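(* Let $r\ge2$ and $s>r$ be integers, and let $G$ be an $(s,s-r)$-starplus on $k$ vertices with excess $\ell$ satisfying $$\ell\le\frac{r\binom{k-s+r}{r}-(k-s+r)}{k-s}.$$ Let $\omega=\omega(n)\to\infty$ as $n\to\infty$ and $$t=n^{\,r-\frac{k-s+r}{\binom{k-s+r}{r}+\ell}}\,\omega.$$ Then there exists a strategy $\mathcal S$ such that $\lim_{n\to\infty}\mathbb P[H_t^{(r,s)}\text{ contains a sub-hypergraph isomorphic to } G]=1$. Consequently, $$\tau^{(r)}_{\mathcal P_G}=r-\frac{k-s+r}{\binom{k-s+r}{r}+\ell}.$$
   Context: For integers $1\le c\le s\le k$, a $k$-vertex $s$-uniform hypergraph is a full $c$-star if its edge set consists of all $\binom{k-c}{s-c}$ $s$-subsets of the vertex set containing a fixed vertex set $C$ with $|C|=c$ (the center). An $(s,c)$-starplus of excess $\ell$ is any $s$-uniform hypergraph obtained from a $k$-vertex full $c$-star by adding $\ell$ further edges (on the same vertex set; they may intersect but not contain $C$). Semi-random hypergraph process with parameters $1\le r\le s$ on $[n]$: start with the empty hypergraph $H_0^{(r,s)}$; in each step $t\ge1$ an $r$-set $U_t$ is chosen uniformly at random from $\binom{[n]}{r}$, the player (knowing the history and $U_t$; possibly randomizing; a rule for doing so is a strategy $\mathcal S$) selects $s-r$ vertices $V_t$ and the multiset edge $U_t\cup V_t$ is added to form $H_t^{(r,s)}$. $\mathcal P_G$ is the property of containing a sub-hypergraph isomorphic to $G$. For a monotonically increasing property $\mathcal P$, strategy $\mathcal S$ and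 $0<q<1$, $\tau^{(r)}_{\mathcal P}(\mathcal S,q,n)$ is the minimum $t\ge0$ with $\mathbb P[H^{(r,s)}_t\in\mathcal P]\ge q$ (or $\infty$), $\tau^{(r)}_{\mathcal P}(q,n)=\inf_{\mathcal S}\tau^{(r)}_{\mathcal P}(\mathcal S,q,n)$, and $\tau^{(r)}_{\mathcal P}=\lim_{q\to1^-}\limsup_{n\to\infty}\frac{\ln\tau^{(r)}_{\mathcal P}(q,n)}{\ln n}$. *)

theory Defs
  imports "HOL-Probability.Probability_Mass_Function" "HOL-Library.Extended_Nat"
    "HOL-Library.Multiset"
begin

section \<open>Hypergraphs, stars and starpluses\<close>

text \<open>A hypergraph without repeated edges: vertex set and edge set.\<close>

type_synonym 'a hypergraph = "'a set \<times> 'a set set"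

definition subsets_of_size :: "nat \<Rightarrow> 'a set \<Rightarrow> 'a set set" where
  "subsets_of_size m V = {e. e \<subseteq> V \<and> card e = m}"

definition full_star :: "nat \<Rightarrow> nat \<Rightarrow> nat \<Rightarrow> 'a set \<Rightarrow> 'a hypergraph \<Rightarrow> bool" where
  "full_star k s c C G \<longleftrightarrow> 1 \<le> c \<and> c \<le> s \<and> s \<le> k \<and>
     (case G of (V, E) \<Rightarrow> finite V \<and> card V = k \<and> C \<subseteq> V \<and> card C = c \<and>
        E = {e \<in> subsets_of_size s V. C \<subseteq> e})"

text \<open>The added edges are new and distinct; since the star is full, an added \<open>s\<close>-set is
  new exactly if it does not contain the center \<open>C\<close>.\<close>

definition starplus :: "nat \<Rightarrow> nat \<Rightarrow> nat \<Rightarrow> nat \<Rightarrow> 'a hypergraph \<Rightarrow> bool" where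
  "starplus k s c l G \<longleftrightarrow> (case G of (V, E) \<Rightarrow>
     \<exists>C E0 F. full_star k s c C (V, E0) \<and>
       F \<subseteq> {e \<in> subsets_of_size s V. \<not> C \<subseteq> e} \<and> card F = l \<and> E = E0 \<union> F)"

definition hypergraph_iso :: "'a hypergraph \<Rightarrow> 'b hypergraph \<Rightarrow> bool" where
  "hypergraph_iso G H \<longleftrightarrow> (case G of (V, E) \<Rightarrow> case H of (V', E') \<Rightarrow>
     \<exists>f. bij_betw f V V' \<and> (\<lambda>e. f ` e) ` E = E')"

text \<open>Hypergraphs produced by the process: edges are multisets of vertices, and edges may
  be parallel.\<close>

type_synonym 'a multihypergraph = "'a set \<times> 'a multiset multiset"

definition sub_hypergraph :: "'a hypergraph \<Rightarrow> 'a multihypergraph \<Rightarrow> bool" where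
  "sub_hypergraph G H \<longleftrightarrow> (case G of (V, E) \<Rightarrow> case H of (W, M) \<Rightarrow>
     V \<subseteq> W \<and> E \<subseteq> Pow V \<and> (\<forall>e\<in>E. mset_set e \<in># M))"

definition contains_copy :: "'a hypergraph \<Rightarrow> 'b multihypergraph \<Rightarrow> bool" where
  "contains_copy G H \<longleftrightarrow> (\<exists>G'. sub_hypergraph G' H \<and> hypergraph_iso G G')"

section \<open>The semi-random hypergraph process\<close>

text \<open>A history lists the pairs \<open>(U\<^sub>i, V\<^sub>i)\<close> in chronological order.\<close>

type_synonym history = "(nat set \<times> nat set) list"

text \<open>For each \<open>n\<close>, a (randomized) strategy maps the history and the current random set
  \<open>U\<^sub>t\<close> to the distribution of the player's reply \<open>V\<^sub>t\<close>.\<close>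

type_synonym strategy = "nat \<Rightarrow> history \<Rightarrow> nat set \<Rightarrow> nat set pmf"

text \<open>The reply may intersect \<open>U\<^sub>t\<close>, in which case the resulting edge has repeated vertices.
  For \<open>n < s\<close> there need not be enough vertices to play, so nothing is required there.\<close>

definition is_strategy :: "nat \<Rightarrow> nat \<Rightarrow> strategy \<Rightarrow> bool" where
  "is_strategy r s S \<longleftrightarrow> (\<forall>n\<ge>s. \<forall>h. \<forall>U \<in> subsets_of_size r {1..n}.
     set_pmf (S n h U) \<subseteq> subsets_of_size (s - r) {1..n})"

primrec play :: "nat \<Rightarrow> strategy \<Rightarrow> nat \<Rightarrow> nat \<Rightarrow> history pmf" where
  "play r S n 0 = return_pmf []"
| "play r S n (Suc t) =
     bind_pmf (play r S n t) (\<lambda>h.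
     bind_pmf (pmf_of_set (subsets_of_size r {1..n})) (\<lambda>U.
     bind_pmf (S n h U) (\<lambda>V. return_pmf (h @ [(U, V)]))))"

definition history_hypergraph :: "nat \<Rightarrow> history \<Rightarrow> nat multihypergraph" where
  "history_hypergraph n h = ({1..n}, mset (map (\<lambda>(U, V). mset_set U + mset_set V) h))"

definition semi_random :: "nat \<Rightarrow> strategy \<Rightarrow> nat \<Rightarrow> nat \<Rightarrow> nat multihypergraph pmf" where
  "semi_random r S n t = map_pmf (history_hypergraph n) (play r S n t)"

section \<open>Thresholds\<close>

definition tau_strategy ::
    "nat \<Rightarrow> (nat multihypergraph \<Rightarrow> bool) \<Rightarrow> strategy \<Rightarrow> real \<Rightarrow> nat \<Rightarrow> enat" where
  "tau_strategy r P S q n =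
     Inf {enat t | t. measure_pmf.prob (semi_random r S n t) {H. P H} \<ge> q}"

definition tau_quantile ::
    "nat \<Rightarrow> nat \<Rightarrow> (nat multihypergraph \<Rightarrow> bool) \<Rightarrow> real \<Rightarrow> nat \<Rightarrow> enat" where
  "tau_quantile r s P q n = (INF S \<in> {S. is_strategy r s S}. tau_strategy r P S q n)"

definition ln_enat :: "enat \<Rightarrow> ereal" where
  "ln_enat x = (case x of enat t \<Rightarrow> if t = 0 then -\<infinity> else ereal (ln (real t)) | \<infinity> \<Rightarrow> \<infinity>)"

definition tau_exponent ::
    "nat \<Rightarrow> nat \<Rightarrow> (nat multihypergraph \<Rightarrow> bool) \<Rightarrow> real \<Rightarrow> ereal" where
  "tau_exponent r s P q =
     limsup (\<lambda>n. ln_enat (tau_quantile r s P q n) / ereal (ln (real n)))"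

definition tau :: "nat \<Rightarrow> nat \<Rightarrow> (nat multihypergraph \<Rightarrow> bool) \<Rightarrow> ereal" where
  "tau r s P = Lim (at_left 1) (tau_exponent r s P)"

text \<open>The limit defining \<^const>\<open>tau\<close> always exists in the extended reals, because
  \<^const>\<open>tau_exponent\<close> is monotone in \<open>q\<close>.\<close>

lemma ln_enat_mono: "x \<le> y \<Longrightarrow> ln_enat x \<le> ln_enat y"
  by (auto simp: ln_enat_def split: enat.splits)

lemma tau_strategy_mono: "p \<le> q \<Longrightarrow> tau_strategy r P S p n \<le> tau_strategy r P S q n"
  unfolding tau_strategy_def by (rule Inf_superset_mono) auto

lemma tau_quantile_mono: "p \<le> q \<Longrightarrow> tau_quantile r s P p n \<le> tau_quantile r s P q n"
  unfolding tau_quantile_def by (rule INF_mono) (auto intro: tau_strategy_mono)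

lemma tau_exponent_mono:
  assumes "p \<le> q"
  shows "tau_exponent r s P p \<le> tau_exponent r s P q"
  unfolding tau_exponent_def
proof (rule Limsup_mono, rule eventually_mono[OF eventually_gt_at_top[of 1]])
  fix n :: nat assume "1 < n"
  then show "ln_enat (tau_quantile r s P p n) / ereal (ln (real n))
      \<le> ln_enat (tau_quantile r s P q n) / ereal (ln (real n))"
    by (intro ereal_divide_right_mono ln_enat_mono tau_quantile_mono assms) simp
qed

lemma tau_tendsto: "(tau_exponent r s P \<longlongrightarrow> tau r s P) (at_left 1)"
proof -
  have "(tau_exponent r s P \<longlongrightarrow> (SUP q\<in>{..<1}. tau_exponent r s P q)) (at_left 1)"
  proof (rule order_tendstoI)
    fix a assume "a < (SUP q\<in>{..<1}. tau_exponent r s P q)"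
    then obtain p where p: "p < 1" "a < tau_exponent r s P p"
      by (auto simp: less_SUP_iff)
    show "eventually (\<lambda>q. a < tau_exponent r s P q) (at_left 1)"
      using eventually_at_left_real[OF p(1)]
    proof (rule eventually_mono)
      fix q assume "q \<in> {p<..<1}"
      then have "tau_exponent r s P p \<le> tau_exponent r s P q"
        by (intro tau_exponent_mono) auto
      with p(2) show "a < tau_exponent r s P q" by simp
    qed
  next
    fix a assume a: "(SUP q\<in>{..<1}. tau_exponent r s P q) < a"
    show "eventually (\<lambda>q. tau_exponent r s P q < a) (at_left 1)"
      using eventually_at_left_real[of 0 "1::real", OF zero_less_one]
    proof (rule eventually_mono)
      fix q :: real assume "q \<in> {0<..<1}"
      then have "tau_exponent r s P q \<le> (SUP q\<in>{..<1}. tau_exponent r s P q)"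
        by (intro SUP_upper) auto
      with a show "tau_exponent r s P q < a" by simp
    qed
  qed
  then show ?thesis
    unfolding tau_def by (simp add: tendsto_Lim)
qed

end

theory Submission
  imports Defs "HOL-Probability.Probability" "HOL-Library.Sublist"
begin

text \<open>Write \<open>m = k - s + r\<close>, \<open>B = m choose r\<close> and \<open>K = B + l\<close>.

  Upper bound: split time into \<open>K\<close> blocks. During the first \<open>B\<close> blocks the player always answers with
  one fixed center, and a second moment argument produces about \<open>n\<^sup>m q\<^sup>B\<close> full stars, where \<open>q\<close> is the
  probability that a given \<open>r\<close>-set is drawn within a block. The bound on \<open>l\<close> says that a star shares an
  \<open>r\<close>-set with only few others, so a large subfamily of pairwise non-competing stars can be chosen.
  Each further block is devoted to one added edge \<open>e\<close>: fix an \<open>r\<close>-set inside \<open>e\<close> that avoids the center;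
  whenever it is drawn for one of the surviving stars, the player completes \<open>e\<close> there. By Chebyshev about
  a fraction \<open>q\<close> of the stars survives each block, and \<open>n\<^sup>m q\<^sup>K\<close> tends to infinity.

  Lower bound: for an ordering of the edges of \<open>G\<close>, count the partial copies built so far. An edge with
  \<open>d\<close> new vertices can only be added if the random \<open>r\<close>-set hits at least \<open>r - d\<close> prescribed vertices, which
  has probability \<open>O(n^(d - r))\<close>. As the first edge is free and the \<open>d\<close> sum up to \<open>k\<close>, the expected number of
  copies after \<open>t\<close> steps is \<open>O(t^K n^(m - r K))\<close>.\<close>

section \<open>Second moments of counting variables\<close>

text \<open>For \<open>k > s\<close> the bound on \<open>l\<close> is the same as
  \<open>m * (l + 1) \<le> r * K\<close>. With \<theta> = m / K and q of order n^(-\<theta>) this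
  says that n^(m - r) q^(B - 1) is bounded up to powers of \<omega>: a given star edge lies, in
  expectation, in boundedly many further stars. Convexity of j choose r carries this over to every
  larger overlap. The obstacle is that a drawn \<open>r\<close>-set can be answered only once,
  although several stars may wait for it. Hence the non-competing family has to be fixed before the
  blocks for the added edges begin. It then depends on earlier blocks only, so the draws of each new
  block are still independent of it, and distinct stars wait for distinct \<open>r\<close>-sets.
  Thinning out the competing stars costs a factor of order w^(B - 1), where w is a slowed-down
  \<omega>, while the expected count n^m q^K is of order w^K. As \<open>B \<le> K\<close>, a factor
  of about w is left over, so \<omega> may grow arbitrarily slowly. The images of different labels
  come from disjoint parts so that a vertex reveals its label; two placements then share an
  \<open>r\<close>-set only where they agree.\<close>

lemma prob_replicate_pmf_subset:
  "measure_pmf.prob (replicate_pmf T p) {xs. set xs \<subseteq> S} = measure_pmf.prob p S ^ T"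
proof (induction T)
  case (Suc T)
  have "emeasure (replicate_pmf (Suc T) p) {xs. set xs \<subseteq> S}
      = (\<integral>\<^sup>+x. \<integral>\<^sup>+xs. indicator S x * indicator {xs. set xs \<subseteq> S} xs \<partial>replicate_pmf T p \<partial>p)"
    by (auto simp: emeasure_bind_pmf indicator_def intro!: nn_integral_cong)
  also have "\<dots> = emeasure p S * emeasure (replicate_pmf T p) {xs. set xs \<subseteq> S}"
    by (simp add: nn_integral_cmult nn_integral_multc)
  also have "\<dots> = ennreal (measure_pmf.prob p S ^ Suc T)"
    using Suc.IH by (simp add: measure_pmf.emeasure_eq_measure ennreal_mult'')
  finally show ?case
    by (simp add: measure_pmf.emeasure_eq_measure del: replicate_pmf.simps)
qed simp

text \<open>Chebyshev's inequality at distance \<open>\<mu> / 2\<close>; the slack \<open>v\<close>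
  of the second moment over the squared mean bounds the variance.\<close>

lemma second_moment_bound:
  fixes p :: "'a pmf" and f :: "'a \<Rightarrow> real"
  assumes fin: "finite (set_pmf p)" and \<mu>: "\<mu> > 0"
    and E: "measure_pmf.expectation p f = \<mu>"
    and E2: "measure_pmf.expectation p (\<lambda>x. (f x)\<^sup>2) \<le> \<mu>\<^sup>2 + v"
  shows "measure_pmf.prob p {x. f x < \<mu> / 2} \<le> 4 * v / \<mu>\<^sup>2"
proof -
  have int: "integrable p g" for g :: "'a \<Rightarrow> real"
    by (rule integrable_measure_pmf_finite[OF fin])
  have "measure_pmf.prob p {x. f x < \<mu> / 2} \<le> measure_pmf.prob p {x. \<mu> / 2 \<le> \<bar>f x - \<mu>\<bar>}"
    by (rule measure_pmf.finite_measure_mono) (auto simp: abs_real_def)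
  also have "\<dots> \<le> measure_pmf.variance p f / (\<mu> / 2)\<^sup>2"
    using measure_pmf.Chebyshev_inequality[of f p "\<mu> / 2"] int \<mu> E by simp
  also have "measure_pmf.variance p f = measure_pmf.expectation p (\<lambda>x. (f x)\<^sup>2) - \<mu>\<^sup>2"
    using measure_pmf.variance_eq[OF int int, of f] E by simp
  also have "(\<dots>) / (\<mu> / 2)\<^sup>2 \<le> v / (\<mu> / 2)\<^sup>2"
    using E2 by (intro divide_right_mono) auto
  finally show ?thesis by (simp add: power_divide mult.commute)
qed

lemma expectation_card:
  fixes p :: "'a pmf"
  assumes "finite (set_pmf p)" "finite I"
  shows "measure_pmf.expectation p (\<lambda>x. real (card {i\<in>I. P i x})) = (\<Sum>i\<in>I. measure_pmf.prob p {x. P i x})"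
proof -
  have "measure_pmf.expectation p (\<lambda>x. real (card {i\<in>I. P i x}))
      = measure_pmf.expectation p (\<lambda>x. \<Sum>i\<in>I. indicator {x. P i x} x)"
    using assms(2) by (simp add: indicator_def sum.If_cases Int_def)
  also have "\<dots> = (\<Sum>i\<in>I. measure_pmf.expectation p (indicator {x. P i x}))"
    by (rule Bochner_Integration.integral_sum) (rule integrable_measure_pmf_finite[OF assms(1)])
  finally show ?thesis by simp
qed

lemma expectation_card_sq:
  fixes p :: "'a pmf"
  assumes "finite (set_pmf p)" "finite I"
  shows "measure_pmf.expectation p (\<lambda>x. (real (card {i\<in>I. P i x}))\<^sup>2)
    = (\<Sum>(i,j)\<in>I \<times> I. measure_pmf.prob p {x. P i x \<and> P j x})"
proof -
  have "measure_pmf.expectation p (\<lambda>x. (real (card {i\<in>I. P i x}))\<^sup>2)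
      = measure_pmf.expectation p (\<lambda>x. real (card {ij\<in>I\<times>I. P (fst ij) x \<and> P (snd ij) x}))"
  proof (rule Bochner_Integration.integral_cong[OF refl])
    fix x
    have "{ij\<in>I\<times>I. P (fst ij) x \<and> P (snd ij) x} = {i\<in>I. P i x} \<times> {i\<in>I. P i x}" by auto
    then show "(real (card {i\<in>I. P i x}))\<^sup>2 = real (card {ij\<in>I\<times>I. P (fst ij) x \<and> P (snd ij) x})"
      by (simp add: card_cartesian_product power2_eq_square)
  qed
  also have "\<dots> = (\<Sum>ij\<in>I\<times>I. measure_pmf.prob p {x. P (fst ij) x \<and> P (snd ij) x})"
    using assms by (intro expectation_card) auto
  finally show ?thesis by (simp add: case_prod_unfold)
qed

text \<open>Pairwise nonpositive correlation leaves only the diagonal terms in the variance, which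
  is therefore at most the mean. This controls the loss of stars during one block.\<close>

lemma prob_few_hits:
  fixes D :: "'b set pmf"
  assumes fin: "finite (set_pmf D)" and finR: "finite R" and q: "q > 0"
    and one: "\<And>e. e \<in> R \<Longrightarrow> measure_pmf.prob D {X. e \<in> X} = q"
    and two: "\<And>e e'. e \<in> R \<Longrightarrow> e' \<in> R \<Longrightarrow> e \<noteq> e' \<Longrightarrow>
      measure_pmf.prob D {X. e \<in> X \<and> e' \<in> X} \<le> q\<^sup>2"
    and ne: "R \<noteq> {}"
  shows "measure_pmf.prob D {X. real (card (R \<inter> X)) < real (card R) * q / 2} \<le> 4 / (real (card R) * q)"
proof -
  let ?\<mu> = "real (card R) * q"
  have \<mu>: "?\<mu> > 0" using ne finR q by (simp add: card_gt_0_iff)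
  have eq: "R \<inter> X = {e\<in>R. e \<in> X}" for X by auto
  have E: "measure_pmf.expectation D (\<lambda>X. real (card (R \<inter> X))) = ?\<mu>"
    unfolding eq by (subst expectation_card[OF fin finR]) (simp add: one)
  have "measure_pmf.expectation D (\<lambda>X. (real (card (R \<inter> X)))\<^sup>2)
      = (\<Sum>i\<in>R. \<Sum>j\<in>R. measure_pmf.prob D {x. i \<in> x \<and> j \<in> x})"
    unfolding eq by (subst expectation_card_sq[OF fin finR]) (simp add: sum.cartesian_product)
  also have "\<dots> \<le> (\<Sum>i\<in>R. \<Sum>j\<in>R. q\<^sup>2 + (if i = j then q else 0))"
  proof (intro sum_mono)
    fix i j assume "i \<in> R" "j \<in> R"
    then show "measure_pmf.prob D {x. i \<in> x \<and> j \<in> x} \<le> q\<^sup>2 + (if i = j then q else 0)"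
      using one[of i] two[of i j] by (cases "i = j") auto
  qed
  also have "\<dots> = (\<Sum>i\<in>R. real (card R) * q\<^sup>2 + q)"
    using finR by (intro sum.cong) (auto simp: sum.distrib sum.delta')
  also have "\<dots> = ?\<mu>\<^sup>2 + ?\<mu>" by (simp add: power2_eq_square algebra_simps)
  finally have "measure_pmf.prob D {X. real (card (R \<inter> X)) < ?\<mu> / 2} \<le> 4 * ?\<mu> / ?\<mu>\<^sup>2"
    by (intro second_moment_bound[OF fin \<mu> E])
  also have "4 * ?\<mu> / ?\<mu>\<^sup>2 = 4 / ?\<mu>" using \<mu> by (simp add: power2_eq_square)
  finally show ?thesis .
qed

section \<open>The set of elements hit by a block of samples\<close>

text \<open>Order and multiplicity of the samples are forgotten, since a single occurrence of an
  awaited set within its block is enough for the player.\<close>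

definition hit_pmf :: "nat \<Rightarrow> 'b set \<Rightarrow> 'b set pmf" where
  "hit_pmf T S = map_pmf set (replicate_pmf T (pmf_of_set S))"

definition hit_prob :: "nat \<Rightarrow> 'b set \<Rightarrow> real" where
  "hit_prob T S = 1 - (1 - 1 / real (card S)) ^ T"

lemma finite_set_hit_pmf:
  assumes "finite S" "S \<noteq> {}"
  shows "finite (set_pmf (hit_pmf T S))"
proof -
  have "{xs \<in> lists S. length xs = T} = {xs. set xs \<subseteq> S \<and> length xs = T}" by auto
  then show ?thesis
    unfolding hit_pmf_def using assms by (simp add: set_replicate_pmf finite_lists_length_eq)
qed

lemma prob_not_hit:
  assumes S: "finite S" "S \<noteq> {}" and R: "R \<subseteq> S"
  shows "measure_pmf.prob (hit_pmf T S) {X. R \<inter> X = {}} = (1 - real (card R) / real (card S)) ^ T"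
proof -
  have "measure_pmf.prob (hit_pmf T S) {X. R \<inter> X = {}}
      = measure_pmf.prob (replicate_pmf T (pmf_of_set S)) {xs. set xs \<subseteq> - R}"
    unfolding hit_pmf_def measure_map_pmf by (rule arg_cong[where f="measure_pmf.prob _"]) auto
  also have "\<dots> = measure_pmf.prob (pmf_of_set S) (- R) ^ T" by (rule prob_replicate_pmf_subset)
  also have "measure_pmf.prob (pmf_of_set S) (- R) = 1 - measure_pmf.prob (pmf_of_set S) R"
    using measure_pmf.prob_compl[of R "pmf_of_set S"] by (simp add: Compl_eq_Diff_UNIV)
  also have "measure_pmf.prob (pmf_of_set S) R = real (card R) / real (card S)"
    using S R by (simp add: measure_pmf_of_set Int_absorb1)
  finally show ?thesis .
qed

lemma prob_hit:
  assumes S: "finite S" and e: "e \<in> S"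
  shows "measure_pmf.prob (hit_pmf T S) {X. e \<in> X} = hit_prob T S"
proof -
  have "measure_pmf.prob (hit_pmf T S) {X. e \<in> X} = 1 - measure_pmf.prob (hit_pmf T S) {X. {e} \<inter> X = {}}"
    by (subst measure_pmf.prob_compl[symmetric]) (auto intro!: arg_cong[where f="measure_pmf.prob _"])
  also have "measure_pmf.prob (hit_pmf T S) {X. {e} \<inter> X = {}} = (1 - 1 / real (card S)) ^ T"
    using prob_not_hit[of S "{e}" T] S e by auto
  finally show ?thesis by (simp add: hit_prob_def)
qed

text \<open>Distinct elements compete for the samples, so their hits are negatively correlated.\<close>

lemma prob_hit2:
  assumes S: "finite S" and e: "e \<in> S" "e' \<in> S" "e \<noteq> e'"
  shows "measure_pmf.prob (hit_pmf T S) {X. e \<in> X \<and> e' \<in> X} \<le> (hit_prob T S)\<^sup>2"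
proof -
  let ?P = "measure_pmf.prob (hit_pmf T S)"
  \<comment> \<open>Two distinct elements make the base \<open>1 - 2 / card S\<close> nonnegative,
    as monotonicity of powers requires.\<close>
  have card: "card S \<ge> 2" using S e card_mono[of S "{e,e'}"] by auto
  let ?A = "{X. e \<in> X}" and ?B = "{X. e' \<in> X}"
  have "?P (?A \<union> ?B) = 1 - ?P {X. {e, e'} \<inter> X = {}}"
    by (subst measure_pmf.prob_compl[symmetric]) (auto intro!: arg_cong[where f="measure_pmf.prob _"])
  also have "?P {X. {e, e'} \<inter> X = {}} = (1 - 2 / real (card S)) ^ T"
    using prob_not_hit[of S "{e,e'}" T] S e by auto
  finally have U: "?P (?A \<union> ?B) = 1 - (1 - 2 / real (card S)) ^ T" .
  have I: "{X. e \<in> X \<and> e' \<in> X} = ?A \<inter> ?B" by auto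
  have "?P (?A \<union> ?B) = ?P ?A + ?P ?B - ?P (?A \<inter> ?B)"
    by (subst measure_Un3) (auto simp: fmeasurable_def less_top[symmetric] measure_pmf.emeasure_finite)
  then have "?P (?A \<inter> ?B) = 2 * hit_prob T S - 1 + (1 - 2 / real (card S)) ^ T"
    using U prob_hit[OF S e(1), of T] prob_hit[OF S e(2), of T] by simp
  \<comment> \<open>With p = \<open>hit_prob T S\<close>, the inequality 1 - 2x \<le> (1 - x)^2
    bounds the joint probability by 2p - 1 + (1 - p)^2 = p^2.\<close>
  moreover have "(1 - 2 / real (card S)) ^ T \<le> ((1 - 1 / real (card S))\<^sup>2) ^ T"
    using card by (intro power_mono) (auto simp: power2_eq_square algebra_simps)
  moreover have "((1 - 1 / real (card S))\<^sup>2) ^ T = (1 - hit_prob T S)\<^sup>2"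
    by (simp add: hit_prob_def power_mult[symmetric] mult.commute)
  ultimately show ?thesis unfolding I by (simp add: power2_eq_square algebra_simps)
qed

text \<open>The upper bound is Bernoulli's inequality. The lower one follows from exp(-p) \<le> 1 /
  (1 + p) \<le> 1 - p / 2, whose last step uses p \<le> 1.\<close>

lemma hit_prob_bounds:
  assumes S: "card S > 0" and le: "real T / real (card S) \<le> 1"
  shows "hit_prob T S \<le> real T / real (card S)" "real T / real (card S) / 2 \<le> hit_prob T S"
    "hit_prob T S \<le> 1"
proof -
  let ?x = "1 / real (card S)" and ?p = "real T / real (card S)"
  have x: "0 \<le> ?x" "?x \<le> 1" using S by auto
  have "1 + real T * (- ?x) \<le> (1 + (- ?x)) ^ T"
    using x by (intro Bernoulli_inequality) auto
  then show "hit_prob T S \<le> ?p" by (simp add: hit_prob_def)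
  show "hit_prob T S \<le> 1" using x by (simp add: hit_prob_def)
  have "(1 - ?x) ^ T \<le> exp (- ?x) ^ T"
    using x exp_ge_add_one_self[of "- ?x"] by (intro power_mono) auto
  also have "\<dots> = exp (- ?p)" by (simp add: exp_of_nat_mult[symmetric])
  also have "\<dots> = 1 / exp ?p" by (simp add: exp_minus field_simps)
  also have "\<dots> \<le> 1 / (1 + ?p)"
    using exp_ge_add_one_self[of ?p] by (intro divide_left_mono) (auto intro!: mult_pos_pos add_pos_nonneg)
  also have "\<dots> \<le> 1 - ?p / 2"
  proof -
    have "0 \<le> u * (1 - u)" if "0 \<le> u" "u \<le> 1" for u :: real using that by (intro mult_nonneg_nonneg) auto
    then have "1 \<le> (1 - u / 2) * (1 + u)" if "0 \<le> u" "u \<le> 1" for u :: real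
      using that by (simp add: algebra_simps)
    from this[of ?p] have "1 \<le> (1 - ?p / 2) * (1 + ?p)" using le by simp
    then show ?thesis by (subst pos_divide_le_eq) (auto intro!: add_pos_nonneg)
  qed
  finally show "?p / 2 \<le> hit_prob T S" by (simp add: hit_prob_def)
qed

section \<open>Large independent sets in sparse graphs\<close>

text \<open>By averaging, at least half of the elements have at most 2D neighbours. A maximal
  independent set among these dominates all of them, and each of its members accounts for at most 2D
  + 1 elements.\<close>

lemma exists_large_independent:
  fixes Y :: "'b set" and R :: "'b \<Rightarrow> 'b \<Rightarrow> bool" and D :: real
  assumes fin: "finite Y" and sym: "\<And>x y. R x y \<Longrightarrow> R y x"
    and pairs: "real (card {(x, y) \<in> Y \<times> Y. R x y}) \<le> D * real (card Y)"
    and D: "D > 0"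
  shows "\<exists>I. I \<subseteq> Y \<and> (\<forall>x\<in>I. \<forall>y\<in>I. x \<noteq> y \<longrightarrow> \<not> R x y) \<and> real (card Y) \<le> 2 * (2 * D + 1) * real (card I)"
proof -
  define dg where "dg x = card {y\<in>Y. R x y}" for x
  define A where "A = {x\<in>Y. real (dg x) \<le> 2 * D}"
  have "{(x, y) \<in> Y \<times> Y. R x y} = (SIGMA x:Y. {y\<in>Y. R x y})" by auto
  then have c: "card {(x, y) \<in> Y \<times> Y. R x y} = (\<Sum>x\<in>Y. dg x)"
    using fin by (simp add: dg_def)
  have "2 * D * real (card (Y - A)) = (\<Sum>x\<in>Y - A. 2 * D)" by simp
  also have "\<dots> \<le> (\<Sum>x\<in>Y - A. real (dg x))" by (rule sum_mono) (auto simp: A_def)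
  also have "\<dots> \<le> (\<Sum>x\<in>Y. real (dg x))" using fin by (intro sum_mono2) auto
  also have "\<dots> \<le> D * real (card Y)" using pairs c by simp
  finally have "2 * real (card (Y - A)) \<le> real (card Y)" using D by (simp add: mult.assoc)
  moreover have "card (Y - A) = card Y - card A" "card A \<le> card Y"
    using fin by (auto simp: A_def intro!: card_Diff_subset card_mono)
  ultimately have half: "real (card Y) \<le> 2 * real (card A)" by simp
  define ind where "ind I \<longleftrightarrow> I \<subseteq> A \<and> (\<forall>x\<in>I. \<forall>y\<in>I. x \<noteq> y \<longrightarrow> \<not> R x y)" for I
  have finA: "finite A" using fin by (simp add: A_def)
  have "finite {I. ind I}" by (rule finite_subset[of _ "Pow A"]) (auto simp: ind_def finA)
  moreover have "{} \<in> {I. ind I}" by (simp add: ind_def)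
  ultimately obtain I where I: "ind I" and max: "\<And>J. ind J \<Longrightarrow> I \<subseteq> J \<Longrightarrow> I = J"
    using finite_has_maximal[of "{I. ind I}"] by auto
  have finI: "finite I" using I finA finite_subset by (auto simp: ind_def)
  \<comment> \<open>By maximality, every low-degree element outside \<open>I\<close> is related to a
    member of \<open>I\<close>.\<close>
  have "A \<subseteq> (\<Union>x\<in>I. insert x {y\<in>Y. R x y})"
  proof
    fix y assume y: "y \<in> A"
    show "y \<in> (\<Union>x\<in>I. insert x {y\<in>Y. R x y})"
    proof (cases "y \<in> I")
      case False
      then have "\<not> ind (insert y I)" using max[of "insert y I"] by auto
      then obtain x where "x \<in> I" "R x y \<or> R y x" using I y by (auto simp: ind_def)
      then show ?thesis using sym y by (auto simp: A_def)
    qed auto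
  qed
  then have "card A \<le> card (\<Union>x\<in>I. insert x {y\<in>Y. R x y})"
    using fin finI by (intro card_mono) auto
  also have "\<dots> \<le> (\<Sum>x\<in>I. card (insert x {y\<in>Y. R x y}))" by (rule card_UN_le[OF finI])
  finally have "real (card A) \<le> (\<Sum>x\<in>I. real (card (insert x {y\<in>Y. R x y})))"
    by (simp flip: of_nat_sum)
  also have "\<dots> \<le> (\<Sum>x\<in>I. 2 * D + 1)"
  proof (rule sum_mono)
    fix x assume "x \<in> I"
    then have "real (dg x) \<le> 2 * D" using I by (auto simp: ind_def A_def)
    moreover have "card (insert x {y\<in>Y. R x y}) \<le> Suc (dg x)"
      unfolding dg_def using card_insert_le_m1 fin by (simp add: card_insert_if)
    ultimately show "real (card (insert x {y\<in>Y. R x y})) \<le> 2 * D + 1" by simp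
  qed
  finally have "real (card A) \<le> (2 * D + 1) * real (card I)" by (simp add: mult.commute)
  with half have "real (card Y) \<le> 2 * (2 * D + 1) * real (card I)" by (simp only: mult.assoc)
  then show ?thesis
    using I A_def by (intro exI[of _ I]) (auto simp: ind_def)
qed

section \<open>Convexity of binomial coefficients\<close>

text \<open>A convex sequence lies below its chords; the inequality is cleared of denominators. The
  increments i choose (r - 1) increase with i, so the increment \<open>d\<close> at \<open>j\<close>
  separates the slopes to the left and to the right of \<open>j\<close>.\<close>

lemma binomial_chord:
  assumes "x \<le> j" "j \<le> y" "r \<ge> 1"
  shows "(real y - real x) * (real (j choose r) - real (x choose r))
    \<le> (real j - real x) * (real (y choose r) - real (x choose r))"
proof -
  define d where "d = real (j choose (r - 1))"
  have pascal: "real (Suc i choose r) = real (i choose r) + real (i choose (r - 1))" for i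
    using assms(3) by (cases r) auto
  have lo: "real (j choose r) - real (x choose r) \<le> (real j - real x) * d"
  proof -
    have "real (i choose r) - real (x choose r) \<le> (real i - real x) * d" if "x \<le> i" "i \<le> j" for i
      using that
    proof (induction i rule: dec_induct)
      case (step i)
      then have "real (i choose (r - 1)) \<le> d"
        unfolding d_def by (intro of_nat_mono binomial_right_mono) simp
      with step show ?case using pascal[of i] by (simp add: algebra_simps)
    qed simp
    then show ?thesis using assms by auto
  qed
  have hi: "(real y - real j) * d \<le> real (y choose r) - real (j choose r)"
  proof -
    have "(real i - real j) * d \<le> real (i choose r) - real (j choose r)" if "j \<le> i" for i
      using that
    proof (induction i rule: dec_induct)
      case (step i)
      then have "d \<le> real (i choose (r - 1))"
        unfolding d_def by (intro of_nat_mono binomial_right_mono) simp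
      with step show ?case using pascal[of i] by (simp add: algebra_simps)
    qed simp
    then show ?thesis using assms by auto
  qed
  have "(real y - real j) * (real (j choose r) - real (x choose r)) \<le> (real y - real j) * ((real j - real x) * d)"
    using assms lo by (intro mult_left_mono) auto
  also have "\<dots> = (real j - real x) * ((real y - real j) * d)" by simp
  also have "\<dots> \<le> (real j - real x) * (real (y choose r) - real (j choose r))"
    using assms hi by (intro mult_left_mono) auto
  finally show ?thesis by (simp add: algebra_simps)
qed

section \<open>The lower bound\<close>

lemma finite_subsets_of_size: "finite V \<Longrightarrow> finite (subsets_of_size r V)"
  unfolding subsets_of_size_def by (rule finite_subset[of _ "Pow V"]) auto

lemma card_subsets_of_size: "finite V \<Longrightarrow> card (subsets_of_size r V) = card V choose r"
  unfolding subsets_of_size_def by (rule n_subsets)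

lemma subsets_of_size_nonempty:
  assumes "finite V" "r \<le> card V"
  shows "subsets_of_size r V \<noteq> {}"
  using card_subsets_of_size[OF assms(1), of r] assms(2) by auto

lemma move_sets:
  assumes "r \<le> n"
  shows "finite (subsets_of_size r {1..n})" "subsets_of_size r {1..n} \<noteq> {}"
  using assms by (simp_all only: finite_subsets_of_size finite_atLeastAtMost subsets_of_size_nonempty card_atLeastAtMost diff_Suc_1 simp_thms
      Suc_eq_plus1[symmetric])

section \<open>Prescribed vertices in a random set\<close>

lemma prob_random_set_superset:
  assumes n: "r \<le> n" and r: "1 \<le> r" and S: "card S \<le> r" "finite S"
  shows "measure_pmf.prob (pmf_of_set (subsets_of_size r {1..n})) {U. S \<subseteq> U}
    \<le> 2 ^ r * real r ^ r / real n ^ card S"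
proof (cases "S \<subseteq> {1..n}")
  case True
  let ?\<Omega> = "subsets_of_size r {1..n}" and ?a = "card S"
  have fin: "finite ?\<Omega>" "?\<Omega> \<noteq> {}"
    by (rule move_sets[OF n])+
  have n0: "real n > 0" using r n by simp
  have "bij_betw (\<lambda>B. S \<union> B) (subsets_of_size (r - ?a) ({1..n} - S)) (?\<Omega> \<inter> {U. S \<subseteq> U})"
  proof (rule bij_betwI[where g="\<lambda>U. U - S"])
    show "(\<lambda>B. S \<union> B) \<in> subsets_of_size (r - ?a) ({1..n} - S) \<rightarrow> ?\<Omega> \<inter> {U. S \<subseteq> U}"
    proof
      fix B assume B: "B \<in> subsets_of_size (r - ?a) ({1..n} - S)"
      then have "finite B" "B \<inter> S = {}" "card B = r - ?a" "B \<subseteq> {1..n}"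
        by (auto simp: subsets_of_size_def intro: finite_subset)
      then show "S \<union> B \<in> ?\<Omega> \<inter> {U. S \<subseteq> U}"
        using S True by (auto simp: subsets_of_size_def card_Un_disjoint Int_commute)
    qed
    show "(\<lambda>U. U - S) \<in> ?\<Omega> \<inter> {U. S \<subseteq> U} \<rightarrow> subsets_of_size (r - ?a) ({1..n} - S)"
      using S by (auto simp: subsets_of_size_def card_Diff_subset)
  qed (auto simp: subsets_of_size_def)
  from bij_betw_same_card[OF this]
  have "card (?\<Omega> \<inter> {U. S \<subseteq> U}) = (n - ?a) choose (r - ?a)"
    using True S by (simp add: card_subsets_of_size card_Diff_subset)
  then have "measure_pmf.prob (pmf_of_set ?\<Omega>) {U. S \<subseteq> U}
      = real ((n - ?a) choose (r - ?a)) / real (n choose r)"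
    using fin by (simp add: measure_pmf_of_set card_subsets_of_size)
  also have "\<dots> = real (r choose ?a) / real (n choose ?a)"
  proof -
    \<comment> \<open>Both sides count pairs of an \<open>r\<close>-set and a subset of it of size
      \<open>card S\<close>. The resulting quotient shows the order n^(-a) directly.\<close>
    have "real (n choose r) * real (r choose ?a) = real (n choose ?a) * real ((n - ?a) choose (r - ?a))"
      using choose_mult[of ?a r n] S n by (simp flip: of_nat_mult)
    moreover have "real (n choose r) > 0" "real (n choose ?a) > 0" using n S by auto
    ultimately show ?thesis by (simp add: field_simps)
  qed
  also have "\<dots> \<le> 2 ^ r / (real n ^ ?a / real r ^ r)"
  proof (rule frac_le)
    show "real (r choose ?a) \<le> 2 ^ r" using binomial_le_pow2[of r ?a] by (metis of_nat_le_iff of_nat_numeral of_nat_power)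
    have "real n ^ ?a / real r ^ r \<le> real n ^ ?a / real ?a ^ ?a"
    proof (rule divide_left_mono)
      have "real ?a ^ ?a \<le> real r ^ ?a" using S by (intro power_mono) auto
      also have "\<dots> \<le> real r ^ r" using S r by (intro power_increasing) auto
      finally show "real ?a ^ ?a \<le> real r ^ r" .
      show "0 < real r ^ r * real ?a ^ ?a" using r by (cases "?a = 0") auto
    qed simp
    also have "\<dots> = (real n / real ?a) ^ ?a" by (simp add: power_divide)
    also have "\<dots> \<le> real (n choose ?a)" using S n by (intro binomial_ge_n_over_k_pow_k) auto
    finally show "real n ^ ?a / real r ^ r \<le> real (n choose ?a)" .
    show "0 < real n ^ ?a / real r ^ r" using n0 r by auto
  qed auto
  finally show ?thesis by simp
next
  case False
  have fin: "finite (subsets_of_size r {1..n})" "subsets_of_size r {1..n} \<noteq> {}"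
    by (rule move_sets[OF n])+
  have "subsets_of_size r {1..n} \<inter> {U. S \<subseteq> U} = {}"
    using False by (auto simp: subsets_of_size_def)
  then show ?thesis using fin by (simp add: measure_pmf_of_set)
qed

text \<open>Union bound over the at most 2^s subsets of \<open>T\<close> of size
  \<open>a\<close>.\<close>

lemma prob_random_set_meets:
  assumes n: "r \<le> n" and r: "1 \<le> r" and a: "a \<le> r" and T: "finite T" "card T \<le> s"
  shows "measure_pmf.prob (pmf_of_set (subsets_of_size r {1..n})) {U. a \<le> card (U \<inter> T)}
    \<le> 2 ^ s * 2 ^ r * real r ^ r / real n ^ a"
proof -
  let ?P = "measure_pmf.prob (pmf_of_set (subsets_of_size r {1..n}))"
  let ?I = "{S. S \<subseteq> T \<and> card S = a}"
  have finI: "finite ?I" using T by auto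
  have "{U. a \<le> card (U \<inter> T)} \<subseteq> (\<Union>S\<in>?I. {U. S \<subseteq> U})"
  proof
    fix U assume "U \<in> {U. a \<le> card (U \<inter> T)}"
    then have "a \<le> card (U \<inter> T)" by simp
    then obtain S where "S \<subseteq> U \<inter> T" "card S = a" by (rule obtain_subset_with_card_n)
    then show "U \<in> (\<Union>S\<in>?I. {U. S \<subseteq> U})" by auto
  qed
  then have "?P {U. a \<le> card (U \<inter> T)} \<le> ?P (\<Union>S\<in>?I. {U. S \<subseteq> U})"
    by (intro measure_pmf.finite_measure_mono) auto
  also have "\<dots> \<le> (\<Sum>S\<in>?I. ?P {U. S \<subseteq> U})"
    by (intro measure_pmf.finite_measure_subadditive_finite finI) auto
  also have "\<dots> \<le> (\<Sum>S\<in>?I. 2 ^ r * real r ^ r / real n ^ a)"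
    using prob_random_set_superset[OF n r] a T by (intro sum_mono) (auto intro: finite_subset)
  also have "\<dots> = real (card ?I) * (2 ^ r * real r ^ r / real n ^ a)" by simp
  also have "\<dots> \<le> 2 ^ s * (2 ^ r * real r ^ r / real n ^ a)"
  proof (rule mult_right_mono)
    have "card ?I \<le> 2 ^ card T" using T(1) binomial_le_pow2[of "card T" a] by (simp add: n_subsets)
    also have "(2::nat) ^ card T \<le> 2 ^ s" using T(2) by (intro power_increasing) auto
    finally have "real (card ?I) \<le> real (2 ^ s)" by (rule of_nat_mono)
    then show "real (card ?I) \<le> 2 ^ s" by simp
  qed auto
  finally show ?thesis by (simp add: mult_ac)
qed

section \<open>Partial copies along an ordering of the edges\<close>

definition move_edge :: "nat set \<times> nat set \<Rightarrow> nat multiset" where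
  "move_edge x = mset_set (fst x) + mset_set (snd x)"

text \<open>The list \<open>es\<close> is read from its end, so that its head is the latest edge.\<close>

definition partial_copies :: "nat \<Rightarrow> 'a set list \<Rightarrow> history \<Rightarrow> ('a \<Rightarrow> nat) set" where
  "partial_copies n es h = {\<phi> \<in> \<Union>(set es) \<rightarrow>\<^sub>E {1..n}.
     subseq (map (\<lambda>e. mset_set (\<phi> ` e)) (rev es)) (map move_edge h)}"

text \<open>The power of 1/n collected along the ordering: each edge contributes the number of
  already placed vertices that the random set must hit. Truncated subtraction makes an edge with at
  least \<open>r\<close> new vertices free.\<close>

primrec deficit :: "nat \<Rightarrow> 'a set list \<Rightarrow> nat" where
  "deficit r [] = 0"
| "deficit r (e # es) = deficit r es + (r - card (e - \<Union>(set es)))"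

text \<open>The first edge is completed by the player at no cost, which accounts for the term \<open>s - r\<close>.\<close>

lemma deficit_ge:
  assumes "r \<le> s" "s > 0"
  shows "es \<noteq> [] \<Longrightarrow> (\<forall>e\<in>set es. card e = s) \<Longrightarrow> r * length es + (s - r) \<le> deficit r es + card (\<Union>(set es))"
proof (induction es)
  case (Cons e es)
  have "finite e'" if "e' \<in> set (e # es)" for e'
    using Cons.prems assms that by (metis card_ge_0_finite)
  then have fin: "finite (\<Union>(set es))" "finite e" by auto
  have "card (e \<union> \<Union>(set es)) = card ((e - \<Union>(set es)) \<union> \<Union>(set es))" by simp
  also have "\<dots> = card (e - \<Union>(set es)) + card (\<Union>(set es))"
    using fin by (intro card_Un_disjoint) auto
  finally have c: "card (\<Union>(set (e # es))) = card (e - \<Union>(set es)) + card (\<Union>(set es))" by simp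
  show ?case
  proof (cases "es = []")
    case True
    \<comment> \<open>For a single edge all \<open>s \<ge> r\<close> vertices are new, so its
      deficit truncates to 0 and both sides equal \<open>s\<close>.\<close>
    with Cons.prems assms show ?thesis by simp
  next
    case False
    with Cons show ?thesis unfolding c by simp
  qed
qed simp

lemma finite_partial_copies: "finite (\<Union>(set es)) \<Longrightarrow> finite (partial_copies n es h)"
  unfolding partial_copies_def by (auto intro!: finite_PiE)

definition extensions :: "nat \<Rightarrow> 'a set \<Rightarrow> 'a set \<Rightarrow> ('a \<Rightarrow> nat) \<Rightarrow> nat multiset \<Rightarrow> ('a \<Rightarrow> nat) set" where
  "extensions n e X \<psi> M = {\<phi> \<in> e \<union> X \<rightarrow>\<^sub>E {1..n}. restrict \<phi> X = \<psi> \<and> mset_set (\<phi> ` e) = M}"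

text \<open>A subsequence of the longer history either avoids the new move or ends with it. In the
  second case the new move realizes the latest edge \<open>e\<close>, and all other edges already
  occur in \<open>h\<close>.\<close>

lemma partial_copies_snoc:
  "partial_copies n (e # es) (h @ [x]) \<subseteq> partial_copies n (e # es) h \<union>
     (\<Union>\<psi>\<in>partial_copies n es h. extensions n e (\<Union>(set es)) \<psi> (move_edge x))"
proof
  fix \<phi> assume \<phi>: "\<phi> \<in> partial_copies n (e # es) (h @ [x])"
  let ?X = "\<Union>(set es)" and ?\<psi> = "restrict \<phi> (\<Union>(set es))"
  have PiE: "\<phi> \<in> e \<union> ?X \<rightarrow>\<^sub>E {1..n}" using \<phi> by (simp add: partial_copies_def)
  have "subseq (map (\<lambda>e. mset_set (\<phi> ` e)) (rev es) @ [mset_set (\<phi> ` e)]) (map move_edge h @ [move_edge x])"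
    using \<phi> by (simp add: partial_copies_def)
  then obtain xs ys where xy: "map (\<lambda>e. mset_set (\<phi> ` e)) (rev es) @ [mset_set (\<phi> ` e)] = xs @ ys"
    "subseq xs (map move_edge h)" "subseq ys [move_edge x]"
    unfolding subseq_append_iff by blast
  show "\<phi> \<in> partial_copies n (e # es) h \<union> (\<Union>\<psi>\<in>partial_copies n es h. extensions n e ?X \<psi> (move_edge x))"
  proof (cases "ys = []")
    case True
    then have "\<phi> \<in> partial_copies n (e # es) h" using xy PiE by (simp add: partial_copies_def)
    then show ?thesis by simp
  next
    case False
    then have "ys = [move_edge x]" using xy(3) by (cases ys) (auto split: if_splits)
    then have eq: "mset_set (\<phi> ` e) = move_edge x" "subseq (map (\<lambda>e. mset_set (\<phi> ` e)) (rev es)) (map move_edge h)"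
      using xy by auto
    have img: "?\<psi> ` e' = \<phi> ` e'" if "e' \<in> set es" for e'
      using that by (intro image_cong) auto
    have "map (\<lambda>e. mset_set (?\<psi> ` e)) (rev es) = map (\<lambda>e. mset_set (\<phi> ` e)) (rev es)"
      by (rule map_cong[OF refl]) (simp add: img del: restrict_apply image_restrict_eq)
    then have "subseq (map (\<lambda>e. mset_set (?\<psi> ` e)) (rev es)) (map move_edge h)"
      using eq(2) by (simp only:)
    moreover have "?\<psi> \<in> \<Union>(set es) \<rightarrow>\<^sub>E {1..n}" using PiE by auto
    ultimately have "?\<psi> \<in> partial_copies n es h"
      by (simp only: partial_copies_def mem_Collect_eq simp_thms)
    moreover have "\<phi> \<in> extensions n e ?X ?\<psi> (move_edge x)"
      using PiE eq(1) by (simp add: extensions_def)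
    ultimately show ?thesis by blast
  qed
qed

text \<open>On \<open>X\<close> an extension is prescribed by \<psi>, so it is determined by its
  values on \<open>e\<close>. These lie in the set of vertices of \<open>M\<close>, of which there
  are at most \<open>s\<close>.\<close>

lemma card_extensions:
  assumes e: "finite e" "card e = s" and X: "finite X"
  shows "card (extensions n e X \<psi> M) \<le> s ^ s"
proof (cases "extensions n e X \<psi> M = {}")
  case False
  then obtain \<phi>0 where "\<phi>0 \<in> extensions n e X \<psi> M" by auto
  then have M: "M = mset_set (\<phi>0 ` e)" by (auto simp: extensions_def)
  have img: "\<phi> ` e = \<phi>0 ` e" if "\<phi> \<in> extensions n e X \<psi> M" for \<phi>
  proof -
    have "mset_set (\<phi> ` e) = mset_set (\<phi>0 ` e)" using that M by (auto simp: extensions_def)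
    then have "set_mset (mset_set (\<phi> ` e)) = set_mset (mset_set (\<phi>0 ` e))" by simp
    then show ?thesis using e by simp
  qed
  have "inj_on (\<lambda>\<phi>. restrict \<phi> e) (extensions n e X \<psi> M)"
  proof (rule inj_onI)
    fix f g assume f: "f \<in> extensions n e X \<psi> M" and g: "g \<in> extensions n e X \<psi> M"
      and eq: "restrict f e = restrict g e"
    have "restrict f X = restrict g X" using f g by (simp add: extensions_def)
    then have "f v = g v" if "v \<in> e \<union> X" for v
      using eq that by (metis UnE restrict_apply')
    moreover have "f \<in> extensional (e \<union> X)" "g \<in> extensional (e \<union> X)"
      using f g by (auto simp: extensions_def PiE_def)
    ultimately show "f = g" by (intro extensionalityI)
  qed
  moreover have "(\<lambda>\<phi>. restrict \<phi> e) ` extensions n e X \<psi> M \<subseteq> e \<rightarrow>\<^sub>E \<phi>0 ` e"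
  proof
    fix g assume "g \<in> (\<lambda>\<phi>. restrict \<phi> e) ` extensions n e X \<psi> M"
    then obtain \<phi> where "\<phi> \<in> extensions n e X \<psi> M" "g = restrict \<phi> e" by auto
    with img[of \<phi>] show "g \<in> e \<rightarrow>\<^sub>E \<phi>0 ` e" by (metis imageI restrict_PiE_iff)
  qed
  ultimately have "card (extensions n e X \<psi> M) \<le> card (e \<rightarrow>\<^sub>E \<phi>0 ` e)"
    using e by (intro card_inj_on_le[of "\<lambda>\<phi>. restrict \<phi> e"]) (auto intro!: finite_PiE)
  also have "\<dots> = card (\<phi>0 ` e) ^ s" using e by (simp add: card_PiE)
  also have "\<dots> \<le> s ^ s" using e card_image_le[of e \<phi>0] by (intro power_mono) auto
  finally show ?thesis .
qed simp

text \<open>An edge completing \<open>\<psi>\<close> has only \<open>card (e - X)\<close> new vertices, so the random set has to hit the old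
  ones at least \<open>r - card (e - X)\<close> times.\<close>

lemma extensions_empty:
  assumes e: "finite e" and U: "finite U" "card U = r"
    and few: "\<not> r - card (e - X) \<le> card (U \<inter> \<psi> ` (e \<inter> X))"
  shows "extensions n e X \<psi> (move_edge (U, V)) = {}"
proof (rule ccontr)
  assume "extensions n e X \<psi> (move_edge (U, V)) \<noteq> {}"
  then obtain \<phi> where \<phi>: "restrict \<phi> X = \<psi>" "mset_set (\<phi> ` e) = mset_set U + mset_set V"
    by (auto simp: extensions_def move_edge_def)
  have "set_mset (mset_set (\<phi> ` e)) = set_mset (mset_set U + mset_set V)" using \<phi> by simp
  then have "U \<subseteq> \<phi> ` e" using e U by auto
  moreover have "\<phi> ` (e \<inter> X) = \<psi> ` (e \<inter> X)" using \<phi>(1) by (intro image_cong) auto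
  moreover have "e = (e \<inter> X) \<union> (e - X)" by auto
  ultimately have "U \<subseteq> \<psi> ` (e \<inter> X) \<union> \<phi> ` (e - X)" by (metis image_Un)
  then have "U \<subseteq> (U \<inter> \<psi> ` (e \<inter> X)) \<union> \<phi> ` (e - X)" by auto
  then have "card U \<le> card ((U \<inter> \<psi> ` (e \<inter> X)) \<union> \<phi> ` (e - X))"
    using e U by (intro card_mono) auto
  also have "\<dots> \<le> card (U \<inter> \<psi> ` (e \<inter> X)) + card (\<phi> ` (e - X))" by (rule card_Un_le)
  also have "card (\<phi> ` (e - X)) \<le> card (e - X)" using e by (intro card_image_le) auto
  finally show False using few U by simp
qed

text \<open>The factor \<open>s ^ s\<close> comes from \<open>card_extensions\<close>, the rest from
  \<open>prob_random_set_meets\<close>.\<close>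

definition step_const :: "nat \<Rightarrow> nat \<Rightarrow> real" where
  "step_const r s = real (s ^ s) * (2 ^ s * 2 ^ r * real r ^ r)"

text \<open>The bound is uniform in the player's reply: for any \<open>V\<close>, a partial copy has
  at most \<open>s ^ s\<close> extensions, and it has none unless the random set hits enough of its
  placed vertices. Only the randomness of \<open>U\<close> enters, which is independent of
  \<open>h\<close>.\<close>

lemma nn_integral_partial_copies_step:
  fixes e :: "'a set" and S :: strategy
  assumes n: "r \<le> n" and r: "1 \<le> r" and s: "0 < s" and es: "\<forall>e'\<in>set (e # es). card e' = s"
  shows "(\<integral>\<^sup>+U. \<integral>\<^sup>+V. ennreal (real (card (partial_copies n (e # es) (h @ [(U, V)])))) \<partial>S n h U
       \<partial>pmf_of_set (subsets_of_size r {1..n}))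
    \<le> ennreal (real (card (partial_copies n (e # es) h))) +
      ennreal (real (card (partial_copies n es h))) *
      ennreal (step_const r s / real n ^ (r - card (e - \<Union>(set es))))"
    (is "?L \<le> _")
proof -
  let ?\<Omega> = "subsets_of_size r {1..n}" and ?X = "\<Union>(set es)"
  let ?a = "r - card (e - \<Union>(set es))"
  let ?Q = "partial_copies n es h"
  let ?c = "real (card (partial_copies n (e # es) h))"
  have fin: "finite ?\<Omega>" "?\<Omega> \<noteq> {}"
    by (rule move_sets[OF n])+
  have "finite e'" if "e' \<in> set (e # es)" for e'
    using es s that by (metis card_ge_0_finite)
  then have finX: "finite ?X" "finite e" by auto
  have finQ: "finite ?Q" using finX(1) by (rule finite_partial_copies)
  \<comment> \<open>The event that \<open>U\<close> hits enough placed vertices of the next edge;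
    outside it \<open>extensions_empty\<close> applies.\<close>
  define B where "B \<psi> = {U. ?a \<le> card (U \<inter> \<psi> ` (e \<inter> ?X))}" for \<psi> :: "'a \<Rightarrow> nat"
  have point: "real (card (partial_copies n (e # es) (h @ [(U, V)])))
      \<le> ?c + (\<Sum>\<psi>\<in>?Q. real (s ^ s) * indicator (B \<psi>) U)"
    if U: "U \<in> ?\<Omega>" for U V
  proof -
    have U': "finite U" "card U = r" using U by (auto simp: subsets_of_size_def intro: finite_subset)
    let ?E = "\<lambda>\<psi>. extensions n e ?X \<psi> (move_edge (U, V))"
    have finE: "finite (?E \<psi>)" for \<psi>
      using finX unfolding extensions_def by (auto intro!: finite_PiE)
    have "card (partial_copies n (e # es) (h @ [(U, V)])) \<le> card (partial_copies n (e # es) h \<union> (\<Union>\<psi>\<in>?Q. ?E \<psi>))"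
      using finX finQ finE by (intro card_mono partial_copies_snoc) (auto intro!: finite_partial_copies)
    also have "\<dots> \<le> card (partial_copies n (e # es) h) + (\<Sum>\<psi>\<in>?Q. card (?E \<psi>))"
      by (intro order.trans[OF card_Un_le] add_left_mono card_UN_le finQ)
    finally have "real (card (partial_copies n (e # es) (h @ [(U, V)]))) \<le> ?c + (\<Sum>\<psi>\<in>?Q. real (card (?E \<psi>)))"
      by (simp flip: of_nat_add of_nat_sum)
    also have "(\<Sum>\<psi>\<in>?Q. real (card (?E \<psi>))) \<le> (\<Sum>\<psi>\<in>?Q. real (s ^ s) * indicator (B \<psi>) U)"
    proof (rule sum_mono)
      fix \<psi> assume "\<psi> \<in> ?Q"
      show "real (card (?E \<psi>)) \<le> real (s ^ s) * indicator (B \<psi>) U"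
      proof (cases "U \<in> B \<psi>")
        case True
        then show ?thesis using card_extensions[of e s ?X n \<psi> "move_edge (U, V)"] finX es by simp
      next
        case False
        then have "?E \<psi> = {}" using U' finX(2) by (intro extensions_empty) (auto simp: B_def)
        then show ?thesis by simp
      qed
    qed
    finally show ?thesis by simp
  qed
  have "?L \<le> (\<integral>\<^sup>+U. \<integral>\<^sup>+V. ennreal (?c + (\<Sum>\<psi>\<in>?Q. real (s ^ s) * indicator (B \<psi>) U)) \<partial>S n h U \<partial>pmf_of_set ?\<Omega>)"
    using point fin by (intro nn_integral_mono_AE AE_pmfI nn_integral_mono ennreal_leI) auto
  also have "\<dots> = (\<integral>\<^sup>+U. ennreal (?c + (\<Sum>\<psi>\<in>?Q. real (s ^ s) * indicator (B \<psi>) U)) \<partial>pmf_of_set ?\<Omega>)"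
    by (simp add: measure_pmf.emeasure_space_1)
  also have "\<dots> = ennreal (measure_pmf.expectation (pmf_of_set ?\<Omega>)
      (\<lambda>U. ?c + (\<Sum>\<psi>\<in>?Q. real (s ^ s) * indicator (B \<psi>) U)))"
    using fin by (intro nn_integral_eq_integral integrable_measure_pmf_finite) (auto intro!: add_nonneg_nonneg sum_nonneg)
  also have "measure_pmf.expectation (pmf_of_set ?\<Omega>) (\<lambda>U. ?c + (\<Sum>\<psi>\<in>?Q. real (s ^ s) * indicator (B \<psi>) U))
      = ?c + (\<Sum>\<psi>\<in>?Q. real (s ^ s) * measure_pmf.prob (pmf_of_set ?\<Omega>) (B \<psi>))"
  proof -
    have int: "integrable (pmf_of_set ?\<Omega>) g" for g :: "nat set \<Rightarrow> real"
      using fin by (intro integrable_measure_pmf_finite) auto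
    show ?thesis
      by (subst Bochner_Integration.integral_add[OF int int], subst Bochner_Integration.integral_sum[OF int]) simp
  qed
  also have "\<dots> \<le> ?c + (\<Sum>\<psi>\<in>?Q. step_const r s / real n ^ ?a)"
  proof (intro add_left_mono sum_mono)
    fix \<psi> assume "\<psi> \<in> ?Q"
    have "card (\<psi> ` (e \<inter> ?X)) \<le> card (e \<inter> ?X)" using finX by (intro card_image_le) auto
    also have "\<dots> \<le> card e" using finX by (intro card_mono) auto
    finally have "card (\<psi> ` (e \<inter> ?X)) \<le> s" using es by simp
    then have "measure_pmf.prob (pmf_of_set ?\<Omega>) (B \<psi>) \<le> 2 ^ s * 2 ^ r * real r ^ r / real n ^ ?a"
      unfolding B_def using n r finX by (intro prob_random_set_meets) auto
    then have "real (s ^ s) * measure_pmf.prob (pmf_of_set ?\<Omega>) (B \<psi>)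
      \<le> real (s ^ s) * (2 ^ s * 2 ^ r * real r ^ r / real n ^ ?a)"
      by (intro mult_left_mono) auto
    then show "real (s ^ s) * measure_pmf.prob (pmf_of_set ?\<Omega>) (B \<psi>) \<le> step_const r s / real n ^ ?a"
      by (simp add: step_const_def)
  qed
  also have "\<dots> = ?c + real (card ?Q) * (step_const r s / real n ^ ?a)" by simp
  also have "ennreal \<dots> = ennreal ?c + ennreal (real (card ?Q)) * ennreal (step_const r s / real n ^ ?a)"
    by (subst ennreal_plus) (auto simp: step_const_def ennreal_mult' simp del: times_divide_eq_right times_divide_eq_left intro!: mult_nonneg_nonneg divide_nonneg_nonneg)
  finally show ?thesis by (simp add: ennreal_leI)
qed

text \<open>Induction on time, for all lists at once, because one step relates the list to its tail.
  The claimed bound solves the resulting recursion.\<close>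

lemma nn_integral_partial_copies:
  fixes es :: "'a set list" and S :: strategy
  assumes n: "r \<le> n" and r: "1 \<le> r" and s: "0 < s" and es: "\<forall>e\<in>set es. card e = s"
  shows "(\<integral>\<^sup>+h. ennreal (real (card (partial_copies n es h))) \<partial>play r S n t)
    \<le> ennreal ((real t * step_const r s) ^ length es / real n ^ deficit r es)"
  using es
proof (induction t arbitrary: es)
  case 0
  show ?case
  proof (cases es)
    case Nil
    then show ?thesis by (simp add: partial_copies_def)
  next
    case (Cons e es')
    then have "partial_copies n es [] = {}" by (auto simp: partial_copies_def)
    then show ?thesis by simp
  qed
next
  case (Suc t)
  show ?case
  proof (cases es)
    case Nil
    then show ?thesis by (simp add: partial_copies_def measure_pmf.emeasure_space_1)
  next
    case (Cons e es')
    let ?\<kappa> = "step_const r s" and ?a = "r - card (e - \<Union>(set es'))"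
    let ?L = "length es'" and ?d = "deficit r es'"
    have \<kappa>: "?\<kappa> \<ge> 0" by (simp add: step_const_def)
    have "(\<integral>\<^sup>+h. ennreal (real (card (partial_copies n es h))) \<partial>play r S n (Suc t))
      = (\<integral>\<^sup>+h. \<integral>\<^sup>+U. \<integral>\<^sup>+V. ennreal (real (card (partial_copies n (e # es') (h @ [(U, V)])))) \<partial>S n h U
       \<partial>pmf_of_set (subsets_of_size r {1..n}) \<partial>play r S n t)"
      using Cons by simp
    also have "\<dots> \<le> (\<integral>\<^sup>+h. ennreal (real (card (partial_copies n (e # es') h))) +
      ennreal (real (card (partial_copies n es' h))) * ennreal (?\<kappa> / real n ^ ?a) \<partial>play r S n t)"
      using nn_integral_partial_copies_step[OF n r s, of e es'] Suc.prems Cons by (intro nn_integral_mono) auto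
    also have "\<dots> = (\<integral>\<^sup>+h. ennreal (real (card (partial_copies n (e # es') h))) \<partial>play r S n t) +
      (\<integral>\<^sup>+h. ennreal (real (card (partial_copies n es' h))) \<partial>play r S n t) * ennreal (?\<kappa> / real n ^ ?a)"
      by (simp add: nn_integral_add nn_integral_multc)
    also have "\<dots> \<le> ennreal ((real t * ?\<kappa>) ^ Suc ?L / real n ^ (?d + ?a)) +
      ennreal ((real t * ?\<kappa>) ^ ?L / real n ^ ?d) * ennreal (?\<kappa> / real n ^ ?a)"
      using Suc.IH[of "e # es'"] Suc.IH[of es'] Suc.prems Cons by (intro add_mono mult_right_mono) auto
    also have "\<dots> = ennreal ((real t * ?\<kappa>) ^ Suc ?L / real n ^ (?d + ?a) + (real t * ?\<kappa>) ^ ?L / real n ^ ?d * (?\<kappa> / real n ^ ?a))"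
      using \<kappa> by (subst ennreal_plus) (auto simp del: times_divide_eq_right times_divide_eq_left simp: ennreal_mult' intro!: divide_nonneg_nonneg mult_nonneg_nonneg)
    also have "\<dots> \<le> ennreal ((real (Suc t) * ?\<kappa>) ^ Suc ?L / real n ^ (?d + ?a))"
    proof (rule ennreal_leI)
      \<comment> \<open>Apart from common factors this is t^(L+1) + t^L = t^L (t + 1), which is then
        increased to (t + 1)^(L+1).\<close>
      have "(real t * ?\<kappa>) ^ Suc ?L / real n ^ (?d + ?a) + (real t * ?\<kappa>) ^ ?L / real n ^ ?d * (?\<kappa> / real n ^ ?a)
        = (real t * ?\<kappa>) ^ ?L * (real (Suc t) * ?\<kappa>) / real n ^ (?d + ?a)"
        by (simp add: power_add add_divide_distrib[symmetric] algebra_simps)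
      also have "\<dots> \<le> (real (Suc t) * ?\<kappa>) ^ ?L * (real (Suc t) * ?\<kappa>) / real n ^ (?d + ?a)"
        using \<kappa> by (intro divide_right_mono mult_right_mono power_mono) auto
      finally show "(real t * ?\<kappa>) ^ Suc ?L / real n ^ (?d + ?a) + (real t * ?\<kappa>) ^ ?L / real n ^ ?d * (?\<kappa> / real n ^ ?a)
        \<le> (real (Suc t) * ?\<kappa>) ^ Suc ?L / real n ^ (?d + ?a)" by (simp only: power_Suc2)
    qed
    finally show ?thesis using Cons by simp
  qed
qed

text \<open>The ordering is read off the history: one occurrence of each edge of the copy is kept,
  and the resulting list is pulled back to \<open>E\<close>. Injectivity of the embedding makes the
  pullback unambiguous.\<close>

lemma contains_copy_imp_partial_copies:
  assumes E: "finite E" and sub: "\<Union>E \<subseteq> V"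
    and copy: "contains_copy (V, E) (history_hypergraph n h)"
  shows "\<exists>es. set es = E \<and> distinct es \<and> partial_copies n es h \<noteq> {}"
proof -
  obtain f V' E' where f: "bij_betw f V V'" "(\<lambda>e. f ` e) ` E = E'" and V': "V' \<subseteq> {1..n}"
    and M: "\<forall>e\<in>E'. mset_set e \<in># mset (map (\<lambda>(U, V). mset_set U + mset_set V) h)"
    using copy unfolding contains_copy_def hypergraph_iso_def sub_hypergraph_def history_hypergraph_def
    by auto
  have mv: "map (\<lambda>(U, V). mset_set U + mset_set V) h = map move_edge h"
    by (auto simp: move_edge_def)
  let ?g = "\<lambda>e. mset_set (f ` e)"
  have finV': "finite V'" using V' finite_subset by blast
  have inj: "inj_on ?g E"
  proof (rule inj_onI)
    fix e e' assume e: "e \<in> E" "e' \<in> E" and eq: "?g e = ?g e'"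
    have s: "e \<subseteq> V" "e' \<subseteq> V" using e sub by auto
    then have "f ` e \<subseteq> V'" "f ` e' \<subseteq> V'" using f(1) by (auto simp: bij_betw_def)
    then have "finite (f ` e)" "finite (f ` e')" using finV' finite_subset by blast+
    with eq have "f ` e = f ` e'" by (metis finite_set_mset_mset_set)
    then show "e = e'" using f(1) s by (auto simp: bij_betw_def inj_on_image_eq_iff)
  qed
  have gE: "?g ` E \<subseteq> set (map move_edge h)" using M f(2) unfolding mv by auto
  define ms where "ms = remdups (filter (\<lambda>x. x \<in> ?g ` E) (map move_edge h))"
  have "subseq (remdups xs) xs" for xs :: "nat multiset list"
    by (induction xs) auto
  then have ss: "subseq ms (map move_edge h)"
    unfolding ms_def by (rule subseq_order.order_trans) simp
  have setms: "set ms = ?g ` E" using gE by (auto simp: ms_def)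
  have dms: "distinct ms" by (simp add: ms_def)
  \<comment> \<open>Reversed, because the head of the list stands for the latest edge.\<close>
  define es where "es = rev (map (inv_into E ?g) ms)"
  have "set es = E" using setms inj by (simp add: es_def inv_into_image_cancel)
  moreover have "distinct es"
    using dms setms by (simp add: es_def distinct_map inj_on_inv_into)
  moreover have "map ?g (rev es) = ms"
  proof -
    have "map ?g (rev es) = map (\<lambda>x. ?g (inv_into E ?g x)) ms" by (simp add: es_def comp_def)
    also have "\<dots> = map (\<lambda>x. x) ms" using setms by (intro map_cong refl f_inv_into_f) auto
    finally show ?thesis by simp
  qed
  moreover have "restrict f (\<Union>E) \<in> partial_copies n es h"
  proof -
    have "map (\<lambda>e. mset_set (restrict f (\<Union>E) ` e)) (rev es) = map ?g (rev es)"
    proof (rule map_cong[OF refl])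
      fix e assume "e \<in> set (rev es)"
      then have "restrict f (\<Union>E) ` e = f ` e" using \<open>set es = E\<close> by (intro image_cong) auto
      then show "mset_set (restrict f (\<Union>E) ` e) = ?g e" by simp
    qed
    moreover have "restrict f (\<Union>E) \<in> \<Union>E \<rightarrow>\<^sub>E {1..n}"
      using f(1) V' sub by (auto simp: bij_betw_def)
    ultimately show ?thesis
      using ss \<open>map ?g (rev es) = ms\<close> \<open>set es = E\<close> by (simp add: partial_copies_def)
  qed
  ultimately show ?thesis by blast
qed

text \<open>Union bound over the orderings of \<open>E\<close>. For each of them the probability is
  at most the expected number of partial copies, and \<open>deficit_ge\<close> bounds the exponent
  independently of the ordering. The constant must not depend on \<open>n\<close>, \<open>S\<close>
  or \<open>t\<close>.\<close>

lemma prob_contains_copy_le: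
  fixes E :: "'a set set"
  assumes E: "finite E" "E \<noteq> {}" and V: "finite V" "\<Union>E \<subseteq> V"
    and s: "\<forall>e\<in>E. card e = s" and r: "1 \<le> r" "r \<le> s"
  shows "\<exists>C>0. \<forall>n\<ge>r. \<forall>S t. measure_pmf.prob (semi_random r S n t) {H. contains_copy (V, E) H}
    \<le> C * real t ^ card E * real n ^ (card V - (s - r)) / real n ^ (r * card E)"
proof -
  let ?ord = "{es. set es = E \<and> distinct es}"
  let ?K = "card E" and ?m = "card V - (s - r)" and ?\<kappa> = "step_const r s"
  define C where "C = (real (card ?ord) + 1) * ?\<kappa> ^ ?K"
  have \<kappa>: "?\<kappa> > 0" using r by (simp add: step_const_def)
  have fin: "finite ?ord"
  proof (rule finite_subset[OF _ finite_lists_length_le[OF E(1), of ?K]])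
    show "?ord \<subseteq> {xs. set xs \<subseteq> E \<and> length xs \<le> ?K}"
    proof
      fix es assume "es \<in> ?ord"
      then show "es \<in> {xs. set xs \<subseteq> E \<and> length xs \<le> ?K}" using distinct_card[of es] by simp
    qed
  qed
  have "measure_pmf.prob (semi_random r S n t) {H. contains_copy (V, E) H}
    \<le> C * real t ^ ?K * real n ^ ?m / real n ^ (r * ?K)" if n: "n \<ge> r" for n S t
  proof -
    have n0: "real n > 0" using n r by simp
    let ?b = "(real t * ?\<kappa>) ^ ?K * real n ^ ?m / real n ^ (r * ?K)"
    have one: "measure_pmf.prob (play r S n t) {h. partial_copies n es h \<noteq> {}} \<le> ?b"
      if es: "es \<in> ?ord" for es
    proof -
      have len: "length es = ?K" using es distinct_card[of es] by auto
      have ne: "es \<noteq> []" using es E by auto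
      have cs: "\<forall>e\<in>set es. card e = s" using es s by auto
      have fU: "finite (\<Union>(set es))" using es V finite_subset by auto
      have "r * ?K + (s - r) \<le> deficit r es + card (\<Union>(set es))"
        using deficit_ge[of r s es] r ne cs len by simp
      also have "card (\<Union>(set es)) \<le> card V" using es V by (intro card_mono) auto
      finally have def_ge: "r * ?K \<le> deficit r es + ?m" by simp
      have "ennreal (measure_pmf.prob (play r S n t) {h. partial_copies n es h \<noteq> {}})
        = (\<integral>\<^sup>+h. indicator {h. partial_copies n es h \<noteq> {}} h \<partial>play r S n t)"
        by (simp add: measure_pmf.emeasure_eq_measure)
      also have "\<dots> \<le> (\<integral>\<^sup>+h. ennreal (real (card (partial_copies n es h))) \<partial>play r S n t)"
      proof (rule nn_integral_mono)
        fix h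
        have "1 \<le> card (partial_copies n es h)" if "partial_copies n es h \<noteq> {}"
          using that finite_partial_copies[OF fU, of n h] by (simp add: Suc_le_eq card_gt_0_iff)
        then show "indicator {h. partial_copies n es h \<noteq> {}} h \<le> ennreal (real (card (partial_copies n es h)))"
          by (auto simp: indicator_def)
      qed
      also have "\<dots> \<le> ennreal ((real t * ?\<kappa>) ^ ?K / real n ^ deficit r es)"
        using nn_integral_partial_copies[OF n r(1), of s es S t] r cs len by simp
      finally have "measure_pmf.prob (play r S n t) {h. partial_copies n es h \<noteq> {}}
          \<le> (real t * ?\<kappa>) ^ ?K / real n ^ deficit r es"
        using \<kappa> by (subst (asm) ennreal_le_iff) auto
      also have "\<dots> \<le> (real t * ?\<kappa>) ^ ?K * real n ^ ?m / real n ^ (r * ?K)"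
      proof -
        have "real n ^ (r * ?K) \<le> real n ^ (deficit r es + ?m)"
          using def_ge n r by (intro power_increasing) auto
        then have "1 / real n ^ deficit r es \<le> real n ^ ?m / real n ^ (r * ?K)"
          using n0 by (simp add: divide_simps power_add mult.commute)
        then have "(real t * ?\<kappa>) ^ ?K * (1 / real n ^ deficit r es) \<le> (real t * ?\<kappa>) ^ ?K * (real n ^ ?m / real n ^ (r * ?K))"
          using \<kappa> by (intro mult_left_mono) auto
        then show ?thesis by simp
      qed
      finally show ?thesis .
    qed
    have "measure_pmf.prob (semi_random r S n t) {H. contains_copy (V, E) H}
      = measure_pmf.prob (play r S n t) {h. contains_copy (V, E) (history_hypergraph n h)}"
      by (simp add: semi_random_def measure_map_pmf vimage_def)
    also have "\<dots> \<le> measure_pmf.prob (play r S n t) (\<Union>es\<in>?ord. {h. partial_copies n es h \<noteq> {}})"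
      using contains_copy_imp_partial_copies[OF E(1) V(2)]
      by (intro measure_pmf.finite_measure_mono) auto
    also have "\<dots> \<le> (\<Sum>es\<in>?ord. measure_pmf.prob (play r S n t) {h. partial_copies n es h \<noteq> {}})"
      using fin by (intro measure_pmf.finite_measure_subadditive_finite) auto
    also have "\<dots> \<le> (\<Sum>es\<in>?ord. ?b)" by (intro sum_mono one)
    also have "\<dots> = real (card ?ord) * ?b" by simp
    also have "\<dots> \<le> (real (card ?ord) + 1) * ?b"
      using \<kappa> by (intro mult_right_mono) auto
    finally show ?thesis by (simp add: C_def power_mult_distrib mult_ac)
  qed
  moreover have "C > 0" using \<kappa> by (auto simp: C_def intro!: mult_pos_pos add_nonneg_pos)
  ultimately show ?thesis by blast
qed

section \<open>Sampling in stages\<close>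

lemma prob_replicate_pmf_nth:
  "measure_pmf.prob (replicate_pmf N p) {xs. \<forall>a<N. xs ! a \<in> Q a} = (\<Prod>a<N. measure_pmf.prob p (Q a))"
proof (induction N arbitrary: Q)
  case (Suc N)
  let ?R = "{xs. \<forall>a<N. xs ! a \<in> Q (Suc a)}"
  have "emeasure (replicate_pmf (Suc N) p) {xs. \<forall>a<Suc N. xs ! a \<in> Q a}
      = (\<integral>\<^sup>+x. \<integral>\<^sup>+xs. indicator (Q 0) x * indicator ?R xs \<partial>replicate_pmf N p \<partial>p)"
    by (auto simp: emeasure_bind_pmf indicator_def All_less_Suc2 intro!: nn_integral_cong)
  also have "\<dots> = emeasure p (Q 0) * emeasure (replicate_pmf N p) ?R"
    by (simp add: nn_integral_cmult nn_integral_multc)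
  also have "\<dots> = ennreal (\<Prod>a<Suc N. measure_pmf.prob p (Q a))"
    using Suc.IH[of "\<lambda>a. Q (Suc a)"]
    by (simp add: measure_pmf.emeasure_eq_measure ennreal_mult'' prod_nonneg prod.lessThan_Suc_shift
        del: prod.lessThan_Suc)
  finally show ?case
    by (simp add: measure_pmf.emeasure_eq_measure prod_nonneg del: replicate_pmf.simps prod.lessThan_Suc)
qed simp

text \<open>Adds the failure probability of one further stage to that of the preceding ones, where
  \<open>X\<close> is the event that these have already failed.\<close>

lemma prob_bind_pmf_le:
  assumes "\<And>x. x \<in> set_pmf p \<Longrightarrow> x \<notin> X \<Longrightarrow> measure_pmf.prob (f x) Y \<le> \<epsilon>" and \<epsilon>: "\<epsilon> \<ge> 0"
  shows "measure_pmf.prob (bind_pmf p f) Y \<le> measure_pmf.prob p X + \<epsilon>"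
proof -
  have "emeasure (bind_pmf p f) Y = (\<integral>\<^sup>+x. emeasure (f x) Y \<partial>p)" by (rule emeasure_bind_pmf)
  also have "\<dots> \<le> (\<integral>\<^sup>+x. indicator X x + ennreal \<epsilon> \<partial>p)"
  proof (intro nn_integral_mono_AE AE_pmfI)
    fix x assume x: "x \<in> set_pmf p"
    show "emeasure (f x) Y \<le> indicator X x + ennreal \<epsilon>"
    proof (cases "x \<in> X")
      case True
      have "emeasure (f x) Y \<le> 1" by (simp add: measure_pmf.emeasure_le_1)
      then show ?thesis using True by (simp add: add_increasing2)
    next
      case False
      then show ?thesis using assms(1)[OF x] by (simp add: measure_pmf.emeasure_eq_measure ennreal_leI)
    qed
  qed
  also have "\<dots> = emeasure p X + ennreal \<epsilon>"
    by (simp add: nn_integral_add measure_pmf.emeasure_space_1)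
  also have "\<dots> = ennreal (measure_pmf.prob p X + \<epsilon>)"
    using \<epsilon> by (simp add: measure_pmf.emeasure_eq_measure ennreal_plus)
  finally show ?thesis
    using \<epsilon> by (simp add: measure_pmf.emeasure_eq_measure del: ennreal_plus)
qed

lemma Markov_pmf:
  fixes f :: "'a \<Rightarrow> real"
  assumes "finite (set_pmf p)" "\<And>x. f x \<ge> 0" "c > 0"
  shows "measure_pmf.prob p {x. c \<le> f x} \<le> measure_pmf.expectation p f / c"
  using integral_Markov_inequality_measure[of p f "{}" c] integrable_measure_pmf_finite[OF assms(1), of f] assms(2,3)
  by simp

text \<open>The recursion defining \<open>replicate_pmf\<close> splits off the first sample, whereas
  both the play and the stages grow at the end.\<close>

lemma replicate_pmf_snoc:
  "replicate_pmf (Suc N) p = bind_pmf (replicate_pmf N p) (\<lambda>xs. map_pmf (\<lambda>x. xs @ [x]) p)"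
  using replicate_pmf_distrib[of N 1 p]
  by (simp add: map_pmf_def bind_assoc_pmf bind_return_pmf del: replicate_pmf.simps(2) flip: One_nat_def)
     (simp add: replicate_pmf_1 map_pmf_def bind_assoc_pmf bind_return_pmf)

text \<open>\<open>D\<close> is the law of the set of \<open>r\<close>-sets drawn in one block; only
  its one-point and two-point probabilities are assumed. A candidate star is a transversal of the
  disjoint sets \<open>P i\<close>. The map \<open>A\<close> enumerates all \<open>r\<close>-sets of
  labels below \<open>B\<close> and continues with the sets awaited for the added edges.\<close>

locale staged_sampling =
  fixes r m B n0 :: nat and P :: "nat \<Rightarrow> 'b set" and A :: "nat \<Rightarrow> nat set"
    and D :: "'b set set pmf" and q :: real and l :: nat
  assumes r: "1 \<le> r" and n0: "0 < n0"
    and finite_D: "finite (set_pmf D)"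
    and finite_P: "i < m \<Longrightarrow> finite (P i)" and card_P: "i < m \<Longrightarrow> card (P i) = n0"
    and disjoint_P: "i < m \<Longrightarrow> j < m \<Longrightarrow> i \<noteq> j \<Longrightarrow> P i \<inter> P j = {}"
    and bij_A: "bij_betw A {..<B} {J. J \<subseteq> {..<m} \<and> card J = r}"
    and A: "a < B + l \<Longrightarrow> A a \<subseteq> {..<m} \<and> card (A a) = r"
    and q: "0 < q" "q \<le> 1"
    and prob1: "\<lbrakk>w \<in> PiE {..<m} P; J \<subseteq> {..<m}; card J = r\<rbrakk> \<Longrightarrow> measure_pmf.prob D {X. w ` J \<in> X} = q"
    and prob2: "\<lbrakk>w \<in> PiE {..<m} P; w' \<in> PiE {..<m} P; J \<subseteq> {..<m}; card J = r; w ` J \<noteq> w' ` J\<rbrakk> \<Longrightarrow>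
      measure_pmf.prob D {X. w ` J \<in> X \<and> w' ` J \<in> X} \<le> q\<^sup>2"
begin

definition agree :: "(nat \<Rightarrow> 'b) \<Rightarrow> (nat \<Rightarrow> 'b) \<Rightarrow> nat set" where
  "agree w w' = {i\<in>{..<m}. w i = w' i}"

definition stars :: "(nat \<Rightarrow> 'b set set) \<Rightarrow> (nat \<Rightarrow> 'b) set" where
  "stars f = {w \<in> PiE {..<m} P. \<forall>a<B. w ` A a \<in> f a}"

text \<open>Such stars share an \<open>r\<close>-set, so in a later block both could wait for the
  same draw, which can complete an edge for only one of them.\<close>

definition conflict :: "(nat \<Rightarrow> 'b) \<Rightarrow> (nat \<Rightarrow> 'b) \<Rightarrow> bool" where
  "conflict w w' \<longleftrightarrow> w \<noteq> w' \<and> r \<le> card (agree w w')"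

definition conflict_free :: "(nat \<Rightarrow> 'b set set) \<Rightarrow> (nat \<Rightarrow> 'b) set \<Rightarrow> bool" where
  "conflict_free f I \<longleftrightarrow> I \<subseteq> stars f \<and> (\<forall>w\<in>I. \<forall>w'\<in>I. \<not> conflict w w')"

text \<open>After \<open>B\<close> stages a largest family of completed stars is selected in which no two stars compete for
  the same \<open>r\<close>-set; later stages only shrink this family.\<close>

primrec live :: "(nat \<Rightarrow> 'b set set) \<Rightarrow> nat \<Rightarrow> (nat \<Rightarrow> 'b) set" where
  "live f 0 = (SOME I. conflict_free f I \<and> (\<forall>J. conflict_free f J \<longrightarrow> card J \<le> card I))"
| "live f (Suc j) = {w \<in> live f j. w ` A (B + j) \<in> f (B + j)}"

declare live.simps(1) [simp del]

lemma finite_W: "finite (PiE {..<m} P)"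
  by (auto intro!: finite_PiE finite_P)

lemma card_W: "card (PiE {..<m} P) = n0 ^ m"
  by (simp add: card_PiE card_P)

lemma finite_stars: "finite (stars f)"
  unfolding stars_def using finite_W by auto

text \<open>A vertex lies in only one part and thus determines its label, so equal images force
  equal values label by label.\<close>

lemma image_eq_iff_agree:
  assumes w: "w \<in> PiE {..<m} P" "w' \<in> PiE {..<m} P" and J: "J \<subseteq> {..<m}"
  shows "w ` J = w' ` J \<longleftrightarrow> J \<subseteq> agree w w'"
proof
  assume eq: "w ` J = w' ` J"
  show "J \<subseteq> agree w w'"
  proof
    fix i assume i: "i \<in> J"
    then obtain j where j: "j \<in> J" "w i = w' j" using eq by auto
    then have "i < m" "j < m" using i J by auto
    moreover have "w i \<in> P i" "w' j \<in> P j" using w \<open>i < m\<close> \<open>j < m\<close> by (auto simp: PiE_iff)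
    ultimately have "i = j" using disjoint_P[of i j] j(2) by auto
    then show "i \<in> agree w w'" using j \<open>i < m\<close> by (simp add: agree_def)
  qed
next
  assume "J \<subseteq> agree w w'"
  then have "w i = w' i" if "i \<in> J" for i using that by (auto simp: agree_def)
  then show "w ` J = w' ` J" by (rule image_cong[OF refl])
qed

lemma agree_commute: "agree w w' = agree w' w"
  unfolding agree_def by auto

lemma finite_agree: "finite (agree w w')"
  by (simp add: agree_def)

text \<open>Blocks are independent. A block whose label set lies in the agreement set waits for the
  same \<open>r\<close>-set twice and costs q once; every other block costs at most q^2. The number
  of blocks of the first kind is the number of \<open>r\<close>-subsets of the agreement
  set.\<close>

lemma prob_stars_pair:
  assumes w: "w \<in> PiE {..<m} P" "w' \<in> PiE {..<m} P"
  shows "measure_pmf.prob (replicate_pmf B D) {fs. w \<in> stars ((!) fs) \<and> w' \<in> stars ((!) fs)}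
    \<le> q ^ (2 * B - (card (agree w w') choose r))"
proof -
  let ?G = "agree w w'" and ?S = "{a\<in>{..<B}. A a \<subseteq> agree w w'}"
  have "bij_betw A ?S {J. J \<subseteq> ?G \<and> card J = r}"
  proof -
    have "?G \<subseteq> {..<m}" by (auto simp: agree_def)
    then have "{J. J \<subseteq> ?G \<and> card J = r} = {J \<in> {J. J \<subseteq> {..<m} \<and> card J = r}. J \<subseteq> ?G}" by blast
    also have "{J. J \<subseteq> {..<m} \<and> card J = r} = A ` {..<B}" using bij_A by (simp add: bij_betw_def)
    also have "{J \<in> A ` {..<B}. J \<subseteq> ?G} = A ` ?S" by blast
    finally have "{J. J \<subseteq> ?G \<and> card J = r} = A ` ?S" .
    moreover have "inj_on A ?S" using bij_betw_imp_inj_on[OF bij_A] by (rule inj_on_subset) blast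
    ultimately show ?thesis by (simp add: bij_betw_def)
  qed
  from bij_betw_same_card[OF this] have cS: "card ?S = card ?G choose r"
    by (simp only: n_subsets[OF finite_agree])
  have cSB: "card ?S \<le> B" using card_mono[of "{..<B}" ?S] by auto
  have "measure_pmf.prob (replicate_pmf B D) {fs. w \<in> stars ((!) fs) \<and> w' \<in> stars ((!) fs)}
    = measure_pmf.prob (replicate_pmf B D) {fs. \<forall>a<B. fs ! a \<in> {X. w ` A a \<in> X \<and> w' ` A a \<in> X}}"
    using w by (intro arg_cong[where f="measure_pmf.prob _"]) (auto simp: stars_def)
  also have "\<dots> = (\<Prod>a<B. measure_pmf.prob D {X. w ` A a \<in> X \<and> w' ` A a \<in> X})"
    by (rule prob_replicate_pmf_nth)
  also have "\<dots> \<le> (\<Prod>a<B. if A a \<subseteq> ?G then q else q\<^sup>2)"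
  proof (intro prod_mono conjI)
    fix a assume "a \<in> {..<B}"
    then have Aa: "A a \<subseteq> {..<m}" "card (A a) = r" using A by auto
    show "measure_pmf.prob D {X. w ` A a \<in> X \<and> w' ` A a \<in> X} \<le> (if A a \<subseteq> ?G then q else q\<^sup>2)"
    proof (cases "A a \<subseteq> ?G")
      case True
      then have "w ` A a = w' ` A a" using image_eq_iff_agree[OF w Aa(1)] by simp
      then show ?thesis using True prob1[OF w(1) Aa] by simp
    next
      case False
      then have "w ` A a \<noteq> w' ` A a" using image_eq_iff_agree[OF w Aa(1)] by simp
      then show ?thesis using False prob2[OF w Aa] by simp
    qed
  qed simp
  also have "\<dots> = q ^ card ?S * (q\<^sup>2) ^ (B - card ?S)"
  proof -
    have "{..<B} \<inter> - {a. A a \<subseteq> ?G} = {..<B} - ?S" "{..<B} \<inter> {a. A a \<subseteq> ?G} = ?S" by auto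
    moreover have "card ({..<B} - ?S) = B - card ?S" by (subst card_Diff_subset) auto
    ultimately show ?thesis by (simp add: prod.If_cases)
  qed
  also have "\<dots> = q ^ (card ?S + 2 * (B - card ?S))" by (simp add: power_add power_mult)
  also have "card ?S + 2 * (B - card ?S) = 2 * B - card ?S" using cSB by simp
  finally show ?thesis by (simp only: cS)
qed

lemma prob_stars:
  assumes w: "w \<in> PiE {..<m} P"
  shows "measure_pmf.prob (replicate_pmf B D) {fs. w \<in> stars ((!) fs)} = q ^ B"
proof -
  have "measure_pmf.prob (replicate_pmf B D) {fs. w \<in> stars ((!) fs)}
    = measure_pmf.prob (replicate_pmf B D) {fs. \<forall>a<B. fs ! a \<in> {X. w ` A a \<in> X}}"
    using w by (intro arg_cong[where f="measure_pmf.prob _"]) (auto simp: stars_def)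
  also have "\<dots> = (\<Prod>a<B. measure_pmf.prob D {X. w ` A a \<in> X})"
    by (rule prob_replicate_pmf_nth)
  also have "\<dots> = (\<Prod>a<B. q)" using prob1[OF w] A by (intro prod.cong) auto
  finally show ?thesis by simp
qed

text \<open>Given the first selection, the second one is free only outside \<open>J\<close>.\<close>

lemma card_agree_pairs:
  assumes J: "J \<subseteq> {..<m}"
  shows "card {ww \<in> PiE {..<m} P \<times> PiE {..<m} P. agree (fst ww) (snd ww) = J} \<le> n0 ^ (2 * m - card J)"
proof -
  let ?X = "{ww \<in> PiE {..<m} P \<times> PiE {..<m} P. agree (fst ww) (snd ww) = J}"
  let ?Y = "PiE {..<m} P \<times> PiE ({..<m} - J) P"
  let ?f = "\<lambda>ww::(nat \<Rightarrow> 'b) \<times> (nat \<Rightarrow> 'b). (fst ww, restrict (snd ww) ({..<m} - J))"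
  have "inj_on ?f ?X"
  proof (rule inj_onI)
    fix x y assume x: "x \<in> ?X" and y: "y \<in> ?X" and eq: "?f x = ?f y"
    have f: "fst x = fst y" using eq by simp
    have "snd x i = snd y i" if i: "i \<in> {..<m}" for i
    proof (cases "i \<in> J")
      case True
      then have "i \<in> agree (fst x) (snd x)" "i \<in> agree (fst y) (snd y)" using x y by auto
      then show ?thesis using f by (simp add: agree_def)
    next
      case False
      then have "i \<in> {..<m} - J" using i by simp
      moreover have "restrict (snd x) ({..<m} - J) i = restrict (snd y) ({..<m} - J) i" using eq by simp
      ultimately show ?thesis by (simp only: restrict_apply')
    qed
    moreover have "snd x \<in> extensional {..<m}" "snd y \<in> extensional {..<m}"
      using x y by (auto simp: PiE_def)
    ultimately have "snd x = snd y" by (intro extensionalityI)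
    with f show "x = y" by (simp add: prod_eq_iff)
  qed
  moreover have "?f ` ?X \<subseteq> ?Y"
  proof
    fix y assume "y \<in> ?f ` ?X"
    then obtain w w' where "y = (w, restrict w' ({..<m} - J))" "w \<in> PiE {..<m} P" "w' \<in> PiE {..<m} P" by auto
    then show "y \<in> ?Y" by (simp only: mem_Sigma_iff restrict_PiE_iff simp_thms) (auto dest: PiE_mem)
  qed
  moreover have "finite ?Y" using finite_P by (auto intro!: finite_PiE)
  ultimately have "card ?X \<le> card ?Y" by (rule card_inj_on_le)
  also have "\<dots> = n0 ^ m * n0 ^ (m - card J)"
  proof -
    have "card ({..<m} - J) = m - card J"
      using J by (subst card_Diff_subset) (auto intro: finite_subset)
    then show ?thesis by (simp add: card_cartesian_product card_W card_PiE card_P)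
  qed
  also have "\<dots> = n0 ^ (2 * m - card J)"
    using card_mono[OF _ J] by (simp add: power_add[symmetric] mult_2)
  finally show ?thesis .
qed

text \<open>Number of pairs with a given agreement set of size \<open>j\<close>, times the
  probability that both are stars.\<close>

definition pair_bound :: "nat \<Rightarrow> real" where
  "pair_bound j = real n0 ^ (2 * m - j) * q ^ (2 * B - (j choose r))"

text \<open>Stated for any family of agreement sets, since the variance needs all of them and the
  conflict count only those of size at least \<open>r\<close> and below \<open>m\<close>.\<close>

lemma sum_prob_stars_pair:
  assumes \<J>: "\<J> \<subseteq> Pow {..<m}"
  shows "(\<Sum>ww\<in>{ww \<in> PiE {..<m} P \<times> PiE {..<m} P. agree (fst ww) (snd ww) \<in> \<J>}.
      measure_pmf.prob (replicate_pmf B D) {fs. fst ww \<in> stars ((!) fs) \<and> snd ww \<in> stars ((!) fs)})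
    \<le> (\<Sum>J\<in>\<J>. pair_bound (card J))"
proof -
  let ?W2 = "PiE {..<m} P \<times> PiE {..<m} P"
  let ?p = "\<lambda>ww. measure_pmf.prob (replicate_pmf B D) {fs. fst ww \<in> stars ((!) fs) \<and> snd ww \<in> stars ((!) fs)}"
  let ?X = "\<lambda>J. {ww \<in> ?W2. agree (fst ww) (snd ww) = J}"
  have finJ: "finite \<J>" using \<J> finite_subset by blast
  have "{ww \<in> ?W2. agree (fst ww) (snd ww) \<in> \<J>} = (\<Union>J\<in>\<J>. ?X J)" by auto
  then have "(\<Sum>ww\<in>{ww \<in> ?W2. agree (fst ww) (snd ww) \<in> \<J>}. ?p ww) = (\<Sum>J\<in>\<J>. \<Sum>ww\<in>?X J. ?p ww)"
    using finJ finite_W by (simp only:) (intro sum.UNION_disjoint, auto)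
  also have "\<dots> \<le> (\<Sum>J\<in>\<J>. pair_bound (card J))"
  proof (rule sum_mono)
    fix J assume J: "J \<in> \<J>"
    have "(\<Sum>ww\<in>?X J. ?p ww) \<le> (\<Sum>ww\<in>?X J. q ^ (2 * B - (card J choose r)))"
      using prob_stars_pair by (intro sum_mono) auto
    also have "\<dots> = real (card (?X J)) * q ^ (2 * B - (card J choose r))" by simp
    also have "\<dots> \<le> pair_bound (card J)"
      unfolding pair_bound_def using card_agree_pairs[of J] J \<J> q
      by (intro mult_right_mono) (auto simp flip: of_nat_power)
    finally show "(\<Sum>ww\<in>?X J. ?p ww) \<le> pair_bound (card J)" .
  qed
  finally show ?thesis .
qed

abbreviation \<mu> :: real where "\<mu> \<equiv> real n0 ^ m * q ^ B"

lemma mu_pos: "\<mu> > 0"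
  using n0 q by simp

lemma B_eq: "B = m choose r"
  using bij_betw_same_card[OF bij_A] n_subsets[of "{..<m}" r] by simp

lemma finite_set_stages: "finite (set_pmf (replicate_pmf N D))"
proof -
  have "{xs \<in> lists (set_pmf D). length xs = N} = {xs. set xs \<subseteq> set_pmf D \<and> length xs = N}" by auto
  then show ?thesis by (simp add: set_replicate_pmf finite_lists_length_eq finite_D)
qed

text \<open>The quantity bounded below by \<beta> is the expected number of stars restricted to
  \<open>j\<close> given labels. Multiplied by \<open>pair_bound j\<close> it gives exactly the
  squared mean, so each of the at most 2^m nonempty agreement sets adds at most a 1/\<beta> fraction
  of it.\<close>

lemma prob_few_stars:
  assumes \<beta>: "\<beta> > 0" "\<And>j. 1 \<le> j \<Longrightarrow> j \<le> m \<Longrightarrow> \<beta> \<le> real n0 ^ j * q ^ (j choose r)"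
  shows "measure_pmf.prob (replicate_pmf B D) {fs. real (card (stars ((!) fs))) < \<mu> / 2} \<le> 4 * 2 ^ m / \<beta>"
proof -
  let ?M = "replicate_pmf B D" and ?W = "PiE {..<m} P"
  have st: "stars f = {w\<in>?W. w \<in> stars f}" for f by (auto simp: stars_def)
  have E: "measure_pmf.expectation ?M (\<lambda>fs. real (card (stars ((!) fs)))) = \<mu>"
    by (subst st, subst expectation_card[OF finite_set_stages finite_W]) (simp add: prob_stars card_W)
  have "measure_pmf.expectation ?M (\<lambda>fs. (real (card (stars ((!) fs))))\<^sup>2)
    = (\<Sum>ww\<in>?W \<times> ?W. measure_pmf.prob ?M {fs. fst ww \<in> stars ((!) fs) \<and> snd ww \<in> stars ((!) fs)})"
    by (subst st, subst expectation_card_sq[OF finite_set_stages finite_W]) (simp add: case_prod_unfold)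
  also have "?W \<times> ?W = {ww \<in> ?W \<times> ?W. agree (fst ww) (snd ww) \<in> Pow {..<m}}"
    by (auto simp: agree_def)
  also have "(\<Sum>ww\<in>\<dots>. measure_pmf.prob ?M {fs. fst ww \<in> stars ((!) fs) \<and> snd ww \<in> stars ((!) fs)})
    \<le> (\<Sum>J\<in>Pow {..<m}. pair_bound (card J))" by (rule sum_prob_stars_pair) simp
  also have "\<dots> \<le> pair_bound 0 + (\<Sum>J\<in>Pow {..<m}. \<mu>\<^sup>2 / \<beta>)"
  proof -
    have "(\<Sum>J\<in>Pow {..<m}. pair_bound (card J)) = pair_bound 0 + (\<Sum>J\<in>Pow {..<m} - {{}}. pair_bound (card J))"
      by (subst sum.remove[of _ "{}"]) auto
    also have "(\<Sum>J\<in>Pow {..<m} - {{}}. pair_bound (card J)) \<le> (\<Sum>J\<in>Pow {..<m} - {{}}. \<mu>\<^sup>2 / \<beta>)"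
    proof (rule sum_mono)
      fix J assume J: "J \<in> Pow {..<m} - {{}}"
      let ?j = "card J"
      have fJ: "finite J" using J finite_subset by auto
      have j: "1 \<le> ?j" "?j \<le> m"
        using J fJ card_mono[of "{..<m}" J] by (auto simp: Suc_le_eq card_gt_0_iff)
      have bj: "?j choose r \<le> B" using j by (simp add: B_eq binomial_right_mono)
      have "pair_bound ?j * (real n0 ^ ?j * q ^ (?j choose r))
        = real n0 ^ ((2 * m - ?j) + ?j) * q ^ ((2 * B - (?j choose r)) + (?j choose r))"
        by (simp add: pair_bound_def power_add)
      also have "\<dots> = \<mu>\<^sup>2" using j bj by (simp add: power_mult_distrib power_mult[symmetric] mult.commute)
      finally have eq: "pair_bound ?j * (real n0 ^ ?j * q ^ (?j choose r)) = \<mu>\<^sup>2" .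
      have "pair_bound ?j * \<beta> \<le> pair_bound ?j * (real n0 ^ ?j * q ^ (?j choose r))"
        using \<beta>(2)[OF j] q by (intro mult_left_mono) (auto simp: pair_bound_def)
      then have "pair_bound ?j * \<beta> \<le> \<mu>\<^sup>2" using eq by simp
      then show "pair_bound ?j \<le> \<mu>\<^sup>2 / \<beta>" using \<beta>(1) by (simp add: pos_le_divide_eq)
    qed
    also have "\<dots> \<le> (\<Sum>J\<in>Pow {..<m}. \<mu>\<^sup>2 / \<beta>)"
      using \<beta>(1) by (intro sum_mono2) auto
    finally show ?thesis by simp
  qed
  \<comment> \<open>Here 0 choose r = 0 because \<open>r \<ge> 1\<close>; the empty agreement set
    gives precisely the squared mean.\<close>
  also have "\<dots> = \<mu>\<^sup>2 + 2 ^ m * \<mu>\<^sup>2 / \<beta>"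
    using r by (simp add: pair_bound_def card_Pow power_mult_distrib power_mult[symmetric] mult.commute binomial_eq_0)
  finally have "measure_pmf.prob ?M {fs. real (card (stars ((!) fs))) < \<mu> / 2} \<le> 4 * (2 ^ m * \<mu>\<^sup>2 / \<beta>) / \<mu>\<^sup>2"
    by (intro second_moment_bound[OF finite_set_stages mu_pos E])
  also have "4 * (2 ^ m * \<mu>\<^sup>2 / \<beta>) / \<mu>\<^sup>2 = 4 * 2 ^ m / \<beta>" using n0 q by simp
  finally show ?thesis .
qed

text \<open>\<Delta> bounds the expected number of ways to complete \<open>j\<close> fixed labels,
  with their edges present, to a full star. Hence the mean number of conflicting pairs is at most
  2^m \<mu> \<Delta>, and Markov's inequality applies.\<close>

lemma prob_many_conflicts:
  assumes \<Delta>: "\<Delta> > 0" "\<And>j. r \<le> j \<Longrightarrow> j < m \<Longrightarrow> real n0 ^ (m - j) * q ^ (B - (j choose r)) \<le> \<Delta>"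
    and \<gamma>: "\<gamma> > 0"
  shows "measure_pmf.prob (replicate_pmf B D)
    {fs. \<gamma> * (2 ^ m * \<mu> * \<Delta>) \<le> real (card {(w, w') \<in> stars ((!) fs) \<times> stars ((!) fs). conflict w w'})} \<le> 1 / \<gamma>"
proof -
  let ?M = "replicate_pmf B D" and ?W = "PiE {..<m} P"
  let ?J = "{J \<in> Pow {..<m}. r \<le> card J \<and> card J < m}"
  let ?X = "{ww \<in> ?W \<times> ?W. agree (fst ww) (snd ww) \<in> ?J}"
  let ?Z = "\<lambda>fs. {ww \<in> ?X. fst ww \<in> stars ((!) fs) \<and> snd ww \<in> stars ((!) fs)}"
  have Z: "{(w, w') \<in> stars ((!) fs) \<times> stars ((!) fs). conflict w w'} \<subseteq> ?Z fs" for fs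
  proof
    fix ww assume "ww \<in> {(w, w') \<in> stars ((!) fs) \<times> stars ((!) fs). conflict w w'}"
    then obtain w w' where ww: "ww = (w, w')" "w \<in> stars ((!) fs)" "w' \<in> stars ((!) fs)" "w \<noteq> w'"
      "r \<le> card (agree w w')" by (auto simp: conflict_def)
    have W: "w \<in> ?W" "w' \<in> ?W" using ww by (auto simp: stars_def)
    have "agree w w' \<noteq> {..<m}"
    proof
      assume "agree w w' = {..<m}"
      then have "\<And>i. i \<in> {..<m} \<Longrightarrow> w i = w' i" by (auto simp: agree_def)
      then have "w = w'" using W by (intro extensionalityI[of w "{..<m}"]) (auto simp: PiE_def)
      with ww show False by simp
    qed
    moreover have "agree w w' \<subseteq> {..<m}" by (auto simp: agree_def)
    ultimately have "card (agree w w') < m"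
      using psubset_card_mono[of "{..<m}" "agree w w'"] by auto
    with \<open>agree w w' \<subseteq> {..<m}\<close> show "ww \<in> ?Z fs" using ww W by auto
  qed
  have finX: "finite ?X" using finite_W by auto
  have "measure_pmf.expectation ?M (\<lambda>fs. real (card (?Z fs)))
    = (\<Sum>ww\<in>?X. measure_pmf.prob ?M {fs. fst ww \<in> stars ((!) fs) \<and> snd ww \<in> stars ((!) fs)})"
    by (rule expectation_card[OF finite_set_stages finX])
  also have "\<dots> \<le> (\<Sum>J\<in>?J. pair_bound (card J))" by (rule sum_prob_stars_pair) auto
  also have "\<dots> \<le> (\<Sum>J\<in>?J. \<mu> * \<Delta>)"
  proof (rule sum_mono)
    fix J assume J: "J \<in> ?J"
    let ?j = "card J"
    have j: "r \<le> ?j" "?j < m" using J by auto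
    have bj: "?j choose r \<le> B" using j by (simp add: B_eq binomial_right_mono)
    have "2 * m - ?j = m + (m - ?j)" "2 * B - (?j choose r) = B + (B - (?j choose r))" using j bj by auto
    then have "pair_bound ?j = \<mu> * (real n0 ^ (m - ?j) * q ^ (B - (?j choose r)))"
      by (simp add: pair_bound_def power_add)
    also have "\<dots> \<le> \<mu> * \<Delta>" using \<Delta>(2)[OF j] mu_pos by (intro mult_left_mono) auto
    finally show "pair_bound ?j \<le> \<mu> * \<Delta>" .
  qed
  also have "\<dots> \<le> (\<Sum>J\<in>Pow {..<m}. \<mu> * \<Delta>)"
    using mu_pos \<Delta>(1) by (intro sum_mono2) auto
  also have "\<dots> = 2 ^ m * \<mu> * \<Delta>" by (simp add: card_Pow)
  finally have E: "measure_pmf.expectation ?M (\<lambda>fs. real (card (?Z fs))) \<le> 2 ^ m * \<mu> * \<Delta>" .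
  have pos: "2 ^ m * \<mu> * \<Delta> > 0" using mu_pos \<Delta>(1) by simp
  have "measure_pmf.prob ?M {fs. \<gamma> * (2 ^ m * \<mu> * \<Delta>) \<le> real (card {(w, w') \<in> stars ((!) fs) \<times> stars ((!) fs). conflict w w'})}
    \<le> measure_pmf.prob ?M {fs. \<gamma> * (2 ^ m * \<mu> * \<Delta>) \<le> real (card (?Z fs))}"
  proof (rule measure_pmf.finite_measure_mono)
    have "card {(w, w') \<in> stars ((!) fs) \<times> stars ((!) fs). conflict w w'} \<le> card (?Z fs)" for fs
      by (intro card_mono Z finite_subset[OF _ finX]) auto
    then show "{fs. \<gamma> * (2 ^ m * \<mu> * \<Delta>) \<le> real (card {(w, w') \<in> stars ((!) fs) \<times> stars ((!) fs). conflict w w'})}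
      \<subseteq> {fs. \<gamma> * (2 ^ m * \<mu> * \<Delta>) \<le> real (card (?Z fs))}"
      by (auto intro: order_trans)
  qed simp
  also have "\<dots> \<le> measure_pmf.expectation ?M (\<lambda>fs. real (card (?Z fs))) / (\<gamma> * (2 ^ m * \<mu> * \<Delta>))"
    using pos \<gamma> by (intro Markov_pmf finite_set_stages mult_pos_pos[of \<gamma>]) auto
  also have "\<dots> \<le> 2 ^ m * \<mu> * \<Delta> / (\<gamma> * (2 ^ m * \<mu> * \<Delta>))"
    using E pos \<gamma> by (intro divide_right_mono) auto
  also have "\<dots> = 1 / \<gamma>" by (rule nonzero_divide_mult_cancel_right[OF less_imp_neq[OF pos, symmetric]])
  finally show ?thesis .
qed

section \<open>The surviving family\<close>

lemma live_0: "conflict_free f (live f 0)" "conflict_free f J \<Longrightarrow> card J \<le> card (live f 0)"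
proof -
  let ?C = "{I. conflict_free f I}"
  have fin: "finite ?C"
    by (rule finite_subset[of _ "Pow (stars f)"]) (auto simp: conflict_free_def finite_stars)
  have "{} \<in> ?C" by (simp add: conflict_free_def)
  then have "Max (card ` ?C) \<in> card ` ?C" using fin by (intro Max_in) auto
  then obtain I where I: "I \<in> ?C" "card I = Max (card ` ?C)" by auto
  have "card J \<le> card I" if "conflict_free f J" for J
    unfolding I(2) using fin that by (intro Max_ge) auto
  with I(1) have "\<exists>I. conflict_free f I \<and> (\<forall>J. conflict_free f J \<longrightarrow> card J \<le> card I)" by blast
  from someI_ex[OF this] show "conflict_free f (live f 0)" "conflict_free f J \<Longrightarrow> card J \<le> card (live f 0)"
    by (simp_all add: live.simps(1))
qed

lemma live_antimono: "j \<le> j' \<Longrightarrow> live f j' \<subseteq> live f j"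
  by (induction j' rule: dec_induct) auto

lemma live_conflict_free: "conflict_free f (live f j)"
  using live_0(1)[of f] live_antimono[of 0 j f] unfolding conflict_free_def by blast

lemma live_subset: "live f j \<subseteq> stars f"
  using live_conflict_free by (auto simp: conflict_free_def)

text \<open>The family of stage \<open>j\<close> is decided by the first \<open>B + j\<close>
  blocks, so it is known to the player, and independent of the draws, when the next block
  starts.\<close>

lemma live_cong: "(\<And>a. a < B + j \<Longrightarrow> f a = g a) \<Longrightarrow> live f j = live g j"
proof (induction j)
  case 0
  then have "stars f = stars g" by (auto simp: stars_def)
  then have "conflict_free f = conflict_free g" by (auto simp: conflict_free_def fun_eq_iff)
  then show ?case by (simp add: live.simps(1))
qed auto

text \<open>Two live stars awaiting the same set would agree on \<open>r\<close> labels and thus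
  conflict. Counting surviving stars becomes counting drawn sets, and a draw identifies the star it
  serves.\<close>

lemma live_inj:
  assumes "j < l"
  shows "inj_on (\<lambda>w. w ` A (B + j)) (live f j)"
proof (rule inj_onI)
  fix w w' assume w: "w \<in> live f j" "w' \<in> live f j" and eq: "w ` A (B + j) = w' ` A (B + j)"
  have W: "w \<in> PiE {..<m} P" "w' \<in> PiE {..<m} P" using w live_subset by (auto simp: stars_def)
  have Aj: "A (B + j) \<subseteq> {..<m}" "card (A (B + j)) = r" using A assms by auto
  then have "A (B + j) \<subseteq> agree w w'" using eq image_eq_iff_agree[OF W] by blast
  then have "r \<le> card (agree w w')" using Aj card_mono[OF finite_agree] by metis
  moreover have "\<not> conflict w w'" using w live_conflict_free by (auto simp: conflict_free_def)
  ultimately show "w = w'" by (simp add: conflict_def)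
qed

text \<open>Unless stars are few or conflicts are many, the conflict graph has bounded average
  degree, and \<open>exists_large_independent\<close> yields a competitor for the maximal family
  \<open>live f 0\<close>.\<close>

lemma prob_live_0:
  assumes \<beta>: "\<beta> > 0" "\<And>j. 1 \<le> j \<Longrightarrow> j \<le> m \<Longrightarrow> \<beta> \<le> real n0 ^ j * q ^ (j choose r)"
    and \<Delta>: "\<Delta> \<ge> 1" "\<And>j. r \<le> j \<Longrightarrow> j < m \<Longrightarrow> real n0 ^ (m - j) * q ^ (B - (j choose r)) \<le> \<Delta>"
    and \<gamma>: "\<gamma> \<ge> 1"
  shows "measure_pmf.prob (replicate_pmf B D) {fs. real (card (live ((!) fs) 0)) < \<mu> / (24 * 2 ^ m * \<gamma> * \<Delta>)}
    \<le> 4 * 2 ^ m / \<beta> + 1 / \<gamma>"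
proof -
  let ?M = "replicate_pmf B D"
  let ?few = "{fs. real (card (stars ((!) fs))) < \<mu> / 2}"
  let ?conf = "\<lambda>fs. {(w, w') \<in> stars ((!) fs) \<times> stars ((!) fs). conflict w w'}"
  let ?many = "{fs. \<gamma> * (2 ^ m * \<mu> * \<Delta>) \<le> real (card (?conf fs))}"
  have "{fs. real (card (live ((!) fs) 0)) < \<mu> / (24 * 2 ^ m * \<gamma> * \<Delta>)} \<subseteq> ?few \<union> ?many"
  proof (rule ccontr)
    assume "\<not> ?thesis"
    then obtain fs where fs: "fs \<in> {fs. real (card (live ((!) fs) 0)) < \<mu> / (24 * 2 ^ m * \<gamma> * \<Delta>)}"
      "fs \<notin> ?few" "fs \<notin> ?many" by blast
    have small: "real (card (live ((!) fs) 0)) < \<mu> / (24 * 2 ^ m * \<gamma> * \<Delta>)" using fs(1) by (simp only: mem_Collect_eq)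
    have N: "\<mu> / 2 \<le> real (card (stars ((!) fs)))" using fs(2) by (simp only: mem_Collect_eq not_less)
    have Z: "real (card (?conf fs)) < \<gamma> * (2 ^ m * \<mu> * \<Delta>)" using fs(3) by (simp only: mem_Collect_eq not_le)
    \<comment> \<open>At least \<mu> / 2 stars share the conflicts, hence the factor 2. As
      \<open>D0 \<ge> 1\<close>, the loss 2 (2 D0 + 1) is at most 6 D0, which leaves \<mu> / (12 D0)
      stars.\<close>
    define D0 where "D0 = 2 * 2 ^ m * \<gamma> * \<Delta>"
    have D0: "D0 \<ge> 1"
    proof -
      have "1 \<le> (2::real) ^ m" by simp
      then have "1 \<le> 2 ^ m * \<gamma>" using \<gamma> mult_mono[of 1 "2 ^ m" 1 \<gamma>] by simp
      then have "1 \<le> 2 ^ m * \<gamma> * \<Delta>" using \<Delta>(1) mult_mono[of 1 "2 ^ m * \<gamma>" 1 \<Delta>] by simp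
      then show ?thesis unfolding D0_def by simp
    qed
    have "real (card (?conf fs)) \<le> D0 * (\<mu> / 2)" using Z by (simp add: D0_def mult_ac)
    also have "\<dots> \<le> D0 * real (card (stars ((!) fs)))" using N D0 by (intro mult_left_mono) auto
    finally obtain I where I: "I \<subseteq> stars ((!) fs)" "\<forall>x\<in>I. \<forall>y\<in>I. x \<noteq> y \<longrightarrow> \<not> conflict x y"
      "real (card (stars ((!) fs))) \<le> 2 * (2 * D0 + 1) * real (card I)"
      using exists_large_independent[of "stars ((!) fs)" conflict D0] finite_stars D0
      by (auto simp: conflict_def agree_commute)
    have "conflict_free ((!) fs) I" using I by (auto simp: conflict_free_def conflict_def)
    then have "card I \<le> card (live ((!) fs) 0)" by (rule live_0)
    then have "2 * (2 * D0 + 1) * real (card I) \<le> 6 * D0 * real (card (live ((!) fs) 0))"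
      using D0 by (intro mult_mono[of "2 * (2 * D0 + 1)" "6 * D0"]) auto
    then have "\<mu> / 2 \<le> 6 * D0 * real (card (live ((!) fs) 0))" using N I(3) by linarith
    then have "\<mu> / (12 * D0) \<le> real (card (live ((!) fs) 0))"
      using D0 by (simp add: pos_divide_le_eq mult_ac)
    then show False using small by (simp add: D0_def mult_ac)
  qed
  then have "measure_pmf.prob ?M {fs. real (card (live ((!) fs) 0)) < \<mu> / (24 * 2 ^ m * \<gamma> * \<Delta>)}
    \<le> measure_pmf.prob ?M (?few \<union> ?many)" by (intro measure_pmf.finite_measure_mono) auto
  also have "\<dots> \<le> measure_pmf.prob ?M ?few + measure_pmf.prob ?M ?many"
    by (intro measure_Un_le) auto
  also have "\<dots> \<le> 4 * 2 ^ m / \<beta> + 1 / \<gamma>"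
    using prob_few_stars[OF \<beta>] prob_many_conflicts[of \<Delta> \<gamma>] \<Delta> \<gamma> by (intro add_mono) auto
  finally show ?thesis .
qed

text \<open>\<open>f\<close> is the past and \<open>g X\<close> continues it by the block outcome
  \<open>X\<close>. The live stars wait for distinct sets, so \<open>prob_few_hits\<close> applies
  to their images.\<close>

lemma prob_live_step:
  assumes j: "j < l" and N: "N > 0" "N \<le> real (card (live f j))"
    and f: "\<And>a X. a < B + j \<Longrightarrow> g X a = f a" "\<And>X. g X (B + j) = X"
  shows "measure_pmf.prob D {X. real (card (live (g X) (Suc j))) < N * (q / 2)} \<le> 4 / (N * q)"
proof -
  let ?L = "live f j" and ?h = "\<lambda>w. w ` A (B + j)"
  have Lf: "live (g X) j = ?L" for X by (rule live_cong) (simp add: f)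
  have c: "card (live (g X) (Suc j)) = card (?h ` ?L \<inter> X)" for X
  proof -
    have "?h ` ?L \<inter> X = ?h ` {w\<in>?L. ?h w \<in> X}" by auto
    moreover have "inj_on ?h {w\<in>?L. ?h w \<in> X}"
      using live_inj[OF j] by (rule inj_on_subset) auto
    ultimately have "card {w\<in>?L. ?h w \<in> X} = card (?h ` ?L \<inter> X)" by (simp only: card_image)
    then show ?thesis using Lf f by simp
  qed
  have cR: "card (?h ` ?L) = card ?L" by (rule card_image[OF live_inj[OF j]])
  have finL: "finite ?L" using live_subset finite_stars finite_subset by blast
  have ne: "?L \<noteq> {}" using N by auto
  have LW: "?L \<subseteq> PiE {..<m} P" using live_subset by (auto simp: stars_def)
  have Aj: "A (B + j) \<subseteq> {..<m}" "card (A (B + j)) = r" using A j by auto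
  have "measure_pmf.prob D {X. real (card (live (g X) (Suc j))) < N * (q / 2)}
    \<le> measure_pmf.prob D {X. real (card (?h ` ?L \<inter> X)) < real (card (?h ` ?L)) * q / 2}"
  proof (rule measure_pmf.finite_measure_mono)
    have "N * (q / 2) \<le> real (card (?h ` ?L)) * q / 2" using N q cR by simp
    then show "{X. real (card (live (g X) (Suc j))) < N * (q / 2)}
      \<subseteq> {X. real (card (?h ` ?L \<inter> X)) < real (card (?h ` ?L)) * q / 2}" unfolding c by auto
  qed simp
  also have "\<dots> \<le> 4 / (real (card (?h ` ?L)) * q)"
  proof (rule prob_few_hits[OF finite_D _ q(1)])
    show "measure_pmf.prob D {X. e \<in> X} = q" if "e \<in> ?h ` ?L" for e
      using that LW prob1 Aj by auto
    show "measure_pmf.prob D {X. e \<in> X \<and> e' \<in> X} \<le> q\<^sup>2" if e: "e \<in> ?h ` ?L" "e' \<in> ?h ` ?L" "e \<noteq> e'" for e e'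
    proof -
      obtain w w' where "e = ?h w" "e' = ?h w'" "w \<in> ?L" "w' \<in> ?L" using e by auto
      then show ?thesis using prob2[of w w' "A (B + j)"] LW Aj e(3) by auto
    qed
  qed (use finL ne in auto)
  also have "\<dots> \<le> 4 / (N * q)"
    using N q cR by (intro divide_left_mono mult_right_mono mult_pos_pos) auto
  finally show ?thesis .
qed

lemma prob_live:
  assumes N: "N > 0" and \<epsilon>: "measure_pmf.prob (replicate_pmf B D) {fs. real (card (live ((!) fs) 0)) < N} \<le> \<epsilon>"
    and j: "j \<le> l"
  shows "measure_pmf.prob (replicate_pmf (B + j) D) {fs. real (card (live ((!) fs) j)) < N * (q / 2) ^ j}
    \<le> \<epsilon> + real j * (4 / (N * (q / 2) ^ l))"
  using j
proof (induction j)
  case 0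
  then show ?case using \<epsilon> by simp
next
  case (Suc j)
  let ?N = "N * (q / 2) ^ j" and ?\<delta> = "4 / (N * (q / 2) ^ l)"
  have Np: "?N > 0" using N q by simp
  have \<delta>: "?\<delta> \<ge> 0" using N q by simp
  have "measure_pmf.prob (replicate_pmf (B + Suc j) D) {fs. real (card (live ((!) fs) (Suc j))) < N * (q / 2) ^ Suc j}
    \<le> measure_pmf.prob (replicate_pmf (B + j) D) {fs. real (card (live ((!) fs) j)) < ?N} + ?\<delta>"
    unfolding add_Suc_right replicate_pmf_snoc
  proof (rule prob_bind_pmf_le)
    fix fs assume fs: "fs \<in> set_pmf (replicate_pmf (B + j) D)" "fs \<notin> {fs. real (card (live ((!) fs) j)) < ?N}"
    have len: "length fs = B + j" using fs by (simp add: set_replicate_pmf)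
    have "measure_pmf.prob (map_pmf (\<lambda>X. fs @ [X]) D) {fs. real (card (live ((!) fs) (Suc j))) < N * (q / 2) ^ Suc j}
      = measure_pmf.prob D {X. real (card (live ((!) (fs @ [X])) (Suc j))) < ?N * (q / 2)}"
      by (simp add: measure_map_pmf vimage_def mult_ac del: live.simps)
    also have "\<dots> \<le> 4 / (?N * q)"
      using fs Suc.prems Np len by (intro prob_live_step[where f="(!) fs"]) (auto simp: nth_append)
    \<comment> \<open>The error of the last and smallest stage serves as a common bound for all
      stages.\<close>
    also have "\<dots> \<le> ?\<delta>"
    proof (rule divide_left_mono)
      have "(q / 2) ^ l \<le> (q / 2) ^ Suc j" using Suc.prems q by (intro power_decreasing) auto
      also have "\<dots> \<le> (q / 2) ^ j * q" using q by simp
      finally show "N * (q / 2) ^ l \<le> ?N * q" using N by (simp add: mult.assoc)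
      show "0 < ?N * q * (N * (q / 2) ^ l)" using N q by simp
    qed simp
    finally show "measure_pmf.prob (map_pmf (\<lambda>X. fs @ [X]) D) {fs. real (card (live ((!) fs) (Suc j))) < N * (q / 2) ^ Suc j} \<le> ?\<delta>" .
  qed (rule \<delta>)
  also have "\<dots> \<le> \<epsilon> + real j * ?\<delta> + ?\<delta>" using Suc by simp
  also have "\<dots> = \<epsilon> + real (Suc j) * ?\<delta>" by (simp only: of_nat_Suc distrib_right mult_1 add.assoc add.commute)
  finally show ?case .
qed

text \<open>The three errors come from too few stars, from too many conflicts, and from the
  \<open>l\<close> later stages. The constant 96 is 4 from Chebyshev times 24 from
  \<open>prob_live_0\<close>. Large \<gamma> helps the second term and harms the third.\<close>

theorem prob_live_empty:
  assumes \<beta>: "\<beta> > 0" "\<And>j. 1 \<le> j \<Longrightarrow> j \<le> m \<Longrightarrow> \<beta> \<le> real n0 ^ j * q ^ (j choose r)"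
    and \<Delta>: "\<Delta> \<ge> 1" "\<And>j. r \<le> j \<Longrightarrow> j < m \<Longrightarrow> real n0 ^ (m - j) * q ^ (B - (j choose r)) \<le> \<Delta>"
    and \<gamma>: "\<gamma> \<ge> 1"
  shows "measure_pmf.prob (replicate_pmf (B + l) D) {fs. live ((!) fs) l = {}}
    \<le> 4 * 2 ^ m / \<beta> + 1 / \<gamma> + 96 * 2 ^ m * 2 ^ l * real l * \<gamma> * \<Delta> / (real n0 ^ m * q ^ (B + l))"
proof -
  let ?N = "\<mu> / (24 * 2 ^ m * \<gamma> * \<Delta>)"
  have N: "?N > 0" by (intro divide_pos_pos mult_pos_pos zero_less_power) (use n0 q \<Delta>(1) \<gamma> in auto)
  have "measure_pmf.prob (replicate_pmf (B + l) D) {fs. live ((!) fs) l = {}}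
    \<le> measure_pmf.prob (replicate_pmf (B + l) D) {fs. real (card (live ((!) fs) l)) < ?N * (q / 2) ^ l}"
  proof (rule measure_pmf.finite_measure_mono)
    have "0 < ?N * (q / 2) ^ l" by (intro mult_pos_pos N zero_less_power) (use q in simp)
    then show "{fs. live ((!) fs) l = {}} \<subseteq> {fs. real (card (live ((!) fs) l)) < ?N * (q / 2) ^ l}"
      by (intro subsetI) (simp only: mem_Collect_eq card.empty of_nat_0)
  qed simp
  also have "\<dots> \<le> 4 * 2 ^ m / \<beta> + 1 / \<gamma> + real l * (4 / (?N * (q / 2) ^ l))"
    by (intro prob_live[OF N] prob_live_0 \<beta> \<Delta> \<gamma>) auto
  also have "real l * (4 / (?N * (q / 2) ^ l)) = 96 * 2 ^ m * 2 ^ l * real l * \<gamma> * \<Delta> / (real n0 ^ m * q ^ (B + l))"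
  proof -
    have "?N * (q / 2) ^ l = (real n0 ^ m * q ^ (B + l)) / (24 * 2 ^ m * 2 ^ l * \<gamma> * \<Delta>)"
      by (simp add: power_divide power_add mult_ac)
    then show ?thesis by (simp add: mult_ac)
  qed
  finally show ?thesis .
qed

end

section \<open>The player's strategy\<close>

definition run :: "(history \<Rightarrow> nat set \<Rightarrow> nat set) \<Rightarrow> nat set list \<Rightarrow> history" where
  "run g us = foldl (\<lambda>h U. h @ [(U, g h U)]) [] us"

lemma run_simps [simp]: "run g [] = []" "run g (us @ [U]) = run g us @ [(U, g (run g us) U)]"
  by (simp_all add: run_def)

lemma map_fst_run [simp]: "map fst (run g us) = us"
  by (induction us rule: rev_induct) auto

lemma length_run [simp]: "length (run g us) = length us"
  by (induction us rule: rev_induct) auto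

lemma nth_run: "i < length us \<Longrightarrow> run g us ! i = (us ! i, g (run g (take i us)) (us ! i))"
proof (induction us rule: rev_induct)
  case (snoc U us)
  then show ?case by (cases "i = length us") (auto simp: nth_append)
qed simp

text \<open>With deterministic replies the history is a function of the random sets alone, so the
  play is an image of independent uniform samples.\<close>

lemma play_deterministic:
  assumes "S n = (\<lambda>h U. return_pmf (g h U))"
  shows "play r S n t = map_pmf (run g) (replicate_pmf t (pmf_of_set (subsets_of_size r {1..n})))"
proof (induction t)
  case (Suc t)
  then show ?case
    unfolding replicate_pmf_snoc
    by (simp add: assms map_pmf_def bind_assoc_pmf bind_return_pmf)
qed simp

section \<open>Cutting the moves into blocks\<close>

definition block :: "nat \<Rightarrow> 'b list \<Rightarrow> nat \<Rightarrow> 'b set" where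
  "block T us a = set (take T (drop (a * T) us))"

lemma block_take: "Suc a * T \<le> i \<Longrightarrow> block T (take i us) a = block T us a"
  unfolding block_def by (simp add: drop_take min_def)

lemma block_concat:
  "a < length bs \<Longrightarrow> \<forall>b\<in>set bs. length b = T \<Longrightarrow> block T (concat bs) a = set (bs ! a)"
proof (induction bs arbitrary: a)
  case (Cons b bs)
  then show ?case by (cases a) (auto simp: block_def)
qed simp

lemma in_blockE:
  assumes "U \<in> block T us a" "Suc a * T \<le> length us"
  obtains i where "i < length us" "i div T = a" "a * T \<le> i" "us ! i = U"
proof -
  from assms obtain x where x: "x < T" "take T (drop (a * T) us) ! x = U"
    unfolding block_def in_set_conv_nth by auto
  show ?thesis
    by (rule that[of "a * T + x"]) (use x assms(2) in auto)
qed

lemma replicate_pmf_map: "replicate_pmf N (map_pmf f p) = map_pmf (map f) (replicate_pmf N p)"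
  by (induction N) (simp_all add: map_pmf_def bind_assoc_pmf bind_return_pmf)

lemma replicate_pmf_concat: "replicate_pmf (K * T) p = map_pmf concat (replicate_pmf K (replicate_pmf T p))"
proof (induction K)
  case (Suc K)
  have "replicate_pmf (Suc K * T) p = replicate_pmf (T + K * T) p" by simp
  also have "\<dots> = map_pmf concat (replicate_pmf (Suc K) (replicate_pmf T p))"
    unfolding replicate_pmf_distrib Suc.IH by (simp add: map_pmf_def bind_assoc_pmf bind_return_pmf)
  finally show ?case .
qed simp

text \<open>Vertices outside the center are labelled by \<open>h\<close>, and a placement chooses the image of label \<open>i\<close> from
  the \<open>i\<close>-th of \<open>m\<close> disjoint parts of size \<open>n0\<close>. Block \<open>a < m choose r\<close> waits for the labels \<open>A a\<close> of a star edge,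
  block \<open>(m choose r) + j\<close> for \<open>r\<close> labels inside the added edge \<open>F j\<close>.\<close>

locale starplus_game =
  fixes r s m l n n0 T :: nat and A :: "nat \<Rightarrow> nat set" and V C :: "'a set"
    and F :: "nat \<Rightarrow> 'a set" and h hC :: "'a \<Rightarrow> nat"
  assumes sizes: "1 \<le> r" "r < s" "r \<le> m" and finite_V: "finite V" and C: "C \<subseteq> V"
    and hC: "bij_betw hC C {1..s - r}" and h: "bij_betw h (V - C) {..<m}"
    and bij_A: "bij_betw A {..<m choose r} {J. J \<subseteq> {..<m} \<and> card J = r}"
    and F: "j < l \<Longrightarrow> F j \<subseteq> V \<and> card (F j) = s \<and> A ((m choose r) + j) \<subseteq> h ` (F j - C) \<and> card (A ((m choose r) + j)) = r"
    and pos: "0 < n0" "0 < T" and n: "(s - r) + m * n0 \<le> n"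
begin

text \<open>The center is placed on 1, ..., s - r; the parts follow it as consecutive intervals of
  length \<open>n0\<close>.\<close>

definition part :: "nat \<Rightarrow> nat set" where
  "part i = {s - r + i * n0 + 1..s - r + (i + 1) * n0}"

abbreviation moves :: "nat set set" where
  "moves \<equiv> subsets_of_size r {1..n}"

lemma part_subset: "i < m \<Longrightarrow> part i \<subseteq> {s - r + 1..n}"
proof -
  assume "i < m"
  then have "(i + 1) * n0 \<le> m * n0" by (intro mult_right_mono) auto
  then show ?thesis using n by (auto simp: part_def)
qed

lemma part_disjoint: "i \<noteq> j \<Longrightarrow> part i \<inter> part j = {}"
proof -
  have *: "part i \<inter> part j = {}" if "i < j" for i j
  proof -
    have "(i + 1) * n0 \<le> j * n0" using that by (intro mult_right_mono) auto
    then show ?thesis by (auto simp: part_def)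
  qed
  assume "i \<noteq> j"
  then show ?thesis using *[of i j] *[of j i] by (cases "i < j") auto
qed

lemma r_le_n: "r \<le> n"
proof -
  have "r * 1 \<le> m * n0" using sizes pos by (intro mult_mono) auto
  then show ?thesis using n by simp
qed

lemma card_moves: "card moves > 0"
  using move_sets[OF r_le_n] card_gt_0_iff by blast

lemma selection_inj:
  assumes "w \<in> PiE {..<m} part"
  shows "inj_on w {..<m}"
proof (rule inj_onI)
  fix i j assume ij: "i \<in> {..<m}" "j \<in> {..<m}" "w i = w j"
  have "w i \<in> part i" "w j \<in> part j" using PiE_mem[OF assms] ij(1,2) by blast+
  then show "i = j" using part_disjoint[of i j] ij(3) by auto
qed

lemma selection_in_moves:
  assumes w: "w \<in> PiE {..<m} part" and J: "J \<subseteq> {..<m}" "card J = r"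
  shows "w ` J \<in> moves"
proof -
  have "card (w ` J) = r" using card_image[OF inj_on_subset[OF selection_inj[OF w] J(1)]] J by simp
  moreover have "w ` J \<subseteq> {1..n}"
  proof
    fix x assume "x \<in> w ` J"
    then obtain i where "i < m" "x \<in> part i" using PiE_mem[OF w] J by auto
    then show "x \<in> {1..n}" using part_subset[of i] by auto
  qed
  ultimately show ?thesis by (simp add: subsets_of_size_def)
qed

lemma A_set: "a < (m choose r) + l \<Longrightarrow> A a \<subseteq> {..<m} \<and> card (A a) = r"
proof (cases "a < m choose r")
  case True
  then show ?thesis using bij_betwE[OF bij_A] by auto
next
  case False
  assume a: "a < (m choose r) + l"
  define j where "j = a - (m choose r)"
  have j: "j < l" "a = (m choose r) + j" using a False by (auto simp: j_def)
  have "h ` (F j - C) \<subseteq> {..<m}" using F[OF j(1)] h by (auto simp: bij_betw_def)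
  then show ?thesis using F[OF j(1)] unfolding j(2) by blast
qed

lemma hit_prob_pos: "0 < hit_prob T moves"
proof -
  have "(1 - 1 / real (card moves)) ^ T \<le> (1 - 1 / real (card moves)) ^ 1"
    using card_moves pos by (intro power_decreasing) auto
  also have "\<dots> < 1" using card_moves by simp
  finally have "(1 - 1 / real (card moves)) ^ T < 1" .
  then show ?thesis by (simp add: hit_prob_def)
qed

sublocale staged_sampling r m "m choose r" n0 part A "hit_pmf T moves" "hit_prob T moves" l
proof
  show "finite (set_pmf (hit_pmf T moves))"
    by (rule finite_set_hit_pmf[OF move_sets[OF r_le_n]])
  show "hit_prob T moves \<le> 1"
    using card_moves by (auto simp: hit_prob_def intro!: zero_le_power)
  show "measure_pmf.prob (hit_pmf T moves) {X. w ` J \<in> X} = hit_prob T moves"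
    if "w \<in> PiE {..<m} part" "J \<subseteq> {..<m}" "card J = r" for w J
    using that by (intro prob_hit selection_in_moves move_sets[OF r_le_n])
  show "measure_pmf.prob (hit_pmf T moves) {X. w ` J \<in> X \<and> w' ` J \<in> X} \<le> (hit_prob T moves)\<^sup>2"
    if "w \<in> PiE {..<m} part" "w' \<in> PiE {..<m} part" "J \<subseteq> {..<m}" "card J = r" "w ` J \<noteq> w' ` J" for w w' J
    using that by (intro prob_hit2 selection_in_moves move_sets[OF r_le_n])
qed (use sizes pos part_disjoint bij_A A_set hit_prob_pos in \<open>auto simp: part_def\<close>)

definition placement :: "(nat \<Rightarrow> nat) \<Rightarrow> 'a \<Rightarrow> nat" where
  "placement w v = (if v \<in> C then hC v else w (h v))"

text \<open>Here \<open>a\<close> is the current block and \<open>j\<close> the added edge it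
  serves. The \<open>THE\<close> term is meaningful if a live star waits for \<open>U\<close>, and
  it is then unique by \<open>live_inj\<close>.\<close>

definition reply :: "nat set list \<Rightarrow> nat set \<Rightarrow> nat set" where
  "reply us U = (let a = length us div T; j = a - (m choose r); w = (THE w. w \<in> live (block T us) j \<and> w ` A a = U)
     in if a < m choose r then {1..s - r} else placement w ` F j - U)"

text \<open>If no live star waits for \<open>U\<close>, the reply may have the wrong size or leave
  the vertex set. Falling back on the center makes the rule legal after every history.\<close>

definition legal_reply :: "history \<Rightarrow> nat set \<Rightarrow> nat set" where
  "legal_reply hs U = (let X = reply (map fst hs) U in if X \<in> subsets_of_size (s - r) {1..n} then X else {1..s - r})"

abbreviation edges :: "'a set set" where
  "edges \<equiv> {e \<in> subsets_of_size s V. C \<subseteq> e} \<union> F ` {..<l}"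

lemma center_legal: "{1..s - r} \<in> subsets_of_size (s - r) {1..n}"
  using n by (auto simp: subsets_of_size_def)

lemma legal_reply_legal: "legal_reply hs U \<in> subsets_of_size (s - r) {1..n}"
  using center_legal by (simp add: legal_reply_def Let_def)

lemma placement_inj:
  assumes w: "w \<in> PiE {..<m} part"
  shows "inj_on (placement w) V" "placement w ` V \<subseteq> {1..n}"
proof -
  have cen: "placement w v \<in> {1..s - r}" if "v \<in> C" for v
    using bij_betwE[OF hC] that by (simp add: placement_def)
  have out: "placement w v \<in> {s - r + 1..n}" if "v \<in> V - C" for v
  proof -
    have hv: "h v < m" using bij_betwE[OF h] that by auto
    then have "w (h v) \<in> part (h v)" using PiE_mem[OF w] by auto
    then show ?thesis using part_subset[OF hv] that by (auto simp: placement_def)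
  qed
  show "placement w ` V \<subseteq> {1..n}"
  proof
    fix x assume "x \<in> placement w ` V"
    then obtain v where v: "v \<in> V" "x = placement w v" by auto
    show "x \<in> {1..n}"
    proof (cases "v \<in> C")
      case True
      then show ?thesis using cen[of v] v n by auto
    next
      case False
      then show ?thesis using out[of v] v by auto
    qed
  qed
  show "inj_on (placement w) V"
  proof (rule inj_onI)
    fix u v assume uv: "u \<in> V" "v \<in> V" "placement w u = placement w v"
    consider "u \<in> C" "v \<in> C" | "u \<in> C" "v \<notin> C" | "u \<notin> C" "v \<in> C" | "u \<notin> C" "v \<notin> C" by blast
    then show "u = v"
    proof cases
      case 1
      then show ?thesis using uv bij_betw_imp_inj_on[OF hC] by (auto simp: placement_def inj_on_def)
    next
      case 2
      then show ?thesis using uv cen[of u] out[of v] by auto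
    next
      case 3
      then show ?thesis using uv cen[of v] out[of u] by auto
    next
      case 4
      then have "w (h u) = w (h v)" using uv by (simp add: placement_def)
      moreover have "h u \<in> {..<m}" "h v \<in> {..<m}" using bij_betwE[OF h] uv 4 by auto
      ultimately have "h u = h v" using selection_inj[OF w] by (auto simp: inj_on_def)
      then show ?thesis using uv 4 bij_betw_imp_inj_on[OF h] by (auto simp: inj_on_def)
    qed
  qed
qed

lemma placement_outside:
  assumes "S \<subseteq> V - C"
  shows "placement w ` S = w ` h ` S"
  using assms by (auto simp: placement_def image_iff)

text \<open>The player sees only a prefix of the moves, yet computes the same live family as from
  the full sequence, because the blocks that decide it are over.\<close>

lemma live_block_take:
  assumes "((m choose r) + j) * T \<le> i"
  shows "live (block T (take i us)) j = live (block T us) j"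
proof (rule live_cong)
  fix a assume "a < (m choose r) + j"
  then have "Suc a * T \<le> ((m choose r) + j) * T" by (intro mult_right_mono) auto
  then show "block T (take i us) a = block T us a" using assms by (intro block_take) simp
qed

lemma move_edge_in_run:
  assumes "i < length us" "legal_reply (run legal_reply (take i us)) (us ! i) = X" "X = Y - us ! i" "us ! i \<subseteq> Y" "finite Y"
  shows "mset_set Y \<in># mset (map (\<lambda>(U, V). mset_set U + mset_set V) (run legal_reply us))"
proof -
  have "run legal_reply us ! i = (us ! i, Y - us ! i)" using nth_run[OF assms(1)] assms(2,3) by simp
  then have "(us ! i, Y - us ! i) \<in> set (run legal_reply us)" using assms(1) by (metis length_run nth_mem)
  moreover have "mset_set (us ! i) + mset_set (Y - us ! i) = mset_set Y"
  proof -
    have "mset_set (us ! i \<union> (Y - us ! i)) = mset_set (us ! i) + mset_set (Y - us ! i)"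
      using assms(4,5) by (intro mset_set_Union) (auto intro: finite_subset)
    moreover have "us ! i \<union> (Y - us ! i) = Y" using assms(4) by auto
    ultimately show ?thesis by simp
  qed
  ultimately show ?thesis by (force simp: image_iff)
qed

text \<open>A live star yields the copy through its placement. Star edges arise from sets drawn in
  the first blocks, where the answer is always the center. For the added edge \<open>F j\<close>,
  surviving stage \<open>j\<close> means that the awaited set was drawn, and the player then
  completed the edge for this very star.\<close>

lemma live_imp_contains_copy:
  assumes len: "length us = ((m choose r) + l) * T" and w: "w \<in> live (block T us) l"
  shows "contains_copy (V, edges) (history_hypergraph n (run legal_reply us))"
proof -
  let ?B = "m choose r"
  let ?\<phi> = "placement w"
  have star: "w \<in> stars (block T us)" using w live_subset by auto
  then have W: "w \<in> PiE {..<m} part" by (simp add: stars_def)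
  note inj = placement_inj[OF W]
  have long: "Suc a * T \<le> length us" if "a < ?B + l" for a
    unfolding len using that by (intro mult_right_mono) auto
  have edge: "mset_set (?\<phi> ` e) \<in># mset (map (\<lambda>(U, V). mset_set U + mset_set V) (run legal_reply us))"
    if e: "e \<in> edges" for e
  proof -
    from e consider "e \<subseteq> V" "card e = s" "C \<subseteq> e" | j where "j < l" "e = F j"
      by (auto simp: subsets_of_size_def)
    then show ?thesis
    proof cases
      case 1
      let ?S = "e - C"
      have fin: "finite C" "finite e" using finite_V C 1 finite_subset by blast+
      have cC: "card C = s - r" using bij_betw_same_card[OF hC] by simp
      have cS: "card ?S = r" using 1 fin cC sizes by (simp add: card_Diff_subset)
      have "inj_on h ?S" by (rule inj_on_subset[OF bij_betw_imp_inj_on[OF h]]) (use 1 in auto)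
      then have "card (h ` ?S) = r" using cS card_image by metis
      moreover have "h ` ?S \<subseteq> {..<m}" using bij_betwE[OF h] 1 by auto
      ultimately have "h ` ?S \<in> A ` {..<?B}" using bij_A by (simp add: bij_betw_def)
      then obtain a where a: "a < ?B" "A a = h ` ?S" by auto
      have "w ` A a \<in> block T us a" using star a(1) by (simp add: stars_def)
      then obtain i where i: "i < length us" "i div T = a" "us ! i = w ` A a"
        using long[of a] a by (elim in_blockE) auto
      have U: "us ! i = ?\<phi> ` ?S" using i(3) a(2) placement_outside[of ?S w] 1 by auto
      have cen: "?\<phi> ` C = {1..s - r}" using hC by (auto simp: placement_def bij_betw_def)
      have "?\<phi> ` e - ?\<phi> ` ?S = ?\<phi> ` (e - ?S)"
        using inj_on_image_set_diff[OF inj(1), of e ?S] 1 by auto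
      also have "e - ?S = C" using 1 by auto
      finally have rest: "{1..s - r} = ?\<phi> ` e - us ! i" using U cen by simp
      have "reply (take i us) (us ! i) = {1..s - r}"
        using i a by (simp add: reply_def)
      then have "legal_reply (run legal_reply (take i us)) (us ! i) = {1..s - r}"
        using center_legal by (simp add: legal_reply_def)
      from move_edge_in_run[OF i(1) this rest] show ?thesis using U fin by auto
    next
      case 2
      define a where "a = ?B + j"
      have aj: "a < ?B + l" "a - ?B = j" "\<not> a < ?B" using 2 by (auto simp: a_def)
      have "w \<in> live (block T us) (Suc j)" using live_antimono[of "Suc j" l] w 2 by auto
      then have wj: "w \<in> live (block T us) j" "w ` A a \<in> block T us a" by (auto simp: a_def)
      obtain i where i: "i < length us" "i div T = a" "a * T \<le> i" "us ! i = w ` A a"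
        using wj(2) long[OF aj(1)] by (elim in_blockE) auto
      have lv: "live (block T (take i us)) j = live (block T us) j"
        using i(3) by (intro live_block_take) (simp add: a_def)
      \<comment> \<open>At the time of the draw the player recognizes \<open>w\<close>, because no
        other live star waits for this set.\<close>
      have the: "(THE w'. w' \<in> live (block T (take i us)) j \<and> w' ` A a = us ! i) = w"
        unfolding lv using wj i(4) live_inj[OF 2(1), of "block T us"]
        by (intro the_equality) (auto simp: a_def inj_on_def)
      have rep: "reply (take i us) (us ! i) = ?\<phi> ` e - us ! i"
        using i aj the 2 by (simp add: reply_def Let_def)
      have Fj: "F j \<subseteq> V" "card (F j) = s" "A a \<subseteq> h ` (F j - C)" "card (A a) = r"
        using F[OF 2(1)] by (auto simp: a_def)
      have fin: "finite (F j)" using Fj(1) finite_V finite_subset by blast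
      have "us ! i \<subseteq> w ` h ` (F j - C)" using i(4) Fj(3) by auto
      also have "\<dots> = ?\<phi> ` (F j - C)" using placement_outside[of "F j - C" w] Fj(1) by auto
      finally have sub: "us ! i \<subseteq> ?\<phi> ` e" using 2 by auto
      have cU: "card (us ! i) = r" "finite (us ! i)"
        using selection_in_moves[OF W] A_set[OF aj(1)] i(4) sub fin 2 by (auto simp: subsets_of_size_def intro: finite_subset)
      \<comment> \<open>The missing part has exactly \<open>s - r\<close> vertices, so
        \<open>legal_reply\<close> passes it on unchanged.\<close>
      have "card (?\<phi> ` e) = s" using card_image[OF inj_on_subset[OF inj(1) Fj(1)]] Fj(2) 2 by simp
      then have "card (?\<phi> ` e - us ! i) = s - r" using cU sub by (simp add: card_Diff_subset)
      moreover have "?\<phi> ` e \<subseteq> {1..n}" using inj(2) Fj(1) 2 by auto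
      ultimately have "?\<phi> ` e - us ! i \<in> subsets_of_size (s - r) {1..n}" by (auto simp: subsets_of_size_def)
      then have "legal_reply (run legal_reply (take i us)) (us ! i) = ?\<phi> ` e - us ! i"
        using rep by (simp add: legal_reply_def)
      from move_edge_in_run[OF i(1) this refl sub] show ?thesis using fin 2 by simp
    qed
  qed
  let ?G = "(?\<phi> ` V, (\<lambda>e. ?\<phi> ` e) ` edges)"
  have "e \<subseteq> V" if "e \<in> edges" for e
    using that
  proof
    assume "e \<in> F ` {..<l}"
    then obtain j where "j < l" "e = F j" by auto
    then show ?thesis using F[of j] by simp
  qed (simp add: subsets_of_size_def)
  then have "sub_hypergraph ?G (history_hypergraph n (run legal_reply us))"
    using inj(2) edge by (auto simp: sub_hypergraph_def history_hypergraph_def)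
  moreover have "hypergraph_iso (V, edges) ?G"
    using inj(1) by (auto simp: hypergraph_iso_def bij_betw_def)
  ultimately show ?thesis unfolding contains_copy_def by blast
qed

text \<open>Both probabilities are computed from the same uniform sets, grouped into blocks; under
  this coupling a nonempty live family forces a copy.\<close>

lemma prob_contains_copy_ge:
  assumes S: "S n = (\<lambda>h U. return_pmf (legal_reply h U))"
  shows "1 - measure_pmf.prob (replicate_pmf ((m choose r) + l) (hit_pmf T moves)) {fs. live ((!) fs) l = {}}
    \<le> measure_pmf.prob (semi_random r S n (((m choose r) + l) * T)) {H. contains_copy (V, edges) H}"
proof -
  let ?K = "(m choose r) + l" and ?p = "pmf_of_set moves"
  let ?M = "replicate_pmf ?K (replicate_pmf T ?p)"
  let ?good = "\<lambda>us. contains_copy (V, edges) (history_hypergraph n (run legal_reply us))"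
  have "measure_pmf.prob (semi_random r S n (?K * T)) {H. contains_copy (V, edges) H}
    = measure_pmf.prob ?M {bs. ?good (concat bs)}"
    unfolding semi_random_def play_deterministic[where S=S and n=n and g=legal_reply, OF S] replicate_pmf_concat
    by (simp add: measure_map_pmf vimage_def)
  moreover have "measure_pmf.prob (replicate_pmf ?K (hit_pmf T moves)) {fs. live ((!) fs) l = {}}
    = measure_pmf.prob ?M {bs. live ((!) (map set bs)) l = {}}"
    unfolding hit_pmf_def replicate_pmf_map by (simp add: measure_map_pmf vimage_def)
  moreover have "measure_pmf.prob ?M (- {bs. live ((!) (map set bs)) l = {}}) \<le> measure_pmf.prob ?M {bs. ?good (concat bs)}"
  proof (rule measure_pmf.finite_measure_mono_AE)
    show "AE bs in ?M. bs \<in> - {bs. live ((!) (map set bs)) l = {}} \<longrightarrow> bs \<in> {bs. ?good (concat bs)}"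
    proof (rule AE_pmfI, rule impI)
      fix bs assume bs: "bs \<in> set_pmf ?M" "bs \<in> - {bs. live ((!) (map set bs)) l = {}}"
      have len: "length bs = ?K" "\<forall>b\<in>set bs. length b = T"
        using bs(1) by (auto simp: set_replicate_pmf)
      have "live ((!) (map set bs)) l = live (block T (concat bs)) l"
        using len by (intro live_cong) (simp add: block_concat)
      moreover have "live ((!) (map set bs)) l \<noteq> {}" using bs(2) by simp
      ultimately obtain w where "w \<in> live (block T (concat bs)) l" by auto
      moreover have "length (concat bs) = ?K * T"
      proof -
        have "map length bs = replicate ?K T" using len by (intro replicate_eqI) auto
        then show ?thesis by (simp add: length_concat sum_list_replicate)
      qed
      ultimately show "bs \<in> {bs. ?good (concat bs)}" using live_imp_contains_copy by blast
    qed
  qed simp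
  ultimately show ?thesis
    using measure_pmf.prob_compl[of "{bs. live ((!) (map set bs)) l = {}}" ?M] by (simp add: Compl_eq_Diff_UNIV)
qed

text \<open>Packaged as an existence statement so that a reply can be chosen for each
  \<open>n\<close>. The parameters \<beta>, \<gamma> and \<Delta> are quantified inside: the reply
  does not depend on them.\<close>

lemma exists_good_reply:
  "\<exists>g. (\<forall>h U. g h U \<in> subsets_of_size (s - r) {1..n}) \<and>
    (\<forall>S \<beta> \<gamma> \<Delta>. S n = (\<lambda>h U. return_pmf (g h U)) \<longrightarrow> 0 < \<beta> \<longrightarrow> 1 \<le> \<gamma> \<longrightarrow> 1 \<le> \<Delta> \<longrightarrow>
      (\<forall>j. 1 \<le> j \<longrightarrow> j \<le> m \<longrightarrow> \<beta> \<le> real n0 ^ j * hit_prob T moves ^ (j choose r)) \<longrightarrow>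
      (\<forall>j. r \<le> j \<longrightarrow> j < m \<longrightarrow> real n0 ^ (m - j) * hit_prob T moves ^ ((m choose r) - (j choose r)) \<le> \<Delta>) \<longrightarrow>
      1 - (4 * 2 ^ m / \<beta> + 1 / \<gamma> + 96 * 2 ^ m * 2 ^ l * real l * \<gamma> * \<Delta> / (real n0 ^ m * hit_prob T moves ^ ((m choose r) + l)))
        \<le> measure_pmf.prob (semi_random r S n (((m choose r) + l) * T)) {H. contains_copy (V, edges) H})"
proof (intro exI[of _ legal_reply] conjI allI impI legal_reply_legal)
  fix S :: strategy and \<beta> \<gamma> \<Delta> :: real
  assume S: "S n = (\<lambda>h U. return_pmf (legal_reply h U))" and pars: "0 < \<beta>" "1 \<le> \<gamma>" "1 \<le> \<Delta>"
    "\<forall>j. 1 \<le> j \<longrightarrow> j \<le> m \<longrightarrow> \<beta> \<le> real n0 ^ j * hit_prob T moves ^ (j choose r)"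
    "\<forall>j. r \<le> j \<longrightarrow> j < m \<longrightarrow> real n0 ^ (m - j) * hit_prob T moves ^ ((m choose r) - (j choose r)) \<le> \<Delta>"
  show "1 - (4 * 2 ^ m / \<beta> + 1 / \<gamma> + 96 * 2 ^ m * 2 ^ l * real l * \<gamma> * \<Delta> / (real n0 ^ m * hit_prob T moves ^ ((m choose r) + l)))
    \<le> measure_pmf.prob (semi_random r S n (((m choose r) + l) * T)) {H. contains_copy (V, edges) H}"
    by (rule order_trans[OF diff_left_mono[OF prob_live_empty] prob_contains_copy_ge[where S=S, OF S]]) (use pars in blast)+
qed

end

section \<open>Monotonicity in the number of steps\<close>

lemma contains_copy_append:
  assumes "contains_copy G (history_hypergraph n h)"
  shows "contains_copy G (history_hypergraph n (h @ h'))"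
proof -
  from assms obtain G' where G': "sub_hypergraph G' (history_hypergraph n h)" "hypergraph_iso G G'"
    by (auto simp: contains_copy_def)
  have "sub_hypergraph G' (history_hypergraph n (h @ h'))"
    using G'(1) by (auto simp: sub_hypergraph_def history_hypergraph_def)
  with G'(2) show ?thesis unfolding contains_copy_def by blast
qed

lemma prob_contains_copy_mono:
  assumes "t \<le> t'"
  shows "measure_pmf.prob (semi_random r S n t) {H. contains_copy G H}
    \<le> measure_pmf.prob (semi_random r S n t') {H. contains_copy G H}"
  using assms
proof (induction t' rule: dec_induct)
  case (step t')
  let ?X = "{h. contains_copy G (history_hypergraph n h)}"
  have eq: "measure_pmf.prob (semi_random r S n t) {H. contains_copy G H} = measure_pmf.prob (play r S n t) ?X" for t
    by (simp add: semi_random_def measure_map_pmf vimage_def)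
  have "emeasure (play r S n t') ?X = (\<integral>\<^sup>+h. indicator ?X h \<partial>play r S n t')" by simp
  also have "\<dots> \<le> (\<integral>\<^sup>+h. \<integral>\<^sup>+U. \<integral>\<^sup>+V. indicator ?X (h @ [(U, V)]) \<partial>S n h U
       \<partial>pmf_of_set (subsets_of_size r {1..n}) \<partial>play r S n t')"
  proof (rule nn_integral_mono)
    fix h
    show "indicator ?X h \<le> (\<integral>\<^sup>+U. \<integral>\<^sup>+V. indicator ?X (h @ [(U, V)]) \<partial>S n h U
       \<partial>pmf_of_set (subsets_of_size r {1..n}))"
    proof (cases "h \<in> ?X")
      case True
      then have "\<And>U V. h @ [(U, V)] \<in> ?X" by (simp add: contains_copy_append)
      then show ?thesis by (simp add: indicator_def measure_pmf.emeasure_space_1)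
    qed simp
  qed
  also have "\<dots> = emeasure (play r S n (Suc t')) ?X"
    by (simp add: emeasure_bind_pmf)
  finally have "measure_pmf.prob (play r S n t') ?X \<le> measure_pmf.prob (play r S n (Suc t')) ?X"
    by (simp add: measure_pmf.emeasure_eq_measure del: play.simps)
  then show ?case using step eq by simp
qed simp

section \<open>Asymptotics\<close>

text \<open>The first inequality controls the variance of the number of stars, the second one the number of
  stars competing for an \<open>r\<close>-set; only the second needs the full strength of the bound on \<open>l\<close>.\<close>

lemma exponent_inequalities:
  fixes r m l B K :: nat
  assumes r: "1 \<le> r" "r \<le> m" and B: "B = m choose r" and K: "K = B + l"
    and l: "real m * (real l + 1) \<le> real r * real K"
  shows "j \<le> m \<Longrightarrow> real m / real K * real (j choose r) \<le> real j"
    and "r \<le> j \<Longrightarrow> j < m \<Longrightarrow> real (m - j) \<le> real m / real K * real (B - (j choose r))"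
proof -
  have "B > 0" using r by (simp add: B)
  then have K0: "real K > 0" by (simp add: K)
  show "real m / real K * real (j choose r) \<le> real j" if "j \<le> m"
  proof -
    \<comment> \<open>The chord from 0 to \<open>m\<close>, where 0 choose r = 0.\<close>
    have "real m * real (j choose r) \<le> real j * real B"
      using binomial_chord[of 0 j m r] that r by (simp add: B binomial_eq_0)
    also have "\<dots> \<le> real j * real K" by (intro mult_left_mono) (auto simp: K)
    finally show ?thesis using K0 by (simp add: pos_divide_le_eq)
  qed
  show "real (m - j) \<le> real m / real K * real (B - (j choose r))" if j: "r \<le> j" "j < m"
  proof -
    let ?b = "real (j choose r)"
    have mr: "real m - real r > 0" using j by simp
    have "j choose r \<le> B" using j by (simp add: B binomial_right_mono)
    then have d: "real (B - (j choose r)) = real B - ?b" "real (m - j) = real m - real j" using j by auto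
    \<comment> \<open>The chord from \<open>r\<close> to \<open>m\<close>, where r choose r =
      1.\<close>
    have chord: "(real m - real r) * (?b - 1) \<le> (real j - real r) * (real B - 1)"
      using binomial_chord[of r j m r] j r by (simp add: B)
    have "(real m - real r) * (real B - ?b) = (real m - real r) * (real B - 1) - (real m - real r) * (?b - 1)"
      by (simp add: algebra_simps)
    also have "\<dots> \<ge> (real m - real r) * (real B - 1) - (real j - real r) * (real B - 1)"
      using chord by simp
    finally have 1: "(real m - real j) * (real B - 1) \<le> (real m - real r) * (real B - ?b)"
      by (simp add: algebra_simps)
    \<comment> \<open>This is the bound on \<open>l\<close> rearranged, and it is the case
      \<open>j = r\<close> of the claim; the chord transfers it to larger \<open>j\<close>.\<close>
    have 2: "real K * (real m - real r) \<le> real m * (real B - 1)"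
      using l by (simp add: K algebra_simps)
    have "(real m - real r) * ((real m - real j) * real K) = (real m - real j) * (real K * (real m - real r))"
      by simp
    also have "\<dots> \<le> (real m - real j) * (real m * (real B - 1))"
      using j 2 by (intro mult_left_mono) auto
    also have "\<dots> = real m * ((real m - real j) * (real B - 1))" by simp
    also have "\<dots> \<le> real m * ((real m - real r) * (real B - ?b))" using 1 by (intro mult_left_mono) auto
    also have "\<dots> = (real m - real r) * (real m * (real B - ?b))" by simp
    finally have "(real m - real j) * real K \<le> real m * (real B - ?b)"
      using mr by (simp only: mult_le_cancel_left_pos)
    then show ?thesis unfolding d using K0 by (simp add: pos_le_divide_eq)
  qed
qed

text \<open>Here \<open>x\<close> is the number of vertices, and \<open>n0\<close> and
  \<open>q\<close> are of the order of \<open>x\<close> and \<open>p0 * w\<close>. Up to constants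
  each quantity is a power of \<open>x\<close> times a power of \<open>w\<close>. The exponent of
  \<open>x\<close> is nonnegative, nonpositive and zero in the three claims.\<close>

lemma sampling_bounds:
  fixes r m l B K n0 :: nat and x p0 w q a1 c1 c2 :: real
  assumes r: "1 \<le> r" "r \<le> m" and B: "B = m choose r" and K: "K = B + l"
    and l: "real m * (real l + 1) \<le> real r * real K"
    and x: "x \<ge> 1" and p0: "p0 = x powr - (real m / real K)" and w: "1 \<le> w" "w \<le> x"
    and n0: "1 \<le> n0" "a1 * x \<le> real n0" "real n0 \<le> x"
    and q: "c1 * (p0 * w) \<le> q" "q \<le> c2 * (p0 * w)"
    and cst: "0 < a1" "a1 \<le> 1" "0 < c1" "c1 \<le> 1" "1 \<le> c2"
  shows "1 \<le> j \<Longrightarrow> j \<le> m \<Longrightarrow> a1 ^ m * c1 ^ K * w \<le> real n0 ^ j * q ^ (j choose r)"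
    and "r \<le> j \<Longrightarrow> j < m \<Longrightarrow> real n0 ^ (m - j) * q ^ (B - (j choose r)) \<le> c2 ^ B * w ^ (B - 1)"
    and "a1 ^ m * c1 ^ K * w ^ K \<le> real n0 ^ m * q ^ K"
proof -
  have Bpos: "B > 0" using r by (simp add: B)
  then have K0: "real K > 0" by (simp add: K)
  have p0_pos: "p0 > 0" using x by (simp add: p0)
  have q0: "0 \<le> q" using q(1) cst p0_pos w by (meson mult_nonneg_nonneg order_trans less_imp_le zero_le_one)
  have xp: "x ^ i * p0 ^ b = x powr (real i - real m / real K * real b)" for i b
  proof -
    have "x ^ i * p0 ^ b = x powr real i * x powr (- (real m / real K) * real b)"
      using x by (simp add: p0 powr_realpow[symmetric] powr_powr)
    then show ?thesis by (simp add: powr_add[symmetric])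
  qed
  have lower: "a1 ^ i * c1 ^ b * (x ^ i * p0 ^ b) * w ^ b \<le> real n0 ^ i * q ^ b" for i b
  proof -
    have "(a1 * x) ^ i * (c1 * (p0 * w)) ^ b \<le> real n0 ^ i * q ^ b"
      using n0 q cst p0_pos w x q0 by (intro mult_mono power_mono) auto
    then show ?thesis by (simp add: power_mult_distrib mult_ac)
  qed
  have const_le: "a1 ^ m * c1 ^ K \<le> a1 ^ i * c1 ^ b" if "i \<le> m" "b \<le> K" for i b
    using that cst by (intro mult_mono power_decreasing) auto
  show "a1 ^ m * c1 ^ K * w \<le> real n0 ^ j * q ^ (j choose r)" if j: "1 \<le> j" "j \<le> m"
  \<comment> \<open>For \<open>j < r\<close> there is no edge to supply a factor \<open>w\<close>;
    there the size of a part does, since \<open>w \<le> x\<close>.\<close>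
  proof (cases "j choose r = 0")
    case True
    have "a1 ^ m * c1 ^ K * w \<le> a1 ^ 1 * c1 ^ 0 * w"
      using const_le[of 1 0] j w by (intro mult_right_mono) auto
    also have "\<dots> \<le> a1 * x" using w cst by simp
    also have "\<dots> \<le> real n0 ^ 1" using n0 by simp
    also have "\<dots> \<le> real n0 ^ j" using j n0 by (intro power_increasing) auto
    finally show ?thesis by (simp only: True power_0 mult_1_right)
  next
    case False
    let ?b = "j choose r"
    have bK: "?b \<le> K" using binomial_right_mono[OF j(2), of r] by (simp add: K B)
    have "1 \<le> x ^ j * p0 ^ ?b"
      unfolding xp using exponent_inequalities(1)[OF r B K l j(2)] x by (intro ge_one_powr_ge_zero) auto
    then have "a1 ^ j * c1 ^ ?b * 1 * w ^ ?b \<le> a1 ^ j * c1 ^ ?b * (x ^ j * p0 ^ ?b) * w ^ ?b"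
      using cst w by (intro mult_right_mono mult_left_mono) auto
    also have "\<dots> \<le> real n0 ^ j * q ^ ?b" by (rule lower)
    finally have "a1 ^ j * c1 ^ ?b * w ^ ?b \<le> real n0 ^ j * q ^ ?b" by simp
    moreover have "w ^ 1 \<le> w ^ ?b" by (intro power_increasing) (use False w in linarith)+
    then have "a1 ^ m * c1 ^ K * w \<le> a1 ^ j * c1 ^ ?b * w ^ ?b"
      using const_le[OF j(2) bK] cst w by (intro mult_mono[of "a1 ^ m * c1 ^ K"]) auto
    ultimately show ?thesis by simp
  qed
  show "real n0 ^ (m - j) * q ^ (B - (j choose r)) \<le> c2 ^ B * w ^ (B - 1)" if j: "r \<le> j" "j < m"
  proof -
    let ?b = "B - (j choose r)"
    \<comment> \<open>An overlap of at least \<open>r\<close> labels contains a whole edge, so at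
      most \<open>B - 1\<close> factors of \<open>w\<close> remain.\<close>
    have "j choose r \<ge> 1" using j by (simp add: Suc_le_eq)
    then have b: "?b \<le> B - 1" "?b \<le> B" by auto
    have "real n0 ^ (m - j) * q ^ ?b \<le> x ^ (m - j) * (c2 * (p0 * w)) ^ ?b"
      using n0 q q0 x by (intro mult_mono power_mono) auto
    also have "\<dots> = c2 ^ ?b * w ^ ?b * (x ^ (m - j) * p0 ^ ?b)" by (simp add: power_mult_distrib mult_ac)
    also have "\<dots> \<le> c2 ^ ?b * w ^ ?b * 1"
    proof (intro mult_left_mono)
      have "x powr (real (m - j) - real m / real K * real ?b) \<le> x powr 0"
        using exponent_inequalities(2)[OF r B K l j] x by (intro powr_mono) auto
      then show "x ^ (m - j) * p0 ^ ?b \<le> 1" unfolding xp using x by simp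
    qed (use cst w in auto)
    also have "\<dots> \<le> c2 ^ B * w ^ (B - 1) * 1"
      using cst w b by (intro mult_mono power_increasing) auto
    finally show ?thesis by simp
  qed
  have "x ^ m * p0 ^ K = 1" unfolding xp using K0 x by simp
  then show "a1 ^ m * c1 ^ K * w ^ K \<le> real n0 ^ m * q ^ K" using lower[of m K] by simp
qed

text \<open>There are between (n/r)^r and n^r possible \<open>r\<close>-sets. In the lower constant,
  1/K comes from splitting the time into \<open>K\<close> blocks, one factor 1/2 from rounding and
  the other from \<open>hit_prob_bounds\<close>; \<open>small\<close> provides the assumption of the
  latter.\<close>

lemma hit_prob_asymp:
  fixes r m K n T :: nat and w :: real
  assumes r: "1 \<le> r" "r \<le> n" and K: "K > 0" and y: "1 \<le> y" "y = real n powr (real r - \<theta>) * w / real K"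
    and T: "T = nat \<lfloor>y\<rfloor>" and w: "w \<ge> 1"
    and small: "real r ^ r * (real n powr - \<theta> * w) \<le> 1"
  shows "1 / (4 * real K) * (real n powr - \<theta> * w) \<le> hit_prob T (subsets_of_size r {1..n})"
    and "hit_prob T (subsets_of_size r {1..n}) \<le> real r ^ r * (real n powr - \<theta> * w)"
proof -
  let ?\<Omega> = "subsets_of_size r {1..n}"
  define M where "M = real (n choose r)"
  have card: "real (card ?\<Omega>) = M" by (simp add: card_subsets_of_size M_def)
  have n0: "real n > 0" using r by simp
  have M_lo: "(real n / real r) ^ r \<le> M" unfolding M_def by (rule binomial_ge_n_over_k_pow_k[OF r(2)])
  have M_hi: "M \<le> real n ^ r" unfolding M_def using binomial_le_pow[OF r(2)] by (metis of_nat_le_iff of_nat_power)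
  have Mpos: "M > 0" using r by (simp add: M_def)
  have T_hi: "real T \<le> y" using y by (simp add: T)
  have T_lo: "y / 2 \<le> real T"
  proof -
    have "1 \<le> \<lfloor>y\<rfloor>" "y < real_of_int \<lfloor>y\<rfloor> + 1" using y(1) by linarith+
    then show ?thesis unfolding T by linarith
  qed
  have yM: "y = real n ^ r * (real n powr - \<theta> * w) / real K"
  proof -
    have "real n powr (real r - \<theta>) = real n powr real r * real n powr - \<theta>" by (simp flip: powr_add)
    then show ?thesis using n0 y(2) by (simp add: powr_realpow mult_ac)
  qed
  let ?z = "real n powr - \<theta> * w"
  have z: "?z > 0" using n0 w by simp
  have "real T / M \<le> y / (real n / real r) ^ r"
    using T_hi M_lo r n0 y by (intro frac_le) auto
  also have "\<dots> = real r ^ r * ?z / real K" using n0 by (simp add: yM power_divide field_simps)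
  also have "\<dots> \<le> real r ^ r * ?z / 1"
    using K z by (intro divide_left_mono) auto
  finally have hi: "real T / M \<le> real r ^ r * ?z" by simp
  then have le1: "real T / real (card ?\<Omega>) \<le> 1" using small card by simp
  have c0: "card ?\<Omega> > 0" using Mpos card by simp
  note hb = hit_prob_bounds[OF c0 le1]
  show "hit_prob T ?\<Omega> \<le> real r ^ r * ?z" using hb(1) hi card by simp
  have "1 / (4 * real K) * ?z = (y / 2) / real n ^ r / 2" using n0 by (simp add: yM)
  also have "\<dots> \<le> real T / M / 2"
    using T_lo M_hi Mpos y by (intro divide_right_mono frac_le) auto
  also have "\<dots> \<le> hit_prob T ?\<Omega>" using hb(2) card by simp
  finally show "1 / (4 * real K) * ?z \<le> hit_prob T ?\<Omega>" .
qed

text \<open>Extends the reply to values of \<open>n\<close> for which the parts do not fit or a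
  block is empty. There the center is always played, so a legal reply exists whenever
  \<open>s \<le> n\<close>.\<close>

lemma reply_exists:
  assumes game: "0 < n0 \<Longrightarrow> 0 < T \<Longrightarrow> s - r + m * n0 \<le> n \<Longrightarrow> starplus_game r s m l n n0 T A V C F h hC"
  shows "\<exists>g. (s \<le> n \<longrightarrow> (\<forall>h U. g h U \<in> subsets_of_size (s - r) {1..n})) \<and>
    (0 < n0 \<and> 0 < T \<and> s - r + m * n0 \<le> n \<longrightarrow>
    (\<forall>S \<beta> \<gamma> \<Delta>. S n = (\<lambda>h U. return_pmf (g h U)) \<longrightarrow> 0 < \<beta> \<longrightarrow> 1 \<le> \<gamma> \<longrightarrow> 1 \<le> \<Delta> \<longrightarrow>
      (\<forall>j. 1 \<le> j \<longrightarrow> j \<le> m \<longrightarrow> \<beta> \<le> real n0 ^ j * hit_prob T (subsets_of_size r {1..n}) ^ (j choose r)) \<longrightarrow>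
      (\<forall>j. r \<le> j \<longrightarrow> j < m \<longrightarrow> real n0 ^ (m - j) * hit_prob T (subsets_of_size r {1..n}) ^ ((m choose r) - (j choose r)) \<le> \<Delta>) \<longrightarrow>
      1 - (4 * 2 ^ m / \<beta> + 1 / \<gamma> + 96 * 2 ^ m * 2 ^ l * real l * \<gamma> * \<Delta> /
          (real n0 ^ m * hit_prob T (subsets_of_size r {1..n}) ^ ((m choose r) + l)))
        \<le> measure_pmf.prob (semi_random r S n (((m choose r) + l) * T))
            {H. contains_copy (V, {e \<in> subsets_of_size s V. C \<subseteq> e} \<union> F ` {..<l}) H}))"
proof (cases "0 < n0 \<and> 0 < T \<and> s - r + m * n0 \<le> n")
  case True
  then interpret starplus_game r s m l n n0 T A V C F h hC by (intro game) auto
  show ?thesis using exists_good_reply by blast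
next
  case False
  have "{1..s - r} \<in> subsets_of_size (s - r) {1..n}" if "s \<le> n"
    using that by (auto simp: subsets_of_size_def)
  then show ?thesis using False by (intro exI[of _ "\<lambda>_ _. {1..s - r}"]) blast
qed

text \<open>The choice \<gamma> = sqrt w balances the last two errors: since
  \<open>B \<le> K\<close>, the quotient sqrt w * w^(B - 1) / w^K is at most 1 / sqrt w.\<close>

lemma error_bound:
  fixes w a b D E :: real and X :: real
  assumes w: "1 \<le> w" and a: "0 < a" and b: "0 \<le> b" and D: "0 \<le> D" "0 \<le> E"
    and BK: "1 \<le> B" "B \<le> K" and X: "a * w ^ K \<le> X"
  shows "D / (a * w) + 1 / sqrt w + E * sqrt w * (b * w ^ (B - 1)) / X \<le> (D / a + 1 + E * b / a) / sqrt w"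
proof -
  have sw: "0 < sqrt w" "sqrt w * sqrt w = w" using w by auto
  have "sqrt w * 1 \<le> sqrt w * sqrt w" using w by (intro mult_left_mono) auto
  then have le: "sqrt w \<le> w" using sw by simp
  have aw: "0 < a * w ^ K" using a w by simp
  have 1: "D / (a * w) \<le> D / a / sqrt w"
    using D a sw le w by (auto intro!: divide_left_mono mult_pos_pos)
  have "E * sqrt w * (b * w ^ (B - 1)) / X \<le> E * sqrt w * (b * w ^ (B - 1)) / (a * w ^ K)"
    using D b w X aw by (intro divide_left_mono) (auto intro!: mult_pos_pos)
  also have "\<dots> \<le> E * b / a / sqrt w"
  proof -
    have "sqrt w * w ^ (B - 1) * sqrt w = w ^ B"
      using sw BK by (metis One_nat_def Suc_pred' mult.commute mult.left_commute power_Suc less_eq_Suc_le)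
    also have "\<dots> \<le> w ^ K" using w BK by (intro power_increasing) auto
    finally have "sqrt w * w ^ (B - 1) / w ^ K \<le> 1 / sqrt w"
      using sw w by (simp add: field_simps)
    then have "(E * b / a) * (sqrt w * w ^ (B - 1) / w ^ K) \<le> (E * b / a) * (1 / sqrt w)"
      using D b a by (intro mult_left_mono) auto
    then show ?thesis by (simp add: mult_ac)
  qed
  finally show ?thesis using 1 by (simp add: add_divide_distrib)
qed

lemma strategy_succeeds:
  fixes r s m l K :: nat and V :: "'a set" and \<omega> :: "nat \<Rightarrow> real"
  defines "E \<equiv> \<lambda>C F. {e \<in> subsets_of_size s V. C \<subseteq> e} \<union> F ` {..<l}"
  assumes game: "\<And>n n0 T. 0 < n0 \<Longrightarrow> 0 < T \<Longrightarrow> s - r + m * n0 \<le> n \<Longrightarrow> starplus_game r s m l n n0 T A V C F h hC"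
    and r: "1 \<le> r" "r \<le> m" and K: "K = (m choose r) + l"
    and l: "real m * (real l + 1) \<le> real r * real K"
    and \<omega>: "filterlim \<omega> at_top sequentially"
  shows "\<exists>S. is_strategy r s S \<and>
    (\<lambda>n. measure_pmf.prob (semi_random r S n (nat \<lfloor>real n powr (real r - real m / real K) * \<omega> n\<rfloor>))
      {H. contains_copy (V, E C F) H}) \<longlonglongrightarrow> 1"
proof -
  let ?\<theta> = "real m / real K"
  let ?B = "m choose r"
  have Bpos: "?B \<ge> 1" using r by (simp add: Suc_le_eq)
  then have Kpos: "real K > 0" by (simp add: K)
  have mpos: "real m > 0" using r by simp
  have \<theta>pos: "?\<theta> > 0" using mpos Kpos by simp
  \<comment> \<open>A nonnegative exponent guarantees that a block eventually contains at least one
    step.\<close>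
  have \<alpha>: "real r - ?\<theta> \<ge> 0"
  proof -
    have "real m * 1 \<le> real m * (real l + 1)" by (intro mult_left_mono) auto
    also have "\<dots> \<le> real r * real K" by (rule l)
    finally show ?thesis using Kpos by (simp add: pos_divide_le_eq)
  qed
  text \<open>Slowing \<open>\<omega>\<close> down to at most \<open>ln\<close> keeps the hitting probability of a block below 1.\<close>
  define w where "w n = min (\<omega> n) (ln (real n))" for n
  define y where "y n = real n powr (real r - ?\<theta>) * w n / real K" for n
  define T where "T n = nat \<lfloor>y n\<rfloor>" for n
  define n0 where "n0 n = (n - (s - r)) div m" for n
  have "\<forall>n. \<exists>g. (s \<le> n \<longrightarrow> (\<forall>h U. g h U \<in> subsets_of_size (s - r) {1..n})) \<and>
    (0 < n0 n \<and> 0 < T n \<and> s - r + m * n0 n \<le> n \<longrightarrow>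
    (\<forall>S \<beta> \<gamma> \<Delta>. S n = (\<lambda>h U. return_pmf (g h U)) \<longrightarrow> 0 < \<beta> \<longrightarrow> 1 \<le> \<gamma> \<longrightarrow> 1 \<le> \<Delta> \<longrightarrow>
      (\<forall>j. 1 \<le> j \<longrightarrow> j \<le> m \<longrightarrow> \<beta> \<le> real (n0 n) ^ j * hit_prob (T n) (subsets_of_size r {1..n}) ^ (j choose r)) \<longrightarrow>
      (\<forall>j. r \<le> j \<longrightarrow> j < m \<longrightarrow> real (n0 n) ^ (m - j) * hit_prob (T n) (subsets_of_size r {1..n}) ^ (?B - (j choose r)) \<le> \<Delta>) \<longrightarrow>
      1 - (4 * 2 ^ m / \<beta> + 1 / \<gamma> + 96 * 2 ^ m * 2 ^ l * real l * \<gamma> * \<Delta> /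
          (real (n0 n) ^ m * hit_prob (T n) (subsets_of_size r {1..n}) ^ (?B + l)))
        \<le> measure_pmf.prob (semi_random r S n ((?B + l) * T n)) {H. contains_copy (V, E C F) H}))"
    (is "\<forall>n. Ex (?R n)")
    unfolding E_def
    by (rule allI, rule reply_exists[where A=A and h=h and hC=hC, OF game])
  \<comment> \<open>A strategy is one function of \<open>n\<close>, so the replies for all
    \<open>n\<close> are chosen simultaneously.\<close>
  from choice[OF this] obtain g where g: "\<forall>n. ?R n (g n)" ..
  note g_legal = g[THEN spec, THEN conjunct1, rule_format]
    and g_good = g[THEN spec, THEN conjunct2, rule_format]
  define S :: strategy where "S n h U = return_pmf (g n h U)" for n h U
  have strat: "is_strategy r s S"
    unfolding is_strategy_def S_def using g_legal by (simp only: set_return_pmf) blast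
  let ?P = "\<lambda>n. measure_pmf.prob (semi_random r S n (nat \<lfloor>real n powr (real r - ?\<theta>) * \<omega> n\<rfloor>)) {H. contains_copy (V, E C F) H}"
  \<comment> \<open>The constants of \<open>sampling_bounds\<close> for parts of size at least n /
    (2m) and the hitting probabilities of \<open>hit_prob_asymp\<close>.\<close>
  define a where "a = (1 / (2 * real m)) ^ m * (1 / (4 * real K)) ^ K"
  define b where "b = (real r ^ r) ^ ?B"
  define Err where "Err = 4 * 2 ^ m / a + 1 + 96 * 2 ^ m * 2 ^ l * real l * b / a"
  have a: "a > 0" using mpos Kpos by (simp add: a_def)
  have rr: "real r ^ r \<ge> 1" using r by simp
  have b: "b \<ge> 1" using rr by (simp add: b_def)
  have w_top: "filterlim w at_top sequentially"
    unfolding w_def filterlim_at_top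
  proof
    fix Z :: real
    have "eventually (\<lambda>n. Z \<le> \<omega> n) sequentially" using \<omega> by (simp add: filterlim_at_top)
    moreover have "filterlim (\<lambda>n. ln (real n)) at_top sequentially"
      by (rule filterlim_compose[OF ln_at_top filterlim_real_sequentially])
    then have "eventually (\<lambda>n. Z \<le> ln (real n)) sequentially" by (simp add: filterlim_at_top)
    ultimately show "eventually (\<lambda>n. Z \<le> min (\<omega> n) (ln (real n))) sequentially"
      by eventually_elim simp
  qed
  \<comment> \<open>The bound \<open>w \<ge> K\<close> compensates for the division by
    \<open>K\<close> in \<open>y\<close>, so that no block is empty.\<close>
  then have ev_w: "eventually (\<lambda>n. max 1 (real K) \<le> w n) sequentially"
    by (rule filterlim_at_top[THEN iffD1, THEN spec])
  have ev_n: "eventually (\<lambda>n. 2 * (s + m) + r \<le> n) sequentially" by (rule eventually_ge_at_top)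
  have ev_small: "eventually (\<lambda>n. ln (real n) / real n powr ?\<theta> < 1 / real r ^ r) sequentially"
    by (intro order_tendstoD(2)[OF lim_ln_over_power[OF \<theta>pos]] divide_pos_pos) (use rr in linarith)+
  have lower: "eventually (\<lambda>n. 1 - Err / sqrt (w n) \<le> ?P n) sequentially"
    using ev_w ev_n ev_small
  proof eventually_elim
    fix n assume wn: "max 1 (real K) \<le> w n" and n: "2 * (s + m) + r \<le> n"
      and sm: "ln (real n) / real n powr ?\<theta> < 1 / real r ^ r"
    have w1: "1 \<le> w n" "real K \<le> w n" using wn by auto
    have x1: "real n \<ge> 1" using n r by simp
    have wl: "w n \<le> ln (real n)" "w n \<le> \<omega> n" by (auto simp: w_def)
    have "ln (real n) \<le> real n" using ln_less_self[of "real n"] x1 by linarith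
    then have wx: "w n \<le> real n" using wl by simp
    let ?p0 = "real n powr - ?\<theta>"
    have small: "real r ^ r * (?p0 * w n) \<le> 1"
    proof -
      have "real r ^ r * (?p0 * w n) \<le> real r ^ r * (?p0 * ln (real n))"
        using wl by (intro mult_left_mono) auto
      also have "?p0 * ln (real n) = ln (real n) / real n powr ?\<theta>"
        by (simp add: powr_minus field_simps)
      also have "real r ^ r * \<dots> \<le> real r ^ r * (1 / real r ^ r)"
        using sm by (intro mult_left_mono) auto
      also have "\<dots> = 1" using r by simp
      finally show ?thesis .
    qed
    have y1: "1 \<le> y n"
    proof -
      have "1 * real K \<le> real n powr (real r - ?\<theta>) * w n"
        using \<alpha> x1 w1 Kpos by (intro mult_mono ge_one_powr_ge_zero) auto
      then show ?thesis using Kpos by (simp add: y_def pos_le_divide_eq)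
    qed
    have Tpos: "0 < T n" using y1 by (simp add: T_def)
    have n0_le: "m * n0 n \<le> n - (s - r)" unfolding n0_def by simp
    have sn: "s - r \<le> n" using n by simp
    have part: "s - r + m * n0 n \<le> n" using n0_le sn by linarith
    have "n - (s - r) < m * (n0 n + 1)"
      unfolding n0_def using r dividend_less_times_div[of m "n - (s - r)"] by simp
    then have "n < m * (n0 n + 1) + (s - r)" using sn by linarith
    then have "real n < real (m * (n0 n + 1) + (s - r))" by (simp only: of_nat_less_iff)
    also have "\<dots> = real m * real (n0 n) + real m + real (s - r)" by (simp add: algebra_simps)
    finally have "real n < real m * real (n0 n) + real m + real (s - r)" .
    moreover have "2 * (m + (s - r)) \<le> n" using n by simp
    then have "real (2 * (m + (s - r))) \<le> real n" by (rule of_nat_mono)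
    then have "2 * (real m + real (s - r)) \<le> real n" by (simp only: of_nat_mult of_nat_add of_nat_numeral)
    \<comment> \<open>Rounding in \<open>n0\<close> and the center together lose at most half of the
      vertices.\<close>
    moreover have half: "x / 2 \<le> u" if "x < u + v + z" "2 * (v + z) \<le> x" for x u v z :: real
      using that by simp
    ultimately have "real n / 2 \<le> real m * real (n0 n)" by (intro half)
    then have n0_lo: "1 / (2 * real m) * real n \<le> real (n0 n)"
      using mpos by (simp add: field_simps)
    then have n0_pos: "0 < n0 n" using x1 mpos by (cases "n0 n = 0") (auto simp: mult_le_0_iff divide_le_0_iff)
    have n0_hi: "real (n0 n) \<le> real n" unfolding n0_def using div_le_dividend[of "n - (s - r)" m] by linarith
    let ?q = "hit_prob (T n) (subsets_of_size r {1..n})"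
    have rn: "r \<le> n" using n by simp
    have K0: "K > 0" using Kpos by simp
    note q = hit_prob_asymp[OF r(1) rn K0 y1 y_def T_def w1(1) small]
    have c: "0 < 1 / (2 * real m)" "1 / (2 * real m) \<le> 1" "0 < 1 / (4 * real K)" "1 / (4 * real K) \<le> 1"
      using r K0 by (auto simp: divide_le_eq)
    have n01: "1 \<le> n0 n" using n0_pos by simp
    note sb = sampling_bounds[OF r refl K l x1 refl w1(1) wx n01 n0_lo n0_hi q c rr]
    \<comment> \<open>Instantiated with \<beta> = a w, \<gamma> = sqrt w and \<Delta> = b w^(B -
      1).\<close>
    have "1 - (4 * 2 ^ m / (a * w n) + 1 / sqrt (w n) + 96 * 2 ^ m * 2 ^ l * real l * sqrt (w n) * (b * w n ^ (?B - 1)) /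
          (real (n0 n) ^ m * ?q ^ (?B + l)))
        \<le> measure_pmf.prob (semi_random r S n ((?B + l) * T n)) {H. contains_copy (V, E C F) H}"
    proof (rule g_good)
      show "0 < n0 n \<and> 0 < T n \<and> s - r + m * n0 n \<le> n" using n0_pos Tpos part by simp
      show "S n = (\<lambda>h U. return_pmf (g n h U))" by (simp add: S_def fun_eq_iff)
      show "0 < a * w n" using a w1 by simp
      show "1 \<le> sqrt (w n)" using w1 by simp
      have "1 * 1 \<le> b * w n ^ (?B - 1)" using b w1 by (intro mult_mono one_le_power) auto
      then show "1 \<le> b * w n ^ (?B - 1)" by simp
      show "a * w n \<le> real (n0 n) ^ j * ?q ^ (j choose r)" if "1 \<le> j" "j \<le> m" for j
        unfolding a_def by (rule sb(1)[OF that])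
      show "real (n0 n) ^ (m - j) * ?q ^ (?B - (j choose r)) \<le> b * w n ^ (?B - 1)" if "r \<le> j" "j < m" for j
        unfolding b_def by (rule sb(2)[OF that])
    qed
    moreover have "4 * 2 ^ m / (a * w n) + 1 / sqrt (w n) + 96 * 2 ^ m * 2 ^ l * real l * sqrt (w n) * (b * w n ^ (?B - 1)) /
          (real (n0 n) ^ m * ?q ^ (?B + l)) \<le> Err / sqrt (w n)"
      unfolding Err_def
    proof (rule error_bound[where K=K])
      show "a * w n ^ K \<le> real (n0 n) ^ m * ?q ^ (?B + l)" using sb(3) by (simp only: a_def K)
    qed (use w1 a b Bpos K in auto)
    \<comment> \<open>The \<open>K\<close> blocks use at most the allotted number of steps, by
      rounding down and \<open>w \<le> \<omega>\<close>; a copy built earlier remains.\<close>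
    moreover have "measure_pmf.prob (semi_random r S n ((?B + l) * T n)) {H. contains_copy (V, E C F) H} \<le> ?P n"
    proof (rule prob_contains_copy_mono, rule le_nat_floor)
      have "real ((?B + l) * T n) = real K * real (T n)" by (simp add: K)
      also have "\<dots> \<le> real K * y n" using y1 by (intro mult_left_mono) (auto simp: T_def)
      also have "\<dots> = real n powr (real r - ?\<theta>) * w n" using Kpos by (simp add: y_def)
      also have "\<dots> \<le> real n powr (real r - ?\<theta>) * \<omega> n" using wl by (intro mult_left_mono) auto
      finally show "real ((?B + l) * T n) \<le> real n powr (real r - ?\<theta>) * \<omega> n" .
    qed
    ultimately show "1 - Err / sqrt (w n) \<le> ?P n" by linarith
  qed
  have "(\<lambda>n. 1 - Err / sqrt (w n)) \<longlonglongrightarrow> 1 - 0"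
    by (intro tendsto_intros real_tendsto_divide_at_top[OF tendsto_const] filterlim_compose[OF sqrt_at_top w_top])
  then have "?P \<longlonglongrightarrow> 1"
    by (intro tendsto_sandwich[OF lower always_eventually _ tendsto_const[of 1]]) auto
  with strat show ?thesis by blast
qed

section \<open>Starpluses as instances of the game\<close>

lemma starplus_gameE:
  fixes V :: "'a set"
  assumes r: "1 \<le> r" "r < s" and sp: "starplus k s (s - r) l (V, E)"
  obtains A C F h hC where "finite V" "card V = k" "s \<le> k"
    "E = {e \<in> subsets_of_size s V. C \<subseteq> e} \<union> F ` {..<l}" "card E = (k - s + r choose r) + l"
    "\<And>n n0 T. 0 < n0 \<Longrightarrow> 0 < T \<Longrightarrow> s - r + (k - s + r) * n0 \<le> n \<Longrightarrow>
      starplus_game r s (k - s + r) l n n0 T A V C F h hC"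
proof -
  let ?m = "k - s + r"
  let ?B = "?m choose r"
  from sp obtain C E0 F0 where star: "full_star k s (s - r) C (V, E0)"
    and F0: "F0 \<subseteq> {e \<in> subsets_of_size s V. \<not> C \<subseteq> e}" "card F0 = l" and E: "E = E0 \<union> F0"
    by (auto simp: starplus_def)
  have V: "finite V" "card V = k" "s \<le> k" and C: "C \<subseteq> V" "card C = s - r"
    and E0: "E0 = {e \<in> subsets_of_size s V. C \<subseteq> e}"
    using star by (auto simp: full_star_def)
  have finC: "finite C" using C V finite_subset by blast
  have cW: "card (V - C) = ?m" using C V finC r by (simp add: card_Diff_subset)
  have finF: "finite F0" using finite_subset[OF F0(1)] finite_subsets_of_size[OF V(1), of s] by simp
  obtain hC where hC: "bij_betw hC C {1..s - r}"
    using finite_same_card_bij[OF finC, of "{1..s - r}"] C by auto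
  obtain h where h: "bij_betw h (V - C) {..<?m}"
    using finite_same_card_bij[of "V - C" "{..<?m}"] cW V by auto
  obtain F where F: "bij_betw F {..<l} F0"
    using finite_same_card_bij[of "{..<l}" F0] F0 finF by auto
  have "card {J. J \<subseteq> {..<?m} \<and> card J = r} = ?B" using n_subsets[of "{..<?m}" r] by simp
  then obtain A0 where A0: "bij_betw A0 {..<?B} {J. J \<subseteq> {..<?m} \<and> card J = r}"
    using finite_same_card_bij[of "{..<?B}" "{J. J \<subseteq> {..<?m} \<and> card J = r}"] by auto
  have Fj: "F j \<subseteq> V \<and> card (F j) = s" if "j < l" for j
    using bij_betwE[OF F] that F0 by (auto simp: subsets_of_size_def)
  \<comment> \<open>An added edge has \<open>s\<close> vertices and the center only
    \<open>s - r\<close>, so at least \<open>r\<close> of them carry labels.\<close>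
  have "\<exists>J. J \<subseteq> h ` (F j - C) \<and> card J = r" if j: "j < l" for j
  proof -
    have fin: "finite (F j)" using Fj[OF j] V finite_subset by blast
    have "card (F j) \<le> card ((F j - C) \<union> C)" using fin finC by (intro card_mono) auto
    also have "\<dots> \<le> card (F j - C) + card C" by (rule card_Un_le)
    finally have "r \<le> card (F j - C)" using Fj[OF j] C r by simp
    also have "\<dots> = card (h ` (F j - C))"
      by (rule card_image[symmetric], rule inj_on_subset[OF bij_betw_imp_inj_on[OF h]]) (use Fj[OF j] in auto)
    finally show ?thesis by (meson obtain_subset_with_card_n)
  qed
  then obtain A1 where A1: "\<And>j. j < l \<Longrightarrow> A1 j \<subseteq> h ` (F j - C) \<and> card (A1 j) = r" by metis
  define A where "A a = (if a < ?B then A0 a else A1 (a - ?B))" for a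
  have bA: "bij_betw A {..<?B} {J. J \<subseteq> {..<?m} \<and> card J = r}"
    using A0 by (subst bij_betw_cong[of _ A A0]) (auto simp: A_def)
  have "starplus_game r s ?m l n n0 T A V C F h hC" if "0 < n0" "0 < T" "s - r + ?m * n0 \<le> n" for n n0 T
    by unfold_locales (use that r V C hC h bA Fj A1 in \<open>auto simp: A_def\<close>)
  moreover have "E = {e \<in> subsets_of_size s V. C \<subseteq> e} \<union> F ` {..<l}"
    using E E0 bij_betw_imp_surj_on[OF F] by simp
  moreover have "card E = ?B + l"
  proof -
    \<comment> \<open>Star edges correspond to the \<open>r\<close>-subsets of the complement of the
      center.\<close>
    have "bij_betw (\<lambda>S. C \<union> S) (subsets_of_size r (V - C)) E0"
    proof (rule bij_betwI[where g="\<lambda>e. e - C"])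
      show "(\<lambda>S. C \<union> S) \<in> subsets_of_size r (V - C) \<rightarrow> E0"
      proof
        fix S assume S: "S \<in> subsets_of_size r (V - C)"
        then have "finite S" "C \<inter> S = {}" "card S = r" "S \<subseteq> V"
          using V by (auto simp: subsets_of_size_def intro: finite_subset)
        then show "C \<union> S \<in> E0" using C finC r by (simp add: E0 subsets_of_size_def card_Un_disjoint)
      qed
      show "(\<lambda>e. e - C) \<in> E0 \<rightarrow> subsets_of_size r (V - C)"
        using C finC r by (auto simp: E0 subsets_of_size_def card_Diff_subset)
    qed (auto simp: E0 subsets_of_size_def)
    from bij_betw_same_card[OF this] have "card E0 = ?B" using V cW by (simp add: card_subsets_of_size)
    moreover have "E0 \<inter> F0 = {}" using F0 E0 by auto
    moreover have "finite E0" using finite_subsets_of_size[OF V(1), of s] by (simp add: E0)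
    ultimately show ?thesis using E F0 finF by (simp add: card_Un_disjoint)
  qed
  ultimately show ?thesis using that V by blast
qed

section \<open>The exponent of the threshold\<close>

text \<open>Replacing "at most \<open>t\<close>" by "less than \<open>Suc t\<close>" gives a strict
  inequality, which yields witnesses for both infima.\<close>

lemma tau_quantile_eq_enatD:
  assumes "tau_quantile r s P q n = enat t"
  obtains S t' where "t' \<le> t" "measure_pmf.prob (semi_random r S n t') {H. P H} \<ge> q"
proof -
  have "tau_quantile r s P q n < enat (Suc t)" using assms by simp
  then obtain S where "tau_strategy r P S q n < enat (Suc t)"
    unfolding tau_quantile_def by (auto simp: INF_less_iff)
  then obtain t' where "enat t' < enat (Suc t)" "measure_pmf.prob (semi_random r S n t') {H. P H} \<ge> q"
    unfolding tau_strategy_def Inf_less_iff by auto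
  then show ?thesis by (intro that[of t' S]) auto
qed

text \<open>If probability \<open>q\<close> is reached at time t, taking logarithms in the bound
  gives ln t \<ge> \<alpha> ln n - d for a constant d, which vanishes after division by ln
  n.\<close>

lemma tau_exponent_ge:
  fixes C q :: real
  assumes q: "0 < q" and C: "0 < C" and K: "0 < K"
    and bound: "\<And>n S t. n \<ge> r \<Longrightarrow> measure_pmf.prob (semi_random r S n t) {H. P H}
      \<le> C * real t ^ K * real n ^ m / real n ^ (r * K)"
  shows "ereal (real r - real m / real K) \<le> tau_exponent r s P q"
proof -
  let ?\<alpha> = "real r - real m / real K"
  define d where "d = ln (C / q) / real K"
  let ?g = "\<lambda>n. ereal (?\<alpha> - d / ln (real n))"
  have ln_top: "filterlim (\<lambda>n. ln (real n)) at_top sequentially"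
    by (rule filterlim_compose[OF ln_at_top filterlim_real_sequentially])
  have "(\<lambda>n. ?\<alpha> - d / ln (real n)) \<longlonglongrightarrow> ?\<alpha> - 0"
    by (intro tendsto_intros real_tendsto_divide_at_top[OF tendsto_const] ln_top)
  then have "?g \<longlonglongrightarrow> ereal ?\<alpha>" by simp
  then have "ereal ?\<alpha> = limsup ?g" by (rule lim_imp_Limsup[OF sequentially_bot, symmetric])
  also have "\<dots> \<le> tau_exponent r s P q"
    unfolding tau_exponent_def
  proof (rule Limsup_mono, rule eventually_mono[OF eventually_ge_at_top[of "max r 2"]])
    fix n assume n: "max r 2 \<le> n"
    have ln0: "ln (real n) > 0" using n by simp
    have n0: "real n > 0" using n by simp
    show "?g n \<le> ln_enat (tau_quantile r s P q n) / ereal (ln (real n))"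
    proof (cases "tau_quantile r s P q n")
      case infinity
      then show ?thesis using ln0 by (simp add: ln_enat_def)
    next
      case (enat t)
      obtain S t' where t': "t' \<le> t" "measure_pmf.prob (semi_random r S n t') {H. P H} \<ge> q"
        using tau_quantile_eq_enatD[OF enat] by blast
      have le: "q \<le> C * real t' ^ K * real n ^ m / real n ^ (r * K)"
        using t'(2) bound[of n S t'] n by simp
      \<comment> \<open>At time 0 the bound would force \<open>q \<le> 0\<close>, because
        \<open>K > 0\<close>. Positivity allows the logarithm to be taken.\<close>
      have tpos: "0 < t'"
      proof (rule ccontr)
        assume "\<not> 0 < t'"
        then show False using le K q by (simp add: zero_power)
      qed
      have "q * real n ^ (r * K) \<le> C * real t' ^ K * real n ^ m"
        using le n0 by (simp add: pos_le_divide_eq)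
      then have "ln (q * real n ^ (r * K)) \<le> ln (C * real t' ^ K * real n ^ m)"
        using q n0 C tpos by (subst ln_le_cancel_iff) auto
      then have log_le: "ln q + real (r * K) * ln (real n) \<le> ln C + real K * ln (real t') + real m * ln (real n)"
        using q n0 C tpos by (simp add: ln_mult ln_realpow)
      have "real K * (?\<alpha> * ln (real n) - d) \<le> real K * ln (real t')"
      proof -
        have "real K * (?\<alpha> * ln (real n) - d) = (real K * ?\<alpha>) * ln (real n) - real K * d"
          by (simp add: right_diff_distrib)
        also have "real K * ?\<alpha> = real K * real r - real m" using K by (simp add: right_diff_distrib)
        also have "real K * d = ln C - ln q" using K q C by (simp add: d_def ln_div)
        finally show ?thesis using log_le by (simp add: algebra_simps)
      qed
      then have "?\<alpha> * ln (real n) - d \<le> ln (real t')" using K by simp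
      also have "\<dots> \<le> ln (real t)" using t'(1) tpos by simp
      finally have "(?\<alpha> * ln (real n) - d) / ln (real n) \<le> ln (real t) / ln (real n)"
        using ln0 by (intro divide_right_mono) auto
      moreover have "(?\<alpha> * ln (real n) - d) / ln (real n) = ?\<alpha> - d / ln (real n)"
        using ln0 by (simp add: diff_divide_distrib)
      ultimately have "?\<alpha> - d / ln (real n) \<le> ln (real t) / ln (real n)" by simp
      then show ?thesis using enat t'(1) tpos ln0 by (simp add: ln_enat_def)
    qed
  qed
  finally show ?thesis .
qed

text \<open>The strategy is run with \<omega> = ln n, whose contribution ln (ln n) / ln n to the
  exponent tends to 0.\<close>

lemma tau_exponent_le:
  assumes q: "q < 1" and S: "is_strategy r s S"
    and lim: "(\<lambda>n. measure_pmf.prob (semi_random r S n (nat \<lfloor>real n powr \<alpha> * ln (real n)\<rfloor>)) {H. P H}) \<longlonglongrightarrow> 1"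
  shows "tau_exponent r s P q \<le> ereal \<alpha>"
proof -
  let ?t = "\<lambda>n. nat \<lfloor>real n powr \<alpha> * ln (real n)\<rfloor>"
  let ?g = "\<lambda>n. ereal (\<alpha> + ln (ln (real n)) / ln (real n))"
  have ln_top: "filterlim (\<lambda>n. ln (real n)) at_top sequentially"
    by (rule filterlim_compose[OF ln_at_top filterlim_real_sequentially])
  have "(\<lambda>n. \<alpha> + ln (ln (real n)) / ln (real n)) \<longlonglongrightarrow> \<alpha> + 0"
    by (intro tendsto_intros filterlim_compose[OF ln_x_over_x_tendsto_0 ln_top])
  then have g: "?g \<longlonglongrightarrow> ereal \<alpha>" by simp
  have "eventually (\<lambda>n. q < measure_pmf.prob (semi_random r S n (?t n)) {H. P H}) sequentially"
    by (rule order_tendstoD(1)[OF lim q])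
  then have ev: "eventually (\<lambda>n. ln_enat (tau_quantile r s P q n) / ereal (ln (real n)) \<le> ?g n) sequentially"
    using eventually_ge_at_top[of 3]
  proof eventually_elim
    fix n :: nat assume pr: "q < measure_pmf.prob (semi_random r S n (?t n)) {H. P H}" and n: "3 \<le> n"
    have ln0: "ln (real n) > 0" using n by simp
    have "tau_quantile r s P q n \<le> tau_strategy r P S q n"
      unfolding tau_quantile_def using S by (intro INF_lower) simp
    also have "\<dots> \<le> enat (?t n)"
      unfolding tau_strategy_def using pr by (intro Inf_lower) auto
    finally have "ln_enat (tau_quantile r s P q n) \<le> ln_enat (enat (?t n))" by (rule ln_enat_mono)
    also have "\<dots> \<le> ereal (\<alpha> * ln (real n) + ln (ln (real n)))"
    proof (cases "?t n = 0")
      case False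
      have pos: "real n powr \<alpha> * ln (real n) > 0" using n ln0 by simp
      have "ln (real (?t n)) \<le> ln (real n powr \<alpha> * ln (real n))"
        using False pos by (subst ln_le_cancel_iff) auto
      also have "\<dots> = \<alpha> * ln (real n) + ln (ln (real n))" using n ln0 by (simp add: ln_mult ln_powr)
      finally show ?thesis using False by (simp add: ln_enat_def)
    qed (simp add: ln_enat_def)
    finally have "ln_enat (tau_quantile r s P q n) / ereal (ln (real n))
      \<le> ereal (\<alpha> * ln (real n) + ln (ln (real n))) / ereal (ln (real n))"
      using ln0 by (intro ereal_divide_right_mono) auto
    also have "\<dots> = ?g n" using ln0 by (simp add: add_divide_distrib)
    finally show "ln_enat (tau_quantile r s P q n) / ereal (ln (real n)) \<le> ?g n" .
  qed
  have "tau_exponent r s P q \<le> limsup ?g" unfolding tau_exponent_def by (rule Limsup_mono[OF ev])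
  also have "\<dots> = ereal \<alpha>" by (rule lim_imp_Limsup[OF sequentially_bot g])
  finally show ?thesis .
qed

lemma tau_eqI:
  assumes "\<And>q. 0 < q \<Longrightarrow> q < 1 \<Longrightarrow> tau_exponent r s P q = x"
  shows "tau r s P = x"
proof (rule tendsto_unique[OF _ tau_tendsto])
  have "eventually (\<lambda>q. q \<in> {0<..<1::real}) (at_left 1)"
    by (rule eventually_at_left_real) simp
  then have "eventually (\<lambda>q. tau_exponent r s P q = x) (at_left 1)"
    by eventually_elim (simp add: assms)
  then show "(tau_exponent r s P \<longlongrightarrow> x) (at_left 1)" by (rule tendsto_eventually)
qed simp

theorem theorem1p9:
  fixes r s k l :: nat and G :: "'a hypergraph"
  defines "\<alpha> \<equiv> real r - real (k - s + r) / (real ((k - s + r) choose r) + real l)"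
  assumes "r \<ge> 2" and "s > r"
    and "starplus k s (s - r) l G"
    and "real l \<le> (real r * real ((k - s + r) choose r) - real (k - s + r)) / real (k - s)"
  shows "(\<forall>\<omega> :: nat \<Rightarrow> real. filterlim \<omega> at_top sequentially \<longrightarrow>
           (\<exists>S. is_strategy r s S \<and>
              (\<lambda>n. measure_pmf.prob (semi_random r S n (nat \<lfloor>real n powr \<alpha> * \<omega> n\<rfloor>))
                     {H. contains_copy G H}) \<longlonglongrightarrow> 1))
         \<and> tau r s (contains_copy G) = ereal \<alpha>"
proof -
  obtain V E where G: "G = (V, E)" by (cases G)
  let ?m = "k - s + r"
  let ?K = "(?m choose r) + l"
  have r: "1 \<le> r" "r < s" "r \<le> ?m" using assms(2,3) by auto
  have sp: "starplus k s (s - r) l (V, E)" using assms(4) by (simp add: G)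
  obtain A C F h hC where V: "finite V" "card V = k" "s \<le> k"
    and E: "E = {e \<in> subsets_of_size s V. C \<subseteq> e} \<union> F ` {..<l}" "card E = ?K"
    and game: "\<And>n n0 T. 0 < n0 \<Longrightarrow> 0 < T \<Longrightarrow> s - r + ?m * n0 \<le> n \<Longrightarrow> starplus_game r s ?m l n n0 T A V C F h hC"
    by (rule starplus_gameE[OF r(1,2) sp], rule that, assumption+)
  have \<alpha>: "\<alpha> = real r - real ?m / real ?K" by (simp add: \<alpha>_def)
  have l: "real ?m * (real l + 1) \<le> real r * real ?K"
  proof (cases "k = s")
    \<comment> \<open>Division by zero yields 0, so the hypothesis reads \<open>l \<le> 0\<close>;
      moreover m = r and the star has a single edge.\<close>
    case True
    then show ?thesis using assms(5) by simp
  next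
    case False
    then have "real (k - s) > 0" using V(3) by simp
    then have "real l * real (k - s) \<le> real r * real (?m choose r) - real ?m"
      using assms(5) by (simp add: pos_le_divide_eq)
    then show ?thesis by (simp add: algebra_simps)
  qed
  have upper: "\<exists>S. is_strategy r s S \<and>
      (\<lambda>n. measure_pmf.prob (semi_random r S n (nat \<lfloor>real n powr \<alpha> * \<omega> n\<rfloor>)) {H. contains_copy G H}) \<longlonglongrightarrow> 1"
    if \<omega>: "filterlim \<omega> at_top sequentially" for \<omega> :: "nat \<Rightarrow> real"
    unfolding G E(1) \<alpha> by (rule strategy_succeeds[OF game r(1,3) refl l \<omega>])
  have "tau r s (contains_copy G) = ereal \<alpha>"
  proof (rule tau_eqI, rule antisym)
    fix q :: real assume q: "0 < q" "q < 1"
    have "filterlim (\<lambda>n. ln (real n)) at_top sequentially"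
      by (rule filterlim_compose[OF ln_at_top filterlim_real_sequentially])
    from upper[OF this] show "tau_exponent r s (contains_copy G) q \<le> ereal \<alpha>"
      using tau_exponent_le[OF q(2)] by blast
    have Kpos: "0 < ?K" using r by simp
    have edges: "e \<subseteq> V \<and> card e = s" if "e \<in> E" for e
      using sp that by (auto simp: starplus_def full_star_def subsets_of_size_def)
    have "finite E" "E \<noteq> {}" using E(2) Kpos by (auto intro: card_ge_0_finite)
    moreover have "\<Union>E \<subseteq> V" "\<forall>e\<in>E. card e = s" using edges by auto
    ultimately have "\<exists>D>0. \<forall>n\<ge>r. \<forall>S t. measure_pmf.prob (semi_random r S n t) {H. contains_copy (V, E) H}
      \<le> D * real t ^ card E * real n ^ (card V - (s - r)) / real n ^ (r * card E)"
      using V(1) r by (intro prob_contains_copy_le) auto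
    then obtain D where D: "D > 0" "\<forall>n\<ge>r. \<forall>S t. measure_pmf.prob (semi_random r S n t) {H. contains_copy (V, E) H}
      \<le> D * real t ^ card E * real n ^ (card V - (s - r)) / real n ^ (r * card E)"
      by (elim exE conjE)
    have "card V - (s - r) = ?m" using V r by simp
    then show "ereal \<alpha> \<le> tau_exponent r s (contains_copy G) q"
      unfolding \<alpha> using D(2) by (intro tau_exponent_ge[OF q(1) D(1) Kpos]) (simp add: G E(2))
  qed
  with upper show ?thesis by blast
qed

end
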